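(* Let $K$ be a field, $S=K[x_1,\dots,x_n]$, and let $a_1\le a_2\le\cdots\le a_t$ be integers, $t\ge 1$. Let $M\subseteq S$ be a totally reducible ideal that contains a regular sequence $f_1,\dots,f_t$ of homogeneous polynomials with $\deg(f_i)=a_i$ for all $1\le i\le t$. If $I$ is a graded ideal of $S$ with $M\subseteq I$, then there exists a graded ideal $J$ of $S$ containing $x_1^{a_1},\dots,x_t^{a_t}$ such that $I$ and $J$ have the same Hilbert function, i.e. $H(S/I,d)=H(S/J,d)$ for all $d\ge 0$.
   Context: $S=K[x_1,\dots,x_n]$ has the standard grading with $\deg x_i=1$. A graded (homogeneous) ideal is a proper ideal of $S$ generated by homogeneous elements. A graded ideal is called totally reducible if it is generated by products of linear forms (each generator is a product of elements of $S_1$). For a graded ideal $I$, $H(S/I,d)=\dim_K (S_d/I_d)$, and the sequence $\{H(S/I,d)\}_{d\ge 0}$ is the Hilbert function of $I$ (or of $S/I$). *)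

theory Defs
  imports Complex_Main "HOL-Library.Poly_Mapping" "HOL-Library.Cardinality"
begin

section \<open>Dimension of a quotient space\<close>

text \<open>\<open>quot_basis scale V W B\<close>: the residue classes of the elements of \<open>B\<close> form a finite basis
  of \<open>V / W\<close>. The classes are pairwise distinct by the independence condition, so \<open>card B\<close>
  is the number of basis vectors.\<close>

definition quot_basis ::
    "('a::field \<Rightarrow> 'b::ab_group_add \<Rightarrow> 'b) \<Rightarrow> 'b set \<Rightarrow> 'b set \<Rightarrow> 'b set \<Rightarrow> bool" where
  "quot_basis scale V W B \<longleftrightarrow> finite B \<and> B \<subseteq> V \<and>
     (\<forall>c. (\<Sum>b\<in>B. scale (c b) b) \<in> W \<longrightarrow> (\<forall>b\<in>B. c b = 0)) \<and>
     (\<forall>v\<in>V. \<exists>c. v - (\<Sum>b\<in>B. scale (c b) b) \<in> W)"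

definition quot_dim ::
    "('a::field \<Rightarrow> 'b::ab_group_add \<Rightarrow> 'b) \<Rightarrow> 'b set \<Rightarrow> 'b set \<Rightarrow> nat" where
  "quot_dim scale V W = (THE k. \<exists>B. quot_basis scale V W B \<and> card B = k)"

context vector_space
begin

lemma quot_basis_card:
  assumes V: "subspace V" and W: "subspace W" "W \<subseteq> V" and fin: "finite A" "V \<subseteq> span A"
    and B: "quot_basis scale V W B"
  shows "card B + dim W = dim V"
proof -
  obtain C where C: "C \<subseteq> W" "independent C" "W \<subseteq> span C" "card C = dim W"
    using basis_exists[of W] by blast
  have finC: "finite C"
    using independent_span_bound[OF fin(1) C(2)] C(1) W(2) fin(2) by blast
  have finB: "finite B" and BV: "B \<subseteq> V"
    and ind: "\<And>c. (\<Sum>b\<in>B. c b *s b) \<in> W \<Longrightarrow> (\<forall>b\<in>B. c b = 0)"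
    and gen: "\<And>v. v \<in> V \<Longrightarrow> \<exists>c. v - (\<Sum>b\<in>B. c b *s b) \<in> W"
    using B by (auto simp: quot_basis_def)
  have disj: "B \<inter> C = {}"
  proof (rule ccontr)
    assume "B \<inter> C \<noteq> {}"
    then obtain x where x: "x \<in> B" "x \<in> C" by blast
    have "(\<Sum>b\<in>B. (if b = x then 1 else 0) *s b) = (\<Sum>b\<in>B. if b = x then x else 0)"
      by (rule sum.cong) auto
    also have "\<dots> = x" using finB x by simp
    finally have eq: "(\<Sum>b\<in>B. (if b = x then 1 else 0) *s b) = x" .
    have "(\<Sum>b\<in>B. (if b = x then 1 else 0) *s b) \<in> W"
      unfolding eq using x(2) C(1) by blast
    from bspec[OF ind[OF this] x(1)] show False by simp
  qed
  have "independent (B \<union> C)"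
  proof
    assume "dependent (B \<union> C)"
    then obtain u where u: "(\<Sum>v\<in>B \<union> C. u v *s v) = 0" "\<exists>v\<in>B \<union> C. u v \<noteq> 0"
      using dependent_finite[of "B \<union> C"] finB finC by auto
    have eq: "(\<Sum>v\<in>B. u v *s v) = - (\<Sum>v\<in>C. u v *s v)"
      using u(1) disj finB finC by (simp add: sum.union_disjoint eq_neg_iff_add_eq_0)
    have "(\<Sum>v\<in>C. u v *s v) \<in> W"
      using C(1) W(1) by (auto intro!: subspace_sum subspace_scale)
    then have "(\<Sum>v\<in>B. u v *s v) \<in> W" using eq subspace_neg[OF W(1)] by simp
    then have 0: "\<forall>b\<in>B. u b = 0" using ind by blast
    then have "(\<Sum>v\<in>C. u v *s v) = 0" using eq by simp
    then have "\<forall>b\<in>C. u b = 0" using C(2) finC dependent_finite[of C] by auto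
    with 0 u(2) show False by blast
  qed
  moreover have "V \<subseteq> span (B \<union> C)"
  proof
    fix v assume "v \<in> V"
    then obtain c where c: "v - (\<Sum>b\<in>B. c b *s b) \<in> W" using gen by blast
    have 1: "v - (\<Sum>b\<in>B. c b *s b) \<in> span (B \<union> C)"
      using c C(3) span_mono[of C "B \<union> C"] by blast
    have 2: "(\<Sum>b\<in>B. c b *s b) \<in> span (B \<union> C)"
      by (intro span_sum span_scale span_base) auto
    show "v \<in> span (B \<union> C)" using span_add[OF 1 2] by simp
  qed
  moreover have "B \<union> C \<subseteq> V" using BV C(1) W(2) by blast
  ultimately have "card (B \<union> C) = dim V" using basis_card_eq_dim by blast
  then show ?thesis using card_Un_disjoint[OF finB finC disj] C(4) by simp
qed

lemma quot_basis_exists: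
  assumes V: "subspace V" and W: "subspace W" "W \<subseteq> V" and fin: "finite A" "V \<subseteq> span A"
  shows "\<exists>B. quot_basis scale V W B"
proof -
  obtain C where C: "C \<subseteq> W" "independent C" "W \<subseteq> span C"
    by (rule basis_exists[of W])
  obtain D where D: "C \<subseteq> D" "D \<subseteq> V" "independent D" "V \<subseteq> span D"
    by (rule maximal_independent_subset_extend[OF order_trans[OF C(1) W(2)] C(2)])
  have finD: "finite D"
    using independent_span_bound[OF fin(1) D(3) order_trans[OF D(2) fin(2)]] by (rule conjunct1)
  have CW: "span C = W" using span_minimal[OF C(1) W(1)] C(3) by (rule equalityI)
  define B where "B = D - C"
  have fB: "finite B" "finite C" using finD D(1) finite_subset by (auto simp: B_def)
  have DBC: "D = B \<union> C" "B \<inter> C = {}" using D(1) by (auto simp: B_def)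
  have "\<forall>b\<in>B. c b = 0" if c: "(\<Sum>b\<in>B. c b *s b) \<in> W" for c
  proof -
    obtain u where u: "(\<Sum>b\<in>B. c b *s b) = (\<Sum>b\<in>C. u b *s b)"
      using c CW span_finite[OF fB(2)] by auto
    let ?w = "\<lambda>v. if v \<in> B then c v else - u v"
    have "(\<Sum>v\<in>D. ?w v *s v) = (\<Sum>v\<in>B. ?w v *s v) + (\<Sum>v\<in>C. ?w v *s v)"
      unfolding DBC(1) by (rule sum.union_disjoint) (use fB DBC(2) in auto)
    also have "(\<Sum>v\<in>B. ?w v *s v) = (\<Sum>b\<in>B. c b *s b)" by (rule sum.cong) auto
    also have "(\<Sum>v\<in>C. ?w v *s v) = (\<Sum>b\<in>C. - (u b *s b))"
      by (rule sum.cong) (use DBC(2) in auto)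
    finally have "(\<Sum>v\<in>D. ?w v *s v) = 0" using u by (simp add: sum_negf)
    then have w: "?w v = 0" if "v \<in> D" for v
      by (rule independentD[OF D(3) finD order_refl _ that])
    show ?thesis
    proof
      fix b assume "b \<in> B"
      then show "c b = 0" using w[of b] DBC(1) by simp
    qed
  qed
  moreover have "\<exists>c. v - (\<Sum>b\<in>B. c b *s b) \<in> W" if v: "v \<in> V" for v
  proof -
    obtain u where u: "v = (\<Sum>b\<in>D. u b *s b)"
      using subsetD[OF D(4) v] unfolding span_finite[OF finD] by auto
    have "v = (\<Sum>b\<in>B. u b *s b) + (\<Sum>b\<in>C. u b *s b)"
      unfolding u DBC(1) by (rule sum.union_disjoint) (use fB DBC(2) in auto)
    then have "v - (\<Sum>b\<in>B. u b *s b) = (\<Sum>b\<in>C. u b *s b)" by simp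
    moreover have "(\<Sum>b\<in>C. u b *s b) \<in> W"
      using C(1) W(1) by (auto intro!: subspace_sum subspace_scale)
    ultimately show ?thesis by metis
  qed
  ultimately have "quot_basis scale V W B"
    using fB D(2) by (auto simp: quot_basis_def B_def)
  then show ?thesis ..
qed

lemma quot_dim_eq:
  assumes "subspace V" "subspace W" "W \<subseteq> V" "finite A" "V \<subseteq> span A"
  shows "quot_dim scale V W + dim W = dim V"
proof -
  obtain B where B: "quot_basis scale V W B" using quot_basis_exists[OF assms] by blast
  have "card B' = card B" if "quot_basis scale V W B'" for B'
    using quot_basis_card[OF assms that] quot_basis_card[OF assms B] by linarith
  then have "quot_dim scale V W = card B"
    unfolding quot_dim_def using B by (intro the_equality) blast+
  then show ?thesis using quot_basis_card[OF assms B] by simp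
qed

end


section \<open>The polynomial ring\<close>

text \<open>With the convolution product of \<open>poly_mapping\<close>, this is the polynomial ring over \<open>'k\<close> in
  the variables indexed by \<open>'n\<close>; exponent vectors are elements of \<open>'n \<Rightarrow>\<^sub>0 nat\<close>.\<close>

type_synonym ('n, 'k) mpoly = "('n \<Rightarrow>\<^sub>0 nat) \<Rightarrow>\<^sub>0 'k"

definition Var :: "'n \<Rightarrow> ('n, 'k::comm_ring_1) mpoly" where
  "Var i = Poly_Mapping.single (Poly_Mapping.single i 1) 1"

definition const_mult :: "'k \<Rightarrow> ('n, 'k) mpoly \<Rightarrow> ('n, 'k::comm_ring_1) mpoly" where
  "const_mult c p = Poly_Mapping.single 0 c * p"

global_interpretation mpoly: vector_space
  "const_mult :: 'k::field \<Rightarrow> ('n, 'k) mpoly \<Rightarrow> ('n, 'k) mpoly"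
  by standard
    (simp_all add: const_mult_def distrib_left distrib_right single_add mult_single flip: mult.assoc)

text \<open>Ideals of a commutative ring are the submodules of the ring over itself.\<close>

global_interpretation ideal: module "(*) :: 'a::comm_ring_1 \<Rightarrow> 'a \<Rightarrow> 'a"
  by standard (simp_all add: distrib_left distrib_right mult.assoc)

declare ideal.scale_scale [simp del]

definition mdeg :: "('n::finite \<Rightarrow>\<^sub>0 nat) \<Rightarrow> nat" where
  "mdeg m = (\<Sum>i\<in>UNIV. Poly_Mapping.lookup m i)"

text \<open>The graded component \<open>S\<^sub>d\<close>; it contains 0.\<close>

definition forms :: "nat \<Rightarrow> ('n::finite, 'k::comm_ring_1) mpoly set" where
  "forms d = {p. \<forall>m\<in>Poly_Mapping.keys p. mdeg m = d}"

definition graded_ideal :: "('n::finite, 'k::comm_ring_1) mpoly set \<Rightarrow> bool" where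
  "graded_ideal I \<longleftrightarrow> I \<noteq> UNIV \<and> (\<exists>G \<subseteq> (\<Union>d. forms d). I = ideal.span G)"

definition totally_reducible :: "('n::finite, 'k::comm_ring_1) mpoly set \<Rightarrow> bool" where
  "totally_reducible I \<longleftrightarrow> graded_ideal I \<and>
     (\<exists>G. (\<forall>g\<in>G. \<exists>ls. set ls \<subseteq> forms 1 \<and> g = prod_list ls) \<and> I = ideal.span G)"

definition regular_sequence :: "nat \<Rightarrow> (nat \<Rightarrow> 'a::comm_ring_1) \<Rightarrow> bool" where
  "regular_sequence t f \<longleftrightarrow> ideal.span (f ` {1..t}) \<noteq> UNIV \<and>
     (\<forall>i\<in>{1..t}. \<forall>g. f i * g \<in> ideal.span (f ` {1..<i}) \<longrightarrow> g \<in> ideal.span (f ` {1..<i}))"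

definition hilbert :: "('n::finite, 'k::field) mpoly set \<Rightarrow> nat \<Rightarrow> nat" where
  "hilbert I d = quot_dim const_mult (forms d) (I \<inter> forms d)"


section \<open>The Hilbert function is well defined\<close>

lemma finite_mdeg: "finite {m :: 'n::finite \<Rightarrow>\<^sub>0 nat. mdeg m = d}"
proof (rule finite_imageD)
  have "Poly_Mapping.lookup m i \<le> d" if "mdeg m = d" for m :: "'n \<Rightarrow>\<^sub>0 nat" and i
    using that member_le_sum[of i UNIV "Poly_Mapping.lookup m"] by (simp add: mdeg_def)
  then have "Poly_Mapping.lookup ` {m :: 'n \<Rightarrow>\<^sub>0 nat. mdeg m = d} \<subseteq>
      {f. \<forall>i. (i \<in> UNIV \<longrightarrow> f i \<in> {..d}) \<and> (i \<notin> UNIV \<longrightarrow> f i = 0)}" by auto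
  then show "finite (Poly_Mapping.lookup ` {m :: 'n \<Rightarrow>\<^sub>0 nat. mdeg m = d})"
    by (rule finite_subset) (rule finite_set_of_finite_funs; simp)
  show "inj_on Poly_Mapping.lookup {m :: 'n \<Rightarrow>\<^sub>0 nat. mdeg m = d}"
    by (rule inj_onI) (simp add: lookup_inject)
qed

lemma subspace_forms: "mpoly.subspace (forms d :: ('n::finite, 'k::field) mpoly set)"
proof (rule mpoly.subspaceI)
  fix c and p :: "('n, 'k) mpoly" assume "p \<in> forms d"
  moreover have "Poly_Mapping.keys (Poly_Mapping.single 0 c * p) \<subseteq> Poly_Mapping.keys p"
    using keys_mult[of "Poly_Mapping.single 0 c" p] by (auto split: if_splits)
  ultimately show "const_mult c p \<in> forms d" by (auto simp: forms_def const_mult_def)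
next
  fix p q :: "('n, 'k) mpoly" assume "p \<in> forms d" "q \<in> forms d"
  then show "p + q \<in> forms d" using Poly_Mapping.keys_add[of p q] by (auto simp: forms_def)
qed (simp add: forms_def)

lemma forms_subset_span:
  "forms d \<subseteq> mpoly.span ((\<lambda>m. Poly_Mapping.single m 1) ` {m :: 'n::finite \<Rightarrow>\<^sub>0 nat. mdeg m = d}
     :: ('n, 'k::field) mpoly set)" (is "_ \<subseteq> mpoly.span ?A")
proof
  fix p :: "('n, 'k) mpoly" assume p: "p \<in> forms d"
  have "p = (\<Sum>m\<in>Poly_Mapping.keys p. Poly_Mapping.single m (Poly_Mapping.lookup p m))"
    by (rule poly_mapping_eqI) (auto simp: lookup_sum lookup_single when_def in_keys_iff)
  also have "\<dots> = (\<Sum>m\<in>Poly_Mapping.keys p.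
      const_mult (Poly_Mapping.lookup p m) (Poly_Mapping.single m 1))"
    by (simp add: const_mult_def mult_single)
  also have "\<dots> \<in> mpoly.span ?A"
    using p by (intro mpoly.span_sum mpoly.span_scale mpoly.span_base) (auto simp: forms_def)
  finally show "p \<in> mpoly.span ?A" .
qed

lemma hilbert_eq:
  fixes I :: "('n::finite, 'k::field) mpoly set"
  assumes "ideal.subspace I"
  shows "hilbert I d + mpoly.dim (I \<inter> forms d) = mpoly.dim (forms d :: ('n, 'k) mpoly set)"
proof -
  have "mpoly.subspace I"
    using assms by (auto simp: mpoly.subspace_def ideal.subspace_def const_mult_def)
  then have "mpoly.subspace (I \<inter> forms d)"
    using subspace_forms by (rule mpoly.subspace_inter)
  from mpoly.quot_dim_eq[OF subspace_forms this _ _ forms_subset_span] finite_mdeg show ?thesis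
    by (auto simp: hilbert_def)
qed

end

theory Submission
  imports Defs "HOL-Library.FuncSet"
begin

text \<open>Let \<open>\<Lambda>\<close> be a space of linear forms inside \<open>I\<close>; think of \<open>S/\<Lambda>\<close> as a polynomial ring in fewer variables.
  A product \<open>l\<^sub>1 \<dots> l\<^sub>m \<in> I\<close> of linear forms outside \<open>\<Lambda>\<close> splits the Hilbert function as
  \<open>H(S/I, e) = \<Sum>\<^sub>k H(S/W\<^sub>k, e - k)\<close> with \<open>W\<^sub>k = (I : l\<^sub>1 \<dots> l\<^sub>k) + (l\<^sub>k\<^sub>+\<^sub>1)\<close>. By induction the \<open>W\<^sub>k\<close> grow like
  lex segments in one variable less. If the factors are ordered greedily with respect to a fixed degree \<open>d\<close>,
  these segments can be stacked as the slices \<open>x\<^sub>1\<^sup>k \<cdot> (\<dots>)\<close> of a set of monomials whose shadow has the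
  right size, and the Clements--Lindstroem theorem replaces that set by a lex segment. Applied for every \<open>d\<close>, this
  yields the monomial ideal \<open>J\<close>.

  The regular sequence enters only through a codimension condition: a space \<open>L\<close> of linear forms that
  contains a factor of every product in \<open>M\<close> of degree at most \<open>a\<^sub>i\<close> generates an ideal containing
  \<open>f\<^sub>1, \<dots>, f\<^sub>i\<close>, and so has dimension at least \<open>i\<close>. This condition passes from \<open>\<Lambda>\<close> to \<open>\<Lambda> + K l\<close>, dropping
  the smallest degree.\<close>

section \<open>Lex segments and shadows in boxes of exponent vectors\<close>

text \<open>Multiplying by \<open>x\<^sub>1\<close> sends slice \<open>k\<close> in degree
  \<open>d\<close> to slice \<open>k + 1\<close> in degree \<open>d + 1\<close>, with the same
  degree \<open>d - k\<close> in the other variables. Stacking therefore asks for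
  \<open>hilbert (W (Suc k)) (d - k) \<le> hilbert (W k) (d - k)\<close>. The greedy order provides
  it: the factor used in \<open>W (Suc k)\<close> was also a candidate for \<open>W k\<close>, where
  the colon ideal was smaller. The good order changes with \<open>d\<close>, so no single stacked
  set serves all degrees. What survives is a numerical bound from each degree to the next, and the
  nesting of lex segments turns these separate bounds into one ideal.

  The smallest degree is spent at each stage because it is the number of layers, hence the exponent
  bound of the variable that is split off.

  The codimension bound is a comparison of growth. Each member of a regular sequence lowers the
  order of growth of the Hilbert function by one, and a linear form lowers it by at most one; so
  fewer than \<open>i\<close> linear forms cannot generate an ideal containing
  \<open>f\<^sub>1, ..., f\<^sub>i\<close>.\<close>

definition box :: "nat \<Rightarrow> (nat \<Rightarrow> nat) \<Rightarrow> nat \<Rightarrow> (nat \<Rightarrow> nat) set" where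
  "box n c d = {w. (\<forall>i<n. w i < c i) \<and> (\<forall>i\<ge>n. w i = 0) \<and> (\<Sum>i<n. w i) = d}"

definition shadow :: "nat \<Rightarrow> (nat \<Rightarrow> nat) \<Rightarrow> (nat \<Rightarrow> nat) set \<Rightarrow> (nat \<Rightarrow> nat) set" where
  "shadow n c A = {w(k := Suc (w k)) | w k. w \<in> A \<and> k < n \<and> Suc (w k) < c k}"

text \<open>\<open>less_fun\<close> decides at the first difference, so variable \<open>0\<close> is
  the largest one. These are the lex segments, taken from the top, among the monomials that do not
  vanish when the power \<open>c i\<close> of each variable \<open>i\<close> is set to zero.\<close>

definition lexup :: "nat \<Rightarrow> (nat \<Rightarrow> nat) \<Rightarrow> nat \<Rightarrow> (nat \<Rightarrow> nat) set \<Rightarrow> bool" where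
  "lexup n c d A \<longleftrightarrow> A \<subseteq> box n c d \<and> (\<forall>w\<in>A. \<forall>u\<in>box n c d. less_fun w u \<longrightarrow> u \<in> A)"

text \<open>Strong stability relative to the bounds: an exchange towards an earlier variable is
  demanded only if it stays inside the box.\<close>

definition stable :: "nat \<Rightarrow> (nat \<Rightarrow> nat) \<Rightarrow> (nat \<Rightarrow> nat) set \<Rightarrow> bool" where
  "stable n c A \<longleftrightarrow> (\<forall>w\<in>A. \<forall>j<n. \<forall>i<j. 0 < w j \<longrightarrow> Suc (w i) < c i \<longrightarrow>
     w(i := Suc (w i), j := w j - 1) \<in> A)"

lemma box_less: "w \<in> box n c d \<Longrightarrow> i < n \<Longrightarrow> w i < c i"
  by (simp add: box_def)

lemma box_zero: "w \<in> box n c d \<Longrightarrow> n \<le> i \<Longrightarrow> w i = 0"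
  by (simp add: box_def)

lemma finite_box [simp]: "finite (box n c d)"
proof -
  have "box n c d \<subseteq> {w. \<forall>i. (i \<in> {..<n} \<longrightarrow> w i \<in> {..d}) \<and> (i \<notin> {..<n} \<longrightarrow> w i = 0)}"
  proof
    fix w assume w: "w \<in> box n c d"
    have "w i \<le> d" if "i < n" for i
    proof -
      have "w i \<le> (\<Sum>i<n. w i)" using that by (metis finite_lessThan lessThan_iff member_le_sum zero_le)
      then show ?thesis using w by (simp add: box_def)
    qed
    then show "w \<in> {w. \<forall>i. (i \<in> {..<n} \<longrightarrow> w i \<in> {..d}) \<and> (i \<notin> {..<n} \<longrightarrow> w i = 0)}"
      using w by (auto simp: box_def)
  qed
  then show ?thesis by (rule finite_subset) (rule finite_set_of_finite_funs; simp)
qed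

lemma finite_subset_box: "A \<subseteq> box n c d \<Longrightarrow> finite A"
  by (rule finite_subset[OF _ finite_box])

lemma sum_bump:
  fixes w :: "nat \<Rightarrow> nat"
  assumes "k < n" shows "(\<Sum>i<n. (w(k := x)) i) + w k = (\<Sum>i<n. w i) + x"
proof -
  have *: "{..<n} = insert k ({..<n} - {k})" using assms by auto
  have "(\<Sum>i<n. (w(k := x)) i) = x + (\<Sum>i\<in>{..<n} - {k}. w i)"
    by (subst *, subst sum.insert) (auto intro: sum.cong)
  moreover have "(\<Sum>i<n. w i) = w k + (\<Sum>i\<in>{..<n} - {k}. w i)"
    by (subst *, subst sum.insert) auto
  ultimately show ?thesis by simp
qed

lemma box_bump:
  assumes "w \<in> box n c d" "k < n" "Suc (w k) < c k"
  shows "w(k := Suc (w k)) \<in> box n c (Suc d)"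
  using assms sum_bump[of k n w "Suc (w k)"] by (auto simp: box_def)

lemma box_unbump:
  assumes "u \<in> box n c (Suc d)" "0 < u k"
  shows "k < n" "u(k := u k - 1) \<in> box n c d" "u = (u(k := u k - 1))(k := Suc ((u(k := u k - 1)) k))"
proof -
  show k: "k < n" using assms by (force simp: box_def intro: ccontr)
  show "u(k := u k - 1) \<in> box n c d"
    using assms sum_bump[of k n u "u k - 1"] k by (force simp: box_def)
  show "u = (u(k := u k - 1))(k := Suc ((u(k := u k - 1)) k))" using assms by auto
qed

lemma box_move:
  assumes "w \<in> box n c d" "i < j" "j < n" "0 < w j" "Suc (w i) < c i"
  shows "w(i := Suc (w i), j := w j - 1) \<in> box n c d"
proof -
  have "w(i := Suc (w i)) \<in> box n c (Suc d)" using assms by (intro box_bump) auto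
  from box_unbump(2)[OF this, of j] assms show ?thesis by (auto simp: fun_upd_twist)
qed

lemma shadow_subset_box: "A \<subseteq> box n c d \<Longrightarrow> shadow n c A \<subseteq> box n c (Suc d)"
  unfolding shadow_def using box_bump by blast

lemma shadowI: "w \<in> A \<Longrightarrow> k < n \<Longrightarrow> Suc (w k) < c k \<Longrightarrow> w(k := Suc (w k)) \<in> shadow n c A"
  unfolding shadow_def by blast

section \<open>The lexicographic order and its segments\<close>

lemma less_fun_cases:
  fixes u v :: "nat \<Rightarrow> nat"
  obtains "less_fun u v" | "u = v" | "less_fun v u"
proof (cases "u = v")
  case False
  then obtain i where "u i \<noteq> v i" by blast
  then have ne: "u (LEAST i. u i \<noteq> v i) \<noteq> v (LEAST i. u i \<noteq> v i)" by (rule LeastI)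
  define i0 where "i0 = (LEAST i. u i \<noteq> v i)"
  have eq: "\<forall>j<i0. u j = v j" unfolding i0_def using not_less_Least by blast
  have "u i0 < v i0 \<or> v i0 < u i0" using ne unfolding i0_def by linarith
  then have "less_fun u v \<or> less_fun v u" unfolding less_fun_def using eq by metis
  then show ?thesis using that by blast
qed (use that in auto)

lemma lexup_linear:
  assumes "lexup n c d A" "lexup n c d B"
  shows "A \<subseteq> B \<or> B \<subseteq> A"
proof (rule ccontr)
  assume "\<not> ?thesis"
  then obtain x y where "x \<in> A" "x \<notin> B" "y \<in> B" "y \<notin> A" by blast
  moreover have "x \<in> box n c d" "y \<in> box n c d" using calculation assms by (auto simp: lexup_def)
  ultimately show False using assms unfolding lexup_def by (metis less_fun_cases[of x y])
qed

lemma lexup_finite: "lexup n c d A \<Longrightarrow> finite A"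
  by (auto simp: lexup_def intro: finite_subset_box)

lemma lexup_subset_iff:
  assumes "lexup n c d A" "lexup n c d B"
  shows "A \<subseteq> B \<longleftrightarrow> card A \<le> card B"
  using lexup_linear[OF assms] lexup_finite[OF assms(1)] lexup_finite[OF assms(2)]
  by (metis card_mono card_seteq subset_refl)

lemma lexup_exists:
  assumes "m \<le> card (box n c d)"
  shows "\<exists>A. lexup n c d A \<and> card A = m"
  using assms
proof (induction m)
  case 0
  show ?case by (intro exI[of _ "{}"]) (auto simp: lexup_def)
next
  case (Suc m)
  then obtain A where A: "lexup n c d A" "card A = m" by auto
  have ne: "box n c d - A \<noteq> {}" using A Suc.prems card_mono[OF lexup_finite[OF A(1)], of "box n c d"] by force
  have "asymp_on (box n c d - A) less_fun"
    by (rule asymp_onI) (auto dest: less_fun_asym)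
  moreover have "transp_on (box n c d - A) less_fun"
    by (rule transp_onI) (blast intro: less_fun_trans)
  ultimately obtain x where x: "x \<in> box n c d - A" "\<forall>y\<in>box n c d - A. y \<noteq> x \<longrightarrow> \<not> less_fun x y"
    using Finite_Set.bex_max_element[OF _ _ _ ne, of less_fun] by auto
  have "lexup n c d (insert x A)"
    unfolding lexup_def
  proof (intro conjI ballI impI)
    show "insert x A \<subseteq> box n c d" using A x by (auto simp: lexup_def)
    fix w u assume "w \<in> insert x A" "u \<in> box n c d" "less_fun w u"
    then show "u \<in> insert x A" using A(1) x(2) by (auto simp: lexup_def)
  qed
  moreover have "card (insert x A) = Suc m" using A x lexup_finite[OF A(1)] by auto
  ultimately show ?case by blast
qed

lemma lexup_stable: "lexup n c d A \<Longrightarrow> stable n c A"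
  unfolding stable_def
proof (intro ballI allI impI)
  fix w i j assume A: "lexup n c d A" and w: "w \<in> A" "j < n" "i < j" "0 < w j" "Suc (w i) < c i"
  have "less_fun w (w(i := Suc (w i), j := w j - 1))"
    unfolding less_fun_def using w by (intro exI[of _ i]) auto
  moreover have "w(i := Suc (w i), j := w j - 1) \<in> box n c d"
    using A w by (intro box_move) (auto simp: lexup_def)
  ultimately show "w(i := Suc (w i), j := w j - 1) \<in> A" using A w by (auto simp: lexup_def)
qed

lemma less_fun_boxD:
  assumes "less_fun u u'" "u \<in> box n c d" "u' \<in> box n c d"
  obtains i where "i < n" "u i < u' i" "\<And>j. j < i \<Longrightarrow> u j = u' j" "(\<Sum>j\<in>{i..<n}. u j) = (\<Sum>j\<in>{i..<n}. u' j)"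
proof -
  obtain i where i: "u i < u' i" "\<And>j. j < i \<Longrightarrow> u j = u' j"
    using assms(1) by (auto simp: less_fun_def)
  have "i < n" using i assms(3) by (force simp: box_def intro: ccontr)
  have *: "(\<Sum>j<n. w j) = (\<Sum>j<i. w j) + (\<Sum>j\<in>{i..<n}. w j)" for w :: "nat \<Rightarrow> nat"
    using \<open>i < n\<close> sum.atLeastLessThan_concat[of 0 i n w] by (simp add: lessThan_atLeast0)
  have "(\<Sum>j<i. u j) = (\<Sum>j<i. u' j)" using i by (intro sum.cong) auto
  then have "(\<Sum>j\<in>{i..<n}. u j) = (\<Sum>j\<in>{i..<n}. u' j)"
    using *[of u] *[of u'] assms by (auto simp: box_def)
  with i \<open>i < n\<close> show ?thesis using that by blast
qed

text \<open>For \<open>u'\<close> lex-above \<open>u = w x\<^sub>k\<close>, some quotient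
  \<open>u' / x\<^sub>m\<close> is equal to \<open>w\<close> or lex-above it. Dividing by a variable
  after the first difference preserves the difference; where there is none, equality of degrees
  settles the tie.\<close>

lemma lexup_shadow:
  assumes L: "lexup n c d L" shows "lexup n c (Suc d) (shadow n c L)"
  unfolding lexup_def
proof (intro conjI ballI impI)
  show sub: "shadow n c L \<subseteq> box n c (Suc d)" using L by (intro shadow_subset_box) (auto simp: lexup_def)
  fix u u' assume u: "u \<in> shadow n c L" and u': "u' \<in> box n c (Suc d)" and less: "less_fun u u'"
  obtain w k where w: "w \<in> L" "k < n" "Suc (w k) < c k" "u = w(k := Suc (w k))"
    using u by (auto simp: shadow_def)
  have wb: "w \<in> box n c d" using w L by (auto simp: lexup_def)
  obtain i where i: "i < n" "u i < u' i" "\<And>j. j < i \<Longrightarrow> u j = u' j"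
      "(\<Sum>j\<in>{i..<n}. u j) = (\<Sum>j\<in>{i..<n}. u' j)"
    using less_fun_boxD[OF less subsetD[OF sub u] u'] by metis
  \<comment> \<open>\<open>m = i\<close> is chosen only if \<open>u'\<close> involves no variable
    after \<open>i\<close>; the third fact records this for the tie below.\<close>
  obtain m where m: "i \<le> m" "0 < u' m" "m = i \<Longrightarrow> (\<forall>j>i. u' j = 0)"
  proof (cases "\<exists>j>i. 0 < u' j")
    case True
    then obtain j where "j > i" "0 < u' j" by blast
    then show ?thesis using that[of j] by simp
  next
    case False
    then show ?thesis using that[of i] i(2) by simp
  qed
  define v where "v = u'(m := u' m - 1)"
  have v: "v \<in> box n c d" "m < n" "u' = v(m := Suc (v m))"
    using box_unbump[OF u' m(2)] unfolding v_def by blast+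
  have "less_fun w v \<or> w = v"
  proof (cases "k < i")
    case True
    then have "u k = u' k" using i by auto
    then have "w k < v k" using True m(1) w by (simp add: v_def)
    moreover have "w j = v j" if "j < k" for j
      using i(3)[of j] that True m(1) w by (simp add: v_def)
    ultimately show ?thesis unfolding less_fun_def by blast
  next
    case False
    show ?thesis
    proof (cases "w i < v i")
      case True
      moreover have "w j = v j" if "j < i" for j
        using i(3)[of j] that m(1) w False by (simp add: v_def)
      ultimately show ?thesis unfolding less_fun_def by blast
    next
      case False2: False
      \<comment> \<open>The tie: the division happened at \<open>i\<close> and \<open>v\<close>
        vanishes after \<open>i\<close>, so equal degrees force \<open>w\<close> to vanish there as
        well.\<close>
      have wle: "w i \<le> u i" using w by auto
      have mi: "m = i" using False2 i(2) wle unfolding v_def by (auto split: if_splits)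
      have vi: "v i = u i" "w i = v i" using False2 i(2) wle mi unfolding v_def by auto
      have vz: "\<forall>j>i. v j = 0" using m(3) mi unfolding v_def by auto
      have less_i: "w j = v j" if "j < i" for j
        using i(3)[OF that] w that False mi unfolding v_def by auto
      have split: "(\<Sum>j<n. x j) = (\<Sum>j\<in>{..i}. x j) + (\<Sum>j\<in>{i<..<n}. x j)" for x :: "nat \<Rightarrow> nat"
      proof -
        have "{..<n} = {..i} \<union> {i<..<n}" using i(1) by auto
        moreover have "sum x ({..i} \<union> {i<..<n}) = sum x {..i} + sum x {i<..<n}"
          by (rule sum.union_disjoint) auto
        ultimately show ?thesis by metis
      qed
      have "(\<Sum>j\<in>{..i}. w j) = (\<Sum>j\<in>{..i}. v j)" using less_i vi by (intro sum.cong) (auto simp: le_less)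
      then have "(\<Sum>j\<in>{i<..<n}. w j) = (\<Sum>j\<in>{i<..<n}. v j)"
        using split[of w] split[of v] wb v(1) by (auto simp: box_def)
      also have "\<dots> = 0" using vz by auto
      finally have "\<forall>j\<in>{i<..<n}. w j = 0" by simp
      then have "w j = v j" if "j > i" for j
        using vz that wb by (cases "j < n") (auto simp: box_def)
      then have "w = v" using less_i vi(2) by (metis ext linorder_less_linear)
      then show ?thesis by simp
    qed
  qed
  then have "v \<in> L" using L w(1) v(1) unfolding lexup_def by metis
  moreover have "u' m < c m" using u' v(2) by (simp add: box_def)
  then have "Suc (v m) < c m" using m(2) by (simp add: v_def)
  ultimately show "u' \<in> shadow n c L" by (subst v(3)) (rule shadowI[OF _ v(2)])
qed

section \<open>Compression in two variables\<close>

definition new_count :: "(nat \<Rightarrow> nat) \<Rightarrow> (nat \<Rightarrow> nat) set \<Rightarrow> nat \<Rightarrow> nat" where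
  "new_count c A k = card {w \<in> A. (\<forall>j>k. w j = 0) \<and> Suc (w k) < c k}"

text \<open>Each \<open>u\<close> in the shadow of a stable set arises exactly once as \<open>u = w x\<^sub>k\<close> with \<open>w \<in> A\<close> and
  \<open>k\<close> the last variable occurring in \<open>u\<close>.\<close>

lemma card_shadow_stable:
  assumes st: "stable n c A" and A: "A \<subseteq> box n c d"
  shows "card (shadow n c A) = (\<Sum>k<n. new_count c A k)"
proof -
  define X where "X k = {w \<in> A. (\<forall>j>k. w j = 0) \<and> Suc (w k) < c k}" for k
  define b where "b k w = w(k := Suc (w k))" for k and w :: "nat \<Rightarrow> nat"
  have finX: "finite (X k)" for k using finite_subset_box[OF A] by (simp add: X_def)
  have inj: "inj_on (b k) (X k)" for k
  proof (rule inj_onI)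
    fix v w assume "b k v = b k w"
    then have *: "(b k v) j = (b k w) j" for j by simp
    show "v = w"
    proof
      fix j show "v j = w j" using *[of j] by (cases "j = k") (auto simp: b_def)
    qed
  qed
  have supp: "0 < u k \<and> (\<forall>j>k. u j = 0)" if "u \<in> b k ` X k" for u k
    using that by (auto simp: b_def X_def)
  have eq: "shadow n c A = (\<Union>k<n. b k ` X k)"
  proof (intro equalityI subsetI)
    fix u assume u: "u \<in> shadow n c A"
    then obtain w k where w: "w \<in> A" "k < n" "Suc (w k) < c k" and uw: "u = w(k := Suc (w k))"
      by (auto simp: shadow_def)
    have ub: "u \<in> box n c (Suc d)" using u shadow_subset_box[OF A] by blast
    define m where "m = Max {j. j < n \<and> 0 < u j}"
    have k: "k \<in> {j. j < n \<and> 0 < u j}" using w uw by simp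
    have "m \<in> {j. j < n \<and> 0 < u j}" unfolding m_def using k by (intro Max_in) auto
    moreover have "k \<le> m" unfolding m_def using k by (intro Max_ge) auto
    ultimately have m: "m < n" "0 < u m" "k \<le> m" by auto
    have um: "\<forall>j>m. u j = 0"
    proof (intro allI impI)
      fix j assume "m < j"
      moreover have "j \<le> m" if "j \<in> {j. j < n \<and> 0 < u j}"
        unfolding m_def using that by (intro Max_ge) auto
      ultimately have "j \<notin> {j. j < n \<and> 0 < u j}" by fastforce
      then show "u j = 0" using ub by (cases "j < n") (auto simp: box_def)
    qed
    define v where "v = u(m := u m - 1)"
    have "v \<in> A"
    proof (cases "k = m")
      case True
      then have "v = w" using uw by (auto simp: v_def)
      then show ?thesis using w by simp
    next
      case False
      \<comment> \<open>Dividing \<open>u = w x\<^sub>k\<close> by \<open>x\<^sub>m\<close>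
        exchanges one \<open>x\<^sub>m\<close> of \<open>w\<close> for the earlier variable
        \<open>x\<^sub>k\<close>.\<close>
      then have "w(k := Suc (w k), m := w m - 1) \<in> A" "k < m"
        using st w m uw unfolding stable_def by auto
      moreover have "v = w(k := Suc (w k), m := w m - 1)"
        using \<open>k \<noteq> m\<close> uw by (auto simp: v_def)
      ultimately show ?thesis by simp
    qed
    moreover have "u m < c m" using ub m by (auto simp: box_def)
    ultimately have "v \<in> X m" using um m by (auto simp: X_def v_def)
    moreover have "u = b m v" using m by (auto simp: b_def v_def)
    ultimately show "u \<in> (\<Union>k<n. b k ` X k)" using m by blast
  next
    fix u assume "u \<in> (\<Union>k<n. b k ` X k)"
    then show "u \<in> shadow n c A" unfolding b_def X_def using shadowI by fastforce
  qed
  have "card (shadow n c A) = (\<Sum>k<n. card (b k ` X k))"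
    unfolding eq
  proof (rule card_UN_disjoint)
    show "\<forall>i\<in>{..<n}. \<forall>j\<in>{..<n}. i \<noteq> j \<longrightarrow> b i ` X i \<inter> b j ` X j = {}"
      using supp by (metis (no_types, lifting) disjoint_iff less_irrefl_nat nat_neq_iff)
  qed (use finX in auto)
  also have "\<dots> = (\<Sum>k<n. new_count c A k)"
    unfolding card_image[OF inj] by (simp add: new_count_def X_def)
  finally show ?thesis .
qed

text \<open>Fix all exponents but those of \<open>x\<^sub>i\<close> and \<open>x\<^sub>j\<close>, and the sum of these two. The monomials of such a
  fibre are listed by their \<open>x\<^sub>i\<close>-exponent, and \<open>compress\<close> moves the members of \<open>A\<close> to the top of each
  fibre. It is here that \<open>c i \<le> c j\<close> matters.\<close>

definition profile :: "nat \<Rightarrow> nat \<Rightarrow> (nat \<Rightarrow> nat) set \<Rightarrow> (nat \<Rightarrow> nat) \<Rightarrow> nat set" where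
  "profile i j A w = {p. p \<le> w i + w j \<and> w(i := p, j := w i + w j - p) \<in> A}"

definition compress :: "nat \<Rightarrow> (nat \<Rightarrow> nat) \<Rightarrow> nat \<Rightarrow> nat \<Rightarrow> nat \<Rightarrow> (nat \<Rightarrow> nat) set \<Rightarrow> (nat \<Rightarrow> nat) set" where
  "compress n c d i j A = {w \<in> box n c d. min (w i + w j) (c i - 1) < w i + card (profile i j A w)}"

text \<open>Only a label for the fibre through \<open>w\<close>: the whole exponent sum is put at
  \<open>j\<close>, and the result may leave the box.\<close>

definition fibre_key :: "nat \<Rightarrow> nat \<Rightarrow> (nat \<Rightarrow> nat) \<Rightarrow> nat \<Rightarrow> nat" where
  "fibre_key i j w = w(i := 0, j := w i + w j)"

lemma fibre_key_eq_iff: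
  assumes "i < j"
  shows "fibre_key i j v = fibre_key i j w \<longleftrightarrow> (\<exists>x\<le>w i + w j. v = w(i := x, j := w i + w j - x))"
proof
  assume "fibre_key i j v = fibre_key i j w"
  then have *: "fibre_key i j v k = fibre_key i j w k" for k by simp
  have s: "v i + v j = w i + w j" using *[of j] assms by (simp add: fibre_key_def)
  have "v k = (w(i := v i, j := w i + w j - v i)) k" for k
    using *[of k] s assms by (cases "k = i"; cases "k = j") (auto simp: fibre_key_def)
  then have "v = w(i := v i, j := w i + w j - v i)" by (rule ext)
  moreover have "v i \<le> w i + w j" using s by linarith
  ultimately show "\<exists>x\<le>w i + w j. v = w(i := x, j := w i + w j - x)" by blast
next
  assume "\<exists>x\<le>w i + w j. v = w(i := x, j := w i + w j - x)"
  then show "fibre_key i j v = fibre_key i j w" using assms by (auto simp: fibre_key_def fun_eq_iff)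
qed

lemma profile_fibre: "i < j \<Longrightarrow> fibre_key i j v = fibre_key i j w \<Longrightarrow> profile i j A v = profile i j A w"
proof -
  assume "i < j" "fibre_key i j v = fibre_key i j w"
  then obtain x where "x \<le> w i + w j" "v = w(i := x, j := w i + w j - x)"
    unfolding fibre_key_eq_iff[OF \<open>i < j\<close>] by blast
  then show ?thesis using \<open>i < j\<close> unfolding profile_def by (auto simp: fun_upd_twist)
qed

lemma box_fibre:
  assumes "i < j" "j < n" "w \<in> box n c d" "p \<le> w i + w j" "p < c i" "w i + w j - p < c j"
  shows "w(i := p, j := w i + w j - p) \<in> box n c d"
proof -
  have "(\<Sum>l<n. (w(i := p)) l) + w i = d + p"
    using sum_bump[of i n w p] assms by (auto simp: box_def)
  moreover have "(\<Sum>l<n. (w(i := p, j := w i + w j - p)) l) + w j = (\<Sum>l<n. (w(i := p)) l) + (w i + w j - p)"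
    using sum_bump[of j n "w(i := p)" "w i + w j - p"] assms by simp
  ultimately have "(\<Sum>l<n. (w(i := p, j := w i + w j - p)) l) = d" using assms(4) by linarith
  then show ?thesis using assms by (simp add: box_def)
qed

lemma profile_subset:
  assumes "i < j" "j < n" "A \<subseteq> box n c d"
  shows "profile i j A w \<subseteq> {p. p \<le> w i + w j \<and> p < c i \<and> w i + w j - p < c j}"
proof
  fix p assume "p \<in> profile i j A w"
  then have p: "p \<le> w i + w j" "w(i := p, j := w i + w j - p) \<in> box n c d" using assms by (auto simp: profile_def)
  then have "\<forall>l<n. (w(i := p, j := w i + w j - p)) l < c l" by (simp add: box_def)
  from spec[OF this, of i] spec[OF this, of j] assms p(1)
  show "p \<in> {p. p \<le> w i + w j \<and> p < c i \<and> w i + w j - p < c j}" by simp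
qed

lemma finite_profile: "finite (profile i j A w)"
  unfolding profile_def by (rule finite_subset[of _ "{..w i + w j}"]) auto

lemma card_fibre:
  assumes "i < j"
  shows "card {v \<in> A. fibre_key i j v = fibre_key i j w} = card (profile i j A w)"
proof (rule bij_betw_same_card[OF bij_betw_byWitness])
  let ?f' = "\<lambda>p. w(i := p, j := w i + w j - p)"
  show "\<forall>a\<in>{v \<in> A. fibre_key i j v = fibre_key i j w}. ?f' (a i) = a"
    using assms by (auto simp: fibre_key_eq_iff)
  show "\<forall>p\<in>profile i j A w. (?f' p) i = p" using assms by auto
  show "(\<lambda>a. a i) ` {v \<in> A. fibre_key i j v = fibre_key i j w} \<subseteq> profile i j A w"
    using assms by (auto simp: fibre_key_eq_iff profile_def)
  show "?f' ` profile i j A w \<subseteq> {v \<in> A. fibre_key i j v = fibre_key i j w}"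
    using assms by (auto simp: fibre_key_eq_iff profile_def)
qed

lemma sum_fibres:
  assumes "finite A" "A \<subseteq> B" "finite B"
  shows "sum h A = (\<Sum>y\<in>g ` B. sum h {v \<in> A. g v = y})"
  by (rule sum.group[symmetric]) (use assms in auto)

lemma profile_compress:
  assumes "i < j" "j < n" "w \<in> box n c d"
  shows "profile i j (compress n c d i j A) w =
    {p. p \<le> w i + w j \<and> p < c i \<and> w i + w j - p < c j \<and> min (w i + w j) (c i - 1) < p + card (profile i j A w)}"
    (is "?P = ?Q")
proof (intro equalityI subsetI)
  have fibre_key: "fibre_key i j (w(i := p, j := w i + w j - p)) = fibre_key i j w" if "p \<le> w i + w j" for p
    using that assms by (auto simp: fibre_key_def fun_eq_iff)
  have mem: "w(i := p, j := w i + w j - p) \<in> compress n c d i j A \<longleftrightarrow>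
      w(i := p, j := w i + w j - p) \<in> box n c d \<and> min (w i + w j) (c i - 1) < p + card (profile i j A w)"
    if "p \<le> w i + w j" for p
    unfolding compress_def using that assms(1) profile_fibre[OF assms(1) fibre_key[OF that], of A] by simp
  {
    fix p assume p: "p \<in> ?P"
    have "compress n c d i j A \<subseteq> box n c d" by (auto simp: compress_def)
    from profile_subset[OF assms(1,2) this] p have "p \<le> w i + w j \<and> p < c i \<and> w i + w j - p < c j" by blast
    then show "p \<in> ?Q" using p mem[of p] by (simp add: profile_def)
  next
    fix p assume "p \<in> ?Q"
    then show "p \<in> ?P" using mem[of p] box_fibre[OF assms, of p] by (simp add: profile_def)
  }
qed

lemma card_profile_compress:
  assumes "i < j" "j < n" "w \<in> box n c d" "A \<subseteq> box n c d"
  shows "card (profile i j (compress n c d i j A) w) = card (profile i j A w)"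
proof -
  let ?s = "w i + w j" and ?m = "card (profile i j A w)"
  have ci: "0 < c i" "0 < c j"
    using box_less[OF assms(3), of i] box_less[OF assms(3), of j] assms(1,2) by linarith+
  \<comment> \<open>The exponents of \<open>x\<^sub>i\<close> possible in this fibre form the
    interval from \<open>?lo\<close> to \<open>?hi\<close>; truncated subtraction gives
    \<open>?lo = 0\<close> if \<open>c j\<close> exceeds the sum. Compression keeps the top
    \<open>?m\<close> of them.\<close>
  let ?hi = "min ?s (c i - 1)" and ?lo = "?s + 1 - c j"
  have iv: "{p. p \<le> ?s \<and> p < c i \<and> ?s - p < c j} = {?lo..?hi}" using ci by auto
  have "?m \<le> card {?lo..?hi}"
    using profile_subset[OF assms(1,2,4), of w] unfolding iv by (intro card_mono) auto
  then have m: "?m \<le> ?hi + 1 - ?lo" by simp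
  have "profile i j (compress n c d i j A) w = {p \<in> {?lo..?hi}. ?hi < p + ?m}"
    unfolding profile_compress[OF assms(1-3)] iv[symmetric] by blast
  also have "\<dots> = {?hi + 1 - ?m..?hi}"
  proof (intro equalityI subsetI)
    fix p assume "p \<in> {p \<in> {?lo..?hi}. ?hi < p + ?m}"
    then show "p \<in> {?hi + 1 - ?m..?hi}" unfolding mem_Collect_eq atLeastAtMost_iff by linarith
  next
    fix p assume "p \<in> {?hi + 1 - ?m..?hi}"
    then show "p \<in> {p \<in> {?lo..?hi}. ?hi < p + ?m}"
      using m unfolding mem_Collect_eq atLeastAtMost_iff by linarith
  qed
  finally show ?thesis using m by simp
qed

lemma card_compress:
  assumes "i < j" "j < n" "A \<subseteq> box n c d"
  shows "card (compress n c d i j A) = card A"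
proof -
  have T: "compress n c d i j A \<subseteq> box n c d" by (auto simp: compress_def)
  have *: "card X = (\<Sum>y\<in>fibre_key i j ` box n c d. card {v \<in> X. fibre_key i j v = y})" if "X \<subseteq> box n c d" for X
    using sum_fibres[OF finite_subset_box[OF that] that finite_box, of "\<lambda>_. 1" "fibre_key i j"]
    unfolding card_eq_sum .
  show ?thesis unfolding *[OF T] *[OF assms(3)]
    by (rule sum.cong) (auto simp: card_fibre[OF assms(1)] card_profile_compress[OF assms(1,2) _ assms(3)])
qed

text \<open>The first variable moves \<open>p\<close> to \<open>Suc p\<close> and is blocked only at
  \<open>p = a - 1\<close>; the second keeps \<open>p\<close> and is blocked only at
  \<open>Suc s - p = b\<close>. If one of them is never blocked on \<open>P\<close>, it injects
  \<open>P\<close> into \<open>Q\<close>. If both are blocked and \<open>P\<close> has a gap between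
  the two blocked places, the first is used below the gap and the second above it, without
  collision. Without a gap, \<open>Q\<close> contains the whole next fibre.\<close>

lemma two_variable_growth:
  assumes P: "P \<subseteq> {p. p \<le> s \<and> p < a \<and> s - p < b}" and finQ: "finite Q"
    and Q1: "\<And>p. p \<in> P \<Longrightarrow> Suc p < a \<Longrightarrow> Suc p \<in> Q"
    and Q2: "\<And>p. p \<in> P \<Longrightarrow> Suc s - p < b \<Longrightarrow> p \<in> Q"
  shows "card P \<le> card Q \<or> {p. p \<le> Suc s \<and> p < a \<and> Suc s - p < b} \<subseteq> Q"
proof -
  have finP: "finite P" using P by (rule finite_subset) (rule finite_subset[of _ "{..s}"], auto)
  consider "\<forall>p\<in>P. Suc p < a" | "\<forall>p\<in>P. Suc s - p < b"
    | p q where "p \<in> P" "\<not> Suc p < a" "q \<in> P" "\<not> Suc s - q < b" by blast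
  then show ?thesis
  proof cases
    case 1
    then have "Suc ` P \<subseteq> Q" using Q1 by auto
    from card_mono[OF finQ this] show ?thesis by (simp add: card_image)
  next
    case 2
    then have "P \<subseteq> Q" using Q2 by auto
    from card_mono[OF finQ this] show ?thesis by simp
  next
    case 3
    have p: "Suc p = a" and q: "Suc s - q = b" using 3 P by force+
    show ?thesis
    proof (cases "\<exists>g. g \<notin> P \<and> q \<le> g \<and> g \<le> p")
      case True
      then obtain g where g: "g \<notin> P" "q \<le> g" "g \<le> p" by blast
      have gl: "q < g" "g < p" using g 3 by (auto simp: order.strict_iff_order)
      let ?X = "Suc ` {x \<in> P. x < g}" and ?Y = "{x \<in> P. g < x}"
      have "?X \<union> ?Y \<subseteq> Q"
      proof
        fix x assume "x \<in> ?X \<union> ?Y"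
        then show "x \<in> Q"
        proof
          assume "x \<in> ?X"
          then obtain y where "y \<in> P" "y < g" "x = Suc y" by blast
          then show ?thesis using Q1[of y] gl p by auto
        next
          assume "x \<in> ?Y"
          then have "x \<in> P" "g < x" by auto
          moreover have "x \<le> s" "q \<le> s" using calculation(1) P 3 by auto
          ultimately show ?thesis using Q2[of x] gl q by auto
        qed
      qed
      then have "card (?X \<union> ?Y) \<le> card Q" by (rule card_mono[OF finQ])
      moreover have "card (?X \<union> ?Y) = card {x \<in> P. x < g} + card ?Y"
        using finP by (subst card_Un_disjoint) (auto simp: card_image)
      moreover have "card P = card {x \<in> P. x < g} + card ?Y"
      proof -
        have "P = {x \<in> P. x < g} \<union> ?Y" using g(1) by (auto, metis linorder_less_linear)
        then have "card P = card ({x \<in> P. x < g} \<union> ?Y)" by simp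
        also have "\<dots> = card {x \<in> P. x < g} + card ?Y" using finP by (intro card_Un_disjoint) auto
        finally show ?thesis .
      qed
      ultimately show ?thesis by simp
    next
      case False
      have "{x. x \<le> Suc s \<and> x < a \<and> Suc s - x < b} \<subseteq> Q"
      proof
        fix x assume x: "x \<in> {x. x \<le> Suc s \<and> x < a \<and> Suc s - x < b}"
        then have "q < x" "x \<le> p" using p q by auto
        then have "x \<in> P" using False by (meson less_imp_le)
        then show "x \<in> Q" using Q2 x by auto
      qed
      then show ?thesis ..
    qed
  qed
qed

text \<open>Membership in a compression is a condition on the size of a profile, so it suffices to
  bound the profile of the shadow in the fibre of \<open>u\<close> from below by that of
  \<open>A\<close> in the fibre of \<open>w\<close>.\<close>

lemma shadow_compress:
  assumes ij: "i < j" "j < n" "c i \<le> c j" and A: "A \<subseteq> box n c d"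
  shows "shadow n c (compress n c d i j A) \<subseteq> compress n c (Suc d) i j (shadow n c A)"
proof
  fix u assume "u \<in> shadow n c (compress n c d i j A)"
  then obtain w k where wT: "w \<in> compress n c d i j A" and k: "k < n" "Suc (w k) < c k"
    and u: "u = w(k := Suc (w k))" by (auto simp: shadow_def)
  have wb: "w \<in> box n c d" and hi: "min (w i + w j) (c i - 1) < w i + card (profile i j A w)"
    using wT by (auto simp: compress_def)
  have ub: "u \<in> box n c (Suc d)" using wb k u box_bump by simp
  let ?P = "profile i j A w" and ?Q = "profile i j (shadow n c A) u"
  have wci: "w i < c i" "w j < c j" using wb ij by (auto simp: box_def)
  have "min (u i + u j) (c i - 1) < u i + card ?Q"
  proof (cases "k = i \<or> k = j")
    case False
    have "?P \<subseteq> ?Q"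
    proof
      fix p assume "p \<in> ?P"
      then have p: "p \<le> w i + w j" "w(i := p, j := w i + w j - p) \<in> A" by (auto simp: profile_def)
      have "(w(i := p, j := w i + w j - p))(k := Suc ((w(i := p, j := w i + w j - p)) k)) \<in> shadow n c A"
        using p k False by (intro shadowI) auto
      then show "p \<in> ?Q" using p False u by (simp add: profile_def fun_upd_twist)
    qed
    then have "card ?P \<le> card ?Q" by (rule card_mono[OF finite_profile])
    then show ?thesis using hi u False by auto
  next
    case True
    have su: "u i + u j = Suc (w i + w j)" using True u ij by auto
    have upd: "u(i := p, j := q) = w(i := p, j := q)" for p q
      using True u ij by (auto simp: fun_eq_iff)
    have Q1: "Suc p \<in> ?Q" if "p \<in> ?P" "Suc p < c i" for p
    proof -
      have p: "p \<le> w i + w j" "w(i := p, j := w i + w j - p) \<in> A" using that by (auto simp: profile_def)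
      have "(w(i := p, j := w i + w j - p))(i := Suc ((w(i := p, j := w i + w j - p)) i)) \<in> shadow n c A"
        using p that ij by (intro shadowI) auto
      then show ?thesis using p ij by (simp add: profile_def su upd fun_upd_twist)
    qed
    have Q2: "p \<in> ?Q" if "p \<in> ?P" "Suc (w i + w j) - p < c j" for p
    proof -
      have p: "p \<le> w i + w j" "w(i := p, j := w i + w j - p) \<in> A" using that by (auto simp: profile_def)
      have "(w(i := p, j := w i + w j - p))(j := Suc ((w(i := p, j := w i + w j - p)) j)) \<in> shadow n c A"
        using p that ij by (intro shadowI) auto
      then show ?thesis using p ij by (simp add: profile_def su upd Suc_diff_le)
    qed
    have Psub: "?P \<subseteq> {p. p \<le> w i + w j \<and> p < c i \<and> w i + w j - p < c j}"
      by (rule profile_subset[OF ij(1,2) A])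
    consider "card ?P \<le> card ?Q" | "{p. p \<le> Suc (w i + w j) \<and> p < c i \<and> Suc (w i + w j) - p < c j} \<subseteq> ?Q"
      using two_variable_growth[OF Psub finite_profile Q1 Q2] by blast
    then show ?thesis
    proof cases
      case 1
      show ?thesis
      proof (cases "k = j \<and> w i + w j < c i - 1")
        case True
        \<comment> \<open>The top of the fibre rises by one while \<open>u i = w i\<close>, so one
          extra element is needed. Because \<open>Suc (w i + w j) < c i \<le> c j\<close>, no
          multiplication is blocked: the profile persists under \<open>x\<^sub>j\<close>, and its
          maximum also moves up under \<open>x\<^sub>i\<close>.\<close>
        have "0 < card ?P" using hi wci by linarith
        then have ne: "?P \<noteq> {}" by auto
        have "insert (Suc (Max ?P)) ?P \<subseteq> ?Q"
        proof -
          have "Max ?P \<in> ?P" using ne finite_profile by (rule Max_in[rotated])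
          moreover have "p \<le> w i + w j" if "p \<in> ?P" for p using that by (simp add: profile_def)
          ultimately show ?thesis using Q1[of "Max ?P"] Q2 True ij(3) by fastforce
        qed
        then have "card (insert (Suc (Max ?P)) ?P) \<le> card ?Q" by (rule card_mono[OF finite_profile])
        moreover have "Suc (Max ?P) \<notin> ?P" using Max_ge[OF finite_profile, of "Suc (Max ?P)" i j A w] by auto
        ultimately have "Suc (card ?P) \<le> card ?Q" by (simp add: finite_profile)
        then show ?thesis using hi su u True ij by auto
      next
        case False
        then show ?thesis using hi su 1 True u ij by auto
      qed
    next
      case 2
      have uc: "u i < c i" "u j < c j" using ub ij by (auto simp: box_def)
      let ?h = "min (u i + u j) (c i - 1)"
      have "{u i..?h} \<subseteq> ?Q" using 2 uc su by (intro order_trans[OF _ 2]) auto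
      then have "card {u i..?h} \<le> card ?Q" by (rule card_mono[OF finite_profile])
      moreover have "u i \<le> ?h" using uc by auto
      ultimately show ?thesis by auto
    qed
  qed
  then show "u \<in> compress n c (Suc d) i j (shadow n c A)" using ub by (simp add: compress_def)
qed

section \<open>A weight that decreases under compression\<close>

lemma sum_exchange:
  fixes g :: "'a \<Rightarrow> nat"
  assumes fin: "finite X" "finite Y" "card X = card Y" and less: "\<And>x y. x \<in> X - Y \<Longrightarrow> y \<in> Y - X \<Longrightarrow> g y < g x"
  shows "sum g Y \<le> sum g X" "X \<noteq> Y \<Longrightarrow> sum g Y < sum g X"
proof -
  have "card X = card (X \<inter> Y) + card (X - Y)" "card Y = card (X \<inter> Y) + card (Y - X)"
    using card_Int_Diff[OF fin(1), of Y] card_Int_Diff[OF fin(2), of X] by (simp_all only: Int_commute)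
  then have "card (X - Y) = card (Y - X)" using fin by simp
  then obtain h where h: "bij_betw h (X - Y) (Y - X)" using fin finite_same_card_bij by blast
  have hs: "sum g (Y - X) = (\<Sum>x\<in>X - Y. g (h x))" using sum.reindex_bij_betw[OF h, of g] by simp
  have hl: "g (h x) < g x" if "x \<in> X - Y" for x using less that bij_betwE[OF h] by blast
  have X: "sum g X = sum g (X \<inter> Y) + sum g (X - Y)" by (rule sum.Int_Diff[OF fin(1)])
  have Y: "sum g Y = sum g (X \<inter> Y) + sum g (Y - X)" using sum.Int_Diff[OF fin(2), of g X] by (simp only: Int_commute)
  show "sum g Y \<le> sum g X" unfolding X Y hs by (intro add_left_mono sum_mono less_imp_le hl)
  assume "X \<noteq> Y"
  then have "X - Y \<noteq> {}" using fin by (metis Diff_eq_empty_iff card_subset_eq)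
  then show "sum g Y < sum g X" unfolding X Y hs by (intro add_strict_left_mono sum_strict_mono hl) (use fin in auto)
qed

lemma weighted_sum_upd:
  fixes w :: "nat \<Rightarrow> nat"
  assumes "k < n" shows "(\<Sum>l<n. l * (w(k := x)) l) + k * w k = (\<Sum>l<n. l * w l) + k * x"
proof -
  have *: "{..<n} = insert k ({..<n} - {k})" using assms by auto
  have "(\<Sum>l<n. l * (w(k := x)) l) = k * x + (\<Sum>l\<in>{..<n} - {k}. l * w l)"
    by (subst *, subst sum.insert) (auto intro: sum.cong)
  moreover have "(\<Sum>l<n. l * w l) = k * w k + (\<Sum>l\<in>{..<n} - {k}. l * w l)"
    by (subst *, subst sum.insert) auto
  ultimately show ?thesis by simp
qed

text \<open>Every fibre keeps its number of members, and those that enter have a larger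
  \<open>x\<^sub>i\<close>-exponent than those that leave. With weight \<open>l\<close> on variable
  \<open>l\<close>, moving exponents from \<open>j\<close> to \<open>i < j\<close> lowers the
  total.\<close>

lemma compress_potential:
  assumes ij: "i < j" "j < n" and A: "A \<subseteq> box n c d" and ne: "compress n c d i j A \<noteq> A"
  shows "(\<Sum>w\<in>compress n c d i j A. \<Sum>l<n. l * w l) < (\<Sum>w\<in>A. \<Sum>l<n. l * w l)"
proof -
  let ?T = "compress n c d i j A" and ?pot = "\<lambda>w. \<Sum>l<n. l * w l"
  have T: "?T \<subseteq> box n c d" by (auto simp: compress_def)
  have fin: "finite A" "finite ?T" using A T finite_subset_box by auto
  have *: "sum ?pot X = (\<Sum>y\<in>fibre_key i j ` box n c d. sum ?pot {v \<in> X. fibre_key i j v = y})" if "X \<subseteq> box n c d" for X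
    by (rule sum_fibres[OF finite_subset_box[OF that] that finite_box])
  have card: "card {v \<in> A. fibre_key i j v = y} = card {v \<in> ?T. fibre_key i j v = y}" if "y \<in> fibre_key i j ` box n c d" for y
    using that ij A by (auto simp: card_fibre card_profile_compress)
  have less: "?pot v < ?pot w"
    if w: "w \<in> {v \<in> A. fibre_key i j v = y} - {v \<in> ?T. fibre_key i j v = y}"
      and v: "v \<in> {v \<in> ?T. fibre_key i j v = y} - {v \<in> A. fibre_key i j v = y}" for v w y
  proof -
    have vw: "fibre_key i j v = fibre_key i j w" using v w by auto
    then obtain p where p: "p \<le> w i + w j" "v = w(i := p, j := w i + w j - p)"
      using fibre_key_eq_iff[OF ij(1)] by blast
    have sv: "v i + v j = w i + w j" "v i = p" using p ij by auto
    have "min (w i + w j) (c i - 1) \<ge> w i + card (profile i j A w)" using w A by (auto simp: compress_def)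
    moreover have "min (w i + w j) (c i - 1) < p + card (profile i j A w)"
      using v sv profile_fibre[OF ij(1) vw, of A] by (auto simp: compress_def)
    ultimately have "w i < p" by linarith
    then obtain \<delta> where \<delta>: "p = w i + \<delta>" "0 < \<delta>" using less_imp_add_positive by metis
    then have wj: "w j = (w i + w j - p) + \<delta>" using p(1) by linarith
    let ?q = "w i + w j - p"
    have 1: "?pot (w(i := p)) + i * w i = ?pot w + i * p" using ij by (intro weighted_sum_upd) auto
    have 2: "?pot v + j * w j = ?pot (w(i := p)) + j * ?q"
      unfolding p(2) using weighted_sum_upd[OF ij(2), of "w(i := p)" ?q] ij by simp
    have 3: "j * w j = j * ?q + j * \<delta>" using wj by (metis distrib_left)
    have 4: "i * p = i * w i + i * \<delta>" using \<delta> by (simp add: distrib_left)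
    have "i * \<delta> < j * \<delta>" using ij \<delta> by simp
    then show ?thesis using 1 2 3 4 by linarith
  qed
  show ?thesis unfolding *[OF A] *[OF T]
  proof (rule sum_strict_mono_ex1)
    show "\<forall>y\<in>fibre_key i j ` box n c d. sum ?pot {v \<in> ?T. fibre_key i j v = y} \<le> sum ?pot {v \<in> A. fibre_key i j v = y}"
    proof
      fix y assume y: "y \<in> fibre_key i j ` box n c d"
      show "sum ?pot {v \<in> ?T. fibre_key i j v = y} \<le> sum ?pot {v \<in> A. fibre_key i j v = y}"
        by (rule sum_exchange(1)[OF _ _ card[OF y]]) (use fin less in auto)
    qed
    obtain w where w: "w \<in> ?T - A \<or> w \<in> A - ?T" using ne by blast
    then have wb: "fibre_key i j w \<in> fibre_key i j ` box n c d" using A T by blast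
    have "sum ?pot {v \<in> ?T. fibre_key i j v = fibre_key i j w} < sum ?pot {v \<in> A. fibre_key i j v = fibre_key i j w}"
    proof (rule sum_exchange(2)[OF _ _ card[OF wb]])
      show "{v \<in> A. fibre_key i j v = fibre_key i j w} \<noteq> {v \<in> ?T. fibre_key i j v = fibre_key i j w}" using w by blast
    qed (use fin less in auto)
    then show "\<exists>y\<in>fibre_key i j ` box n c d. sum ?pot {v \<in> ?T. fibre_key i j v = y} < sum ?pot {v \<in> A. fibre_key i j v = y}"
      using wb by blast
  qed auto
qed

text \<open>A competitor of least weight is fixed by every compression, since compressing keeps the
  cardinality, does not enlarge the shadow, and lowers the weight if it changes anything. Being
  fixed by all compressions implies stability, as raising the \<open>x\<^sub>i\<close>-exponent
  inside a fibre keeps a vector above the threshold.\<close>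

lemma exists_stable:
  assumes c: "\<And>i j. i < j \<Longrightarrow> j < n \<Longrightarrow> c i \<le> c j" and A: "A \<subseteq> box n c d"
  obtains B where "B \<subseteq> box n c d" "stable n c B" "card B = card A" "card (shadow n c B) \<le> card (shadow n c A)"
proof -
  let ?Q = "\<lambda>B. B \<subseteq> box n c d \<and> card B = card A \<and> card (shadow n c B) \<le> card (shadow n c A)"
  let ?pot = "\<lambda>B. \<Sum>w\<in>B. \<Sum>l<n. l * w l"
  obtain B where B: "?Q B" "\<And>B'. ?Q B' \<Longrightarrow> ?pot B \<le> ?pot B'"
    using ex_has_least_nat[of ?Q A ?pot] A by auto
  have fixed: "compress n c d i j B = B" if ij: "i < j" "j < n" for i j
  proof (rule ccontr)
    assume ne: "compress n c d i j B \<noteq> B"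
    have sub: "compress n c d i j B \<subseteq> box n c d" by (auto simp: compress_def)
    have sB: "shadow n c B \<subseteq> box n c (Suc d)" using B by (intro shadow_subset_box) auto
    have "card (shadow n c (compress n c d i j B)) \<le> card (compress n c (Suc d) i j (shadow n c B))"
      by (rule card_mono) (use shadow_compress[of i j n c B d] ij c B in \<open>auto simp: compress_def\<close>)
    also have "\<dots> = card (shadow n c B)" by (rule card_compress[OF ij sB])
    finally have "?Q (compress n c d i j B)" using B(1) sub card_compress[OF ij, of B c d] by auto
    with B(2)[OF this] compress_potential[OF ij _ ne] B(1) show False by simp
  qed
  have "stable n c B"
    unfolding stable_def
  proof (intro ballI allI impI)
    fix w j i assume w: "w \<in> B" "j < n" "i < j" "0 < w j" "Suc (w i) < c i"
    let ?v = "w(i := Suc (w i), j := w j - 1)"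
    have "?v \<in> box n c d" using box_move[of w n c d i j] w B by auto
    moreover have "fibre_key i j ?v = fibre_key i j w" using w by (auto simp: fibre_key_def)
    then have "profile i j B ?v = profile i j B w" by (rule profile_fibre[OF w(3)])
    moreover have "min (w i + w j) (c i - 1) < w i + card (profile i j B w)"
      using fixed[OF w(3,2)] w(1) by (auto simp: compress_def)
    ultimately have "?v \<in> compress n c d i j B" using w by (simp add: compress_def)
    then show "?v \<in> B" using fixed[OF w(3,2)] by simp
  qed
  then show ?thesis using that B by blast
qed

section \<open>Lexicographically small multiples\<close>

lemma exists_between:
  fixes v h :: "nat \<Rightarrow> nat"
  assumes vh: "\<And>i. i < n \<Longrightarrow> v i \<le> h i" and T: "(\<Sum>i<n. v i) + m \<le> (\<Sum>i<n. h i)"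
  shows "\<exists>x. (\<forall>i<n. v i \<le> x i \<and> x i \<le> h i) \<and> (\<forall>i\<ge>n. x i = v i) \<and> (\<Sum>i<n. x i) = (\<Sum>i<n. v i) + m"
  using T
proof (induction m)
  case 0
  then show ?case using vh by (intro exI[of _ v]) auto
next
  case (Suc m)
  then obtain x where x: "\<forall>i<n. v i \<le> x i \<and> x i \<le> h i" "\<forall>i\<ge>n. x i = v i" "(\<Sum>i<n. x i) = (\<Sum>i<n. v i) + m"
    by auto
  have "\<exists>k<n. x k < h k"
  proof (rule ccontr)
    assume "\<not> ?thesis"
    then have "(\<Sum>i<n. h i) \<le> (\<Sum>i<n. x i)" by (intro sum_mono) (metis lessThan_iff not_less)
    then show False using x Suc.prems by simp
  qed
  then obtain k where k: "k < n" "x k < h k" by blast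
  have "(\<Sum>i<n. (x(k := Suc (x k))) i) = (\<Sum>i<n. v i) + Suc m"
    using sum_bump[OF k(1), of x "Suc (x k)"] x(3) by linarith
  then show ?case using x k by (intro exI[of _ "x(k := Suc (x k))"]) (auto simp: le_Suc_eq)
qed

text \<open>Among the multiples of \<open>v\<close> that keep its entries before \<open>i\<close>
  and have at most \<open>u i\<close> at \<open>i\<close>, one with least entry at \<open>i\<close>
  is taken. If that entry is still \<open>u i\<close>, no unit can be moved from \<open>i\<close> to
  a later \<open>j\<close> with \<open>x j < u j\<close>; so \<open>x\<close> dominates
  \<open>u\<close>, and equal degrees give \<open>x = u\<close>.\<close>

lemma exists_lex_le_multiple:
  assumes v: "v \<in> box n c e" and u: "u \<in> box n c (e + m)"
    and i: "i < n" "v i < u i" "\<And>j. j < i \<Longrightarrow> v j = u j"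
  obtains x where "x \<in> box n c (e + m)" "\<And>j. v j \<le> x j" "x = u \<or> less_fun x u"
proof -
  define h where "h j = (if j < i then v j else if j = i then u i else c j - 1)" for j
  define Q where "Q x \<longleftrightarrow> (\<forall>j<n. v j \<le> x j \<and> x j \<le> h j) \<and> (\<forall>j\<ge>n. x j = v j) \<and> (\<Sum>j<n. x j) = e + m" for x
  have vh: "v j \<le> h j" if "j < n" for j using i box_less[OF v that] by (auto simp: h_def)
  have uh: "u j \<le> h j" if "j < n" for j using i box_less[OF u that] by (auto simp: h_def)
  have sv: "(\<Sum>j<n. v j) = e" and su: "(\<Sum>j<n. u j) = e + m" using v u by (auto simp: box_def)
  \<comment> \<open>There is enough room because \<open>u\<close> itself lies below
    \<open>h\<close>.\<close>
  have "(\<Sum>j<n. v j) + m \<le> (\<Sum>j<n. h j)" using sum_mono[of "{..<n}" u h] uh sv su by simp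
  from exists_between[OF vh this] obtain x0 where "Q x0" using sv unfolding Q_def by auto
  then obtain x where Qx: "Q x" and least: "\<And>y. Q y \<Longrightarrow> x i \<le> y i"
    using ex_has_least_nat[of Q x0 "\<lambda>x. x i"] by blast
  have x: "\<And>j. j < n \<Longrightarrow> v j \<le> x j" "\<And>j. j < n \<Longrightarrow> x j \<le> h j" "\<And>j. n \<le> j \<Longrightarrow> x j = v j"
    "(\<Sum>j<n. x j) = e + m" using Qx by (auto simp: Q_def)
  have pre: "x j = u j" if "j < i" for j
    using x(1,2)[of j] that i(1) i(3)[of j] by (simp add: h_def)
  have xi: "x i \<le> u i" using x(2)[of i] i(1) by (simp add: h_def)
  have xc: "x j < c j" if "j < n" for j
    using x(2)[OF that] box_less[OF v that] box_less[OF u that] by (simp add: h_def split: if_splits)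
  have xb: "x \<in> box n c (e + m)" using x(3,4) xc box_zero[OF v] by (simp add: box_def)
  have vx: "v j \<le> x j" for j using x(1,3)[of j] by (cases "j < n") auto
  show ?thesis
  proof (cases "x i < u i")
    case True
    then show ?thesis using that[OF xb vx] pre unfolding less_fun_def by blast
  next
    case False
    then have xi: "x i = u i" using xi by simp
    have "u j \<le> x j" if "j < n" for j
    proof (rule ccontr)
      assume n: "\<not> u j \<le> x j"
      then have ji: "i < j" using pre[of j] xi by (metis le_refl linorder_neqE_nat)
      let ?y = "x(j := Suc (x j), i := x i - 1)"
      have "(\<Sum>l<n. ?y l) = e + m"
        using sum_bump[OF that, of x "Suc (x j)"] sum_bump[OF i(1), of "x(j := Suc (x j))" "x i - 1"] x(4) i(2) xi ji by auto
      moreover have "v l \<le> ?y l \<and> ?y l \<le> h l" if "l < n" for l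
      proof -
        consider "l = i" | "l = j" "l \<noteq> i" | "l \<noteq> i" "l \<noteq> j" by blast
        then show ?thesis
        proof cases
          case 1
          have "v i \<le> x i - 1 \<and> x i - 1 \<le> h i" using i(2) xi x(2)[OF i(1)] by linarith
          then show ?thesis using 1 by simp
        next
          case 2
          have "v j \<le> x j" using x(1) \<open>j < n\<close> by simp
          moreover have "Suc (x j) \<le> h j" using n ji box_less[OF u \<open>j < n\<close>] by (simp add: h_def)
          ultimately show ?thesis using 2 by simp
        next
          case 3
          then show ?thesis using x(1,2)[OF that] by simp
        qed
      qed
      moreover have "?y l = v l" if "n \<le> l" for l using that x(3)[OF that] i(1) \<open>j < n\<close> by simp
      ultimately have "Q ?y" unfolding Q_def by blast
      from least[OF this] show False using i(2) xi by simp
    qed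
    moreover have "(\<Sum>l<n. u l) = (\<Sum>l<n. x l)" using x(4) su by simp
    ultimately have ux: "u l = x l" if "l < n" for l using sum_mono_inv[of u "{..<n}" x l] that by auto
    have "x l = u l" for l
      using ux[of l] box_zero[OF xb, of l] box_zero[OF u, of l] by (cases "l < n") simp_all
    then have "x = u" by (rule ext)
    then show ?thesis using that[OF xb vx] by simp
  qed
qed

section \<open>The Clements--Lindstroem theorem\<close>

definition slice :: "nat \<Rightarrow> nat \<Rightarrow> (nat \<Rightarrow> nat) set \<Rightarrow> (nat \<Rightarrow> nat) set" where
  "slice n q A = {v. v n = 0 \<and> v(n := q) \<in> A}"

lemma box_Suc_upd:
  assumes "v n = 0" "q \<le> d"
  shows "v(n := q) \<in> box (Suc n) c d \<longleftrightarrow> q < c n \<and> v \<in> box n c (d - q)"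
proof -
  have *: "(\<Sum>i<n. (v(n := q)) i) = (\<Sum>i<n. v i)" by (intro sum.cong) auto
  show ?thesis
  proof
    assume b: "v(n := q) \<in> box (Suc n) c d"
    have "v i < c i" if "i < n" for i using box_less[OF b, of i] that by simp
    moreover have "v i = 0" if "n \<le> i" for i using box_zero[OF b, of i] that assms(1) by (cases "i = n") auto
    moreover have "(\<Sum>i<n. v i) + q = d" using b * by (simp add: box_def)
    then have "(\<Sum>i<n. v i) = d - q" by linarith
    ultimately show "q < c n \<and> v \<in> box n c (d - q)" using box_less[OF b, of n] by (simp add: box_def)
  next
    assume "q < c n \<and> v \<in> box n c (d - q)"
    then show "v(n := q) \<in> box (Suc n) c d" using * assms(2) by (auto simp: box_def less_Suc_eq)
  qed
qed

lemma slice_subset_box: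
  assumes "A \<subseteq> box (Suc n) c d" "q \<le> d"
  shows "slice n q A \<subseteq> box n c (d - q)"
  using assms box_Suc_upd[of _ n q d c] by (auto simp: slice_def)

lemma slice_less: "A \<subseteq> box (Suc n) c d \<Longrightarrow> v \<in> slice n q A \<Longrightarrow> q < c n"
  using box_less[of "v(n := q)" "Suc n" c d n] by (auto simp: slice_def)

lemma card_slices:
  assumes A: "A \<subseteq> box (Suc n) c d"
  shows "card {w \<in> A. P (w n)} = (\<Sum>q | q \<le> d \<and> P q. card (slice n q A))"
proof -
  have fin: "finite A" using A by (rule finite_subset_box)
  have le: "w n \<le> d" if "w \<in> A" for w
  proof -
    have "w n \<le> (\<Sum>i<Suc n. w i)" by (rule member_le_sum) auto
    then show ?thesis using that A by (auto simp: box_def)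
  qed
  have "card {w \<in> A. P (w n)} = (\<Sum>q | q \<le> d \<and> P q. card {w \<in> {w \<in> A. P (w n)}. w n = q})"
    unfolding card_eq_sum by (rule sum.group[symmetric]) (use fin le in auto)
  also have "\<dots> = (\<Sum>q | q \<le> d \<and> P q. card (slice n q A))"
  proof (rule sum.cong[OF refl])
    fix q assume q: "q \<in> {q. q \<le> d \<and> P q}"
    show "card {w \<in> {w \<in> A. P (w n)}. w n = q} = card (slice n q A)"
    proof (rule bij_betw_same_card[OF bij_betw_byWitness[where f = "\<lambda>w. w(n := 0)" and f' = "\<lambda>v. v(n := q)"]])
      show "\<forall>w\<in>{w \<in> {w \<in> A. P (w n)}. w n = q}. (w(n := 0))(n := q) = w" by (intro ballI ext) simp
      show "\<forall>v\<in>slice n q A. (v(n := q))(n := 0) = v" by (intro ballI ext) (simp add: slice_def)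
      show "(\<lambda>w. w(n := 0)) ` {w \<in> {w \<in> A. P (w n)}. w n = q} \<subseteq> slice n q A"
      proof
        fix v assume "v \<in> (\<lambda>w. w(n := 0)) ` {w \<in> {w \<in> A. P (w n)}. w n = q}"
        then obtain w where "w \<in> A" "w n = q" "v = w(n := 0)" by blast
        then have "v n = 0 \<and> v(n := q) = w" by auto
        then show "v \<in> slice n q A" using \<open>w \<in> A\<close> by (simp add: slice_def)
      qed
      show "(\<lambda>v. v(n := q)) ` slice n q A \<subseteq> {w \<in> {w \<in> A. P (w n)}. w n = q}"
        using q by (auto simp: slice_def)
    qed
  qed
  finally show ?thesis .
qed

lemma slice_lexup:
  assumes L: "lexup (Suc n) c d L" and q: "q \<le> d"
  shows "lexup n c (d - q) (slice n q L)"
  unfolding lexup_def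
proof (intro conjI ballI impI)
  have Lb: "L \<subseteq> box (Suc n) c d" using L by (simp add: lexup_def)
  show sub: "slice n q L \<subseteq> box n c (d - q)" by (rule slice_subset_box[OF Lb q])
  fix v u assume v: "v \<in> slice n q L" and u: "u \<in> box n c (d - q)" and less: "less_fun v u"
  have un: "u n = 0" using box_zero[OF u] by simp
  have "u(n := q) \<in> box (Suc n) c d" using box_Suc_upd[of u n q d c, OF un q] u slice_less[OF Lb v] by simp
  moreover have "less_fun (v(n := q)) (u(n := q))"
  proof -
    obtain i where i: "i < n" "v i < u i" "\<And>j. j < i \<Longrightarrow> v j = u j"
      using less_fun_boxD[OF less subsetD[OF sub v] u] by metis
    then show ?thesis unfolding less_fun_def by (intro exI[of _ i]) auto
  qed
  ultimately have "u(n := q) \<in> L" using L v unfolding lexup_def slice_def by blast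
  then show "u \<in> slice n q L" using un by (simp add: slice_def)
qed

lemma slice_stable: "stable (Suc n) c A \<Longrightarrow> stable n c (slice n q A)"
  unfolding stable_def
proof (intro ballI allI impI)
  fix w j i
  assume st: "\<forall>w\<in>A. \<forall>j<Suc n. \<forall>i<j. 0 < w j \<longrightarrow> Suc (w i) < c i \<longrightarrow> w(i := Suc (w i), j := w j - 1) \<in> A"
    and w: "w \<in> slice n q A" "j < n" "i < j" "0 < w j" "Suc (w i) < c i"
  have "(w(n := q))(i := Suc ((w(n := q)) i), j := (w(n := q)) j - 1) \<in> A"
    using st[rule_format, of "w(n := q)" j i] w by (auto simp: slice_def)
  moreover have "(w(n := q))(i := Suc ((w(n := q)) i), j := (w(n := q)) j - 1) = (w(i := Suc (w i), j := w j - 1))(n := q)"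
    using w by (auto simp: fun_eq_iff)
  ultimately show "w(i := Suc (w i), j := w j - 1) \<in> slice n q A" using w by (auto simp: slice_def)
qed

text \<open>Stability exchanges one factor \<open>x\<^sub>n\<close> for \<open>x\<^sub>k\<close>, so
  a multiple by \<open>x\<^sub>k\<close> is found one slice lower.\<close>

lemma shadow_slice:
  assumes "stable (Suc n) c A"
  shows "shadow n c (slice n (Suc q) A) \<subseteq> slice n q A"
proof
  fix u assume "u \<in> shadow n c (slice n (Suc q) A)"
  then obtain w k where w: "w n = 0" "w(n := Suc q) \<in> A" "k < n" "Suc (w k) < c k" "u = w(k := Suc (w k))"
    by (auto simp: shadow_def slice_def)
  have "(w(n := Suc q))(k := Suc ((w(n := Suc q)) k), n := (w(n := Suc q)) n - 1) \<in> A"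
    using assms[unfolded stable_def, rule_format, OF w(2), of n k] w by simp
  moreover have "(w(n := Suc q))(k := Suc ((w(n := Suc q)) k), n := (w(n := Suc q)) n - 1) = u(n := q)"
    using w by (auto simp: fun_eq_iff)
  ultimately show "u \<in> slice n q A" using w by (auto simp: slice_def)
qed

text \<open>Each slice descended buys one degree. The variable removed from \<open>x\<close> in the
  induction is one in which \<open>x\<close> exceeds \<open>v\<close>, so the quotient is still a
  multiple of \<open>v\<close>.\<close>

lemma shadow_chain:
  assumes B: "\<And>q. Suc q \<le> d \<Longrightarrow> shadow n c (B (Suc q)) \<subseteq> B q" and sub: "\<And>q. q \<le> d \<Longrightarrow> B q \<subseteq> box n c (d - q)"
    and v: "v \<in> B q" "q \<le> d" "m \<le> q"
    and x: "x \<in> box n c (d - q + m)" "\<And>j. v j \<le> x j"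
  shows "x \<in> B (q - m)"
  using v(3) x
proof (induction m arbitrary: x)
  case 0
  have vb: "v \<in> box n c (d - q)" using sub v by blast
  have "(\<Sum>j<n. v j) = (\<Sum>j<n. x j)" using vb 0 by (simp add: box_def)
  then have vx: "v j = x j" if "j < n" for j using sum_mono_inv[of v "{..<n}" x j] 0(3) that by auto
  have "v j = x j" for j using vx[of j] box_zero[OF vb, of j] box_zero[OF 0(2), of j] by (cases "j < n") simp_all
  then have "v = x" by (rule ext)
  then show ?case using v by simp
next
  case (Suc m)
  have vb: "v \<in> box n c (d - q)" using sub v by blast
  have "\<exists>k<n. v k < x k"
  proof (rule ccontr)
    assume "\<not> ?thesis"
    then have "(\<Sum>j<n. x j) \<le> (\<Sum>j<n. v j)" by (intro sum_mono) (metis lessThan_iff not_less)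
    then show False using vb Suc.prems by (simp add: box_def)
  qed
  then obtain k where k: "k < n" "v k < x k" by blast
  define y where "y = x(k := x k - 1)"
  have xb: "x \<in> box n c (Suc (d - q + m))" using Suc.prems by simp
  have xk: "0 < x k" using k by simp
  have y: "y \<in> box n c (d - q + m)" using box_unbump(2)[OF xb xk] by (simp add: y_def)
  have "v j \<le> y j" for j using Suc.prems(3)[of j] k by (auto simp: y_def)
  then have "y \<in> B (q - m)" using Suc.IH[OF _ y] Suc.prems by simp
  moreover have "Suc (y k) < c k" using xk box_less[OF xb k(1)] by (simp add: y_def)
  ultimately have "y(k := Suc (y k)) \<in> shadow n c (B (q - m))" using k by (intro shadowI)
  moreover have "y(k := Suc (y k)) = x" using xk by (simp add: y_def)
  moreover have "q - m = Suc (q - Suc m)" using Suc.prems by simp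
  moreover have "Suc (q - Suc m) \<le> d" using Suc.prems v(2) by simp
  ultimately show ?case using B[of "q - Suc m"] by (metis subsetD)
qed

definition lex_shadow_minimal :: "nat \<Rightarrow> (nat \<Rightarrow> nat) \<Rightarrow> bool" where
  "lex_shadow_minimal n c \<longleftrightarrow> (\<forall>d A L. A \<subseteq> box n c d \<longrightarrow> lexup n c d L \<longrightarrow> card L \<le> card A \<longrightarrow>
     card (shadow n c L) \<le> card (shadow n c A))"

text \<open>A comparison summand by summand instead of shadow by shadow. It is restricted to stable
  sets, where the summands add up to the size of the shadow, and it is the form that can be carried
  from \<open>n\<close> to \<open>Suc n\<close> variables.\<close>

definition lex_new_count_minimal :: "nat \<Rightarrow> (nat \<Rightarrow> nat) \<Rightarrow> bool" where
  "lex_new_count_minimal n c \<longleftrightarrow> (\<forall>d A L. A \<subseteq> box n c d \<longrightarrow> stable n c A \<longrightarrow> lexup n c d L \<longrightarrow> card L \<le> card A \<longrightarrow>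
     (\<forall>k<n. new_count c L k \<le> new_count c A k))"

lemma lex_shadow_minimalI:
  assumes c: "\<And>i j. i < j \<Longrightarrow> j < n \<Longrightarrow> c i \<le> c j" and B: "lex_new_count_minimal n c"
  shows "lex_shadow_minimal n c"
  unfolding lex_shadow_minimal_def
proof (intro allI impI)
  fix d A L assume A: "A \<subseteq> box n c d" "lexup n c d L" "card L \<le> card A"
  obtain A' where A': "A' \<subseteq> box n c d" "stable n c A'" "card A' = card A" "card (shadow n c A') \<le> card (shadow n c A)"
    by (rule exists_stable[OF _ A(1)]) (use c in auto)
  have "card (shadow n c L) = (\<Sum>k<n. new_count c L k)"
    using A by (intro card_shadow_stable[of n c L d] lexup_stable) (auto simp: lexup_def)
  also have "\<dots> \<le> (\<Sum>k<n. new_count c A' k)"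
    using B A A' unfolding lex_new_count_minimal_def by (intro sum_mono) (metis lessThan_iff)
  also have "\<dots> = card (shadow n c A')" using A' by (intro card_shadow_stable[symmetric, of n c A' d])
  finally show "card (shadow n c L) \<le> card (shadow n c A)" using A' by simp
qed

text \<open>Slice by the last variable. Replacing the slices \<open>A\<^sub>q\<close> by lex segments \<open>B\<^sub>q\<close> keeps \<open>shadow B\<^sub>q\<^sub>+\<^sub>1 \<subseteq> B\<^sub>q\<close>.
  If \<open>B\<^sub>0\<close> missed some \<open>u \<in> L\<^sub>0\<close>, then every \<open>B\<^sub>q\<close> would lie in \<open>L\<^sub>q\<close>, since otherwise some multiple of an
  element of \<open>B\<^sub>q\<close> would be lex-below \<open>u\<close> and force \<open>u \<in> B\<^sub>0\<close>; the top slice is compared in the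
  same way, in the opposite direction.\<close>

lemma lex_new_count_minimal_Suc:
  assumes cl: "lex_shadow_minimal n c" and big: "lex_new_count_minimal n c"
  shows "lex_new_count_minimal (Suc n) c"
  unfolding lex_new_count_minimal_def
proof (intro allI impI)
  fix d A L k
  assume A: "A \<subseteq> box (Suc n) c d" and st: "stable (Suc n) c A" and L: "lexup (Suc n) c d L"
    and LA: "card L \<le> card A" and k: "k < Suc n"
  let ?A = "\<lambda>q. slice n q A" and ?L = "\<lambda>q. slice n q L"
  have Lb: "L \<subseteq> box (Suc n) c d" using L by (simp add: lexup_def)
  have "\<exists>B. \<forall>q. q \<le> d \<longrightarrow> lexup n c (d - q) (B q) \<and> card (B q) = card (?A q)"
  proof (intro choice allI)
    fix q
    show "\<exists>B. q \<le> d \<longrightarrow> lexup n c (d - q) B \<and> card B = card (?A q)"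
      using lexup_exists[of "card (?A q)" n c "d - q"] card_mono[OF finite_box slice_subset_box[OF A]] by blast
  qed
  then obtain B where B: "\<And>q. q \<le> d \<Longrightarrow> lexup n c (d - q) (B q)" "\<And>q. q \<le> d \<Longrightarrow> card (B q) = card (?A q)"
    by blast
  have Bb: "B q \<subseteq> box n c (d - q)" if "q \<le> d" for q using B(1)[OF that] by (simp add: lexup_def)
  have Llex: "lexup n c (d - q) (?L q)" if "q \<le> d" for q using slice_lexup[OF L that] .
  have chain: "shadow n c (B (Suc q)) \<subseteq> B q" if "Suc q \<le> d" for q
  proof -
    have dq: "Suc (d - Suc q) = d - q" using that by simp
    have "card (shadow n c (B (Suc q))) \<le> card (shadow n c (?A (Suc q)))"
      using cl B[OF that] slice_subset_box[OF A that] unfolding lex_shadow_minimal_def by (metis le_refl)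
    also have "\<dots> \<le> card (?A q)"
      using slice_subset_box[OF A, of q] that by (intro card_mono shadow_slice[OF st]) (auto intro: finite_subset_box)
    also have "\<dots> = card (B q)" using B that by simp
    finally show ?thesis
      using lexup_subset_iff[of n c "d - q"] lexup_shadow[OF B(1)[OF that]] B(1)[of q] that dq by simp
  qed
  have Bc: "q < c n" if "q \<le> d" "v \<in> B q" for q v
  proof -
    have "card (B q) \<noteq> 0" using that(2) lexup_finite[OF B(1)[OF that(1)]] by (metis card_0_eq empty_iff)
    then have "card (?A q) \<noteq> 0" using B(2)[OF that(1)] by simp
    then have "?A q \<noteq> {}" by auto
    then show ?thesis using slice_less[OF A] by blast
  qed
  have cardA: "card {w \<in> A. P (w n)} = (\<Sum>q | q \<le> d \<and> P q. card (B q))" for P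
    unfolding card_slices[OF A] using B by (intro sum.cong) auto
  have cardL: "card {w \<in> L. P (w n)} = (\<Sum>q | q \<le> d \<and> P q. card (?L q))" for P
    by (rule card_slices[OF Lb])
  have le: "(\<Sum>q | q \<le> d. card (?L q)) \<le> (\<Sum>q | q \<le> d. card (B q))"
    using LA cardA[of "\<lambda>_. True"] cardL[of "\<lambda>_. True"] by simp
  show "new_count c L k \<le> new_count c A k"
  proof (cases "k = n")
    case False
    \<comment> \<open>For \<open>k < n\<close> the vectors that are counted have last entry
      \<open>0\<close>, so only slice \<open>0\<close> matters.\<close>
    have "card (?L 0) \<le> card (B 0)"
    proof (rule ccontr)
      assume less: "\<not> ?thesis"
      then have "\<not> ?L 0 \<subseteq> B 0" using lexup_subset_iff[OF Llex[of 0] B(1)[of 0]] by simp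
      then obtain u where u: "u \<in> ?L 0" "u \<notin> B 0" by blast
      have ub: "u \<in> box n c d" using u(1) slice_subset_box[OF Lb, of 0] by auto
      have uL: "u \<in> L" using u(1) unfolding slice_def by (metis (mono_tags) fun_upd_triv mem_Collect_eq)
      have "B q \<subseteq> ?L q" if q: "q \<le> d" for q
      proof
        fix v assume v: "v \<in> B q"
        have vb: "v \<in> box n c (d - q)" using Bb q v by blast
        have vn: "v n = 0" using box_zero[OF vb] by simp
        have wb: "v(n := q) \<in> box (Suc n) c d" using box_Suc_upd[of v n q d c] vb vn q Bc[OF q v] by simp
        have "v(n := q) \<in> L"
        proof (rule ccontr)
          assume nL: "v(n := q) \<notin> L"
          then have "less_fun (v(n := q)) u"
            using L uL wb unfolding lexup_def by (metis less_fun_cases)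
          then obtain i where i: "(v(n := q)) i < u i" "\<And>j. j < i \<Longrightarrow> (v(n := q)) j = u j"
            unfolding less_fun_def by blast
          have "i < n" using i(1) box_zero[OF ub, of i] by (metis not_less less_nat_zero_code)
          then have i': "v i < u i" "\<And>j. j < i \<Longrightarrow> v j = u j" using i by (auto split: if_splits)
          have ub': "u \<in> box n c (d - q + q)" using ub q by simp
          obtain x where x: "x \<in> box n c (d - q + q)" "\<And>j. v j \<le> x j" "x = u \<or> less_fun x u"
            using exists_lex_le_multiple[OF vb ub' \<open>i < n\<close> i'] by blast
          have "x \<in> B (q - q)" using chain Bb v q x(1,2) by (intro shadow_chain[where d = d and B = B]) auto
          then show False using x(3) u(2) B(1)[of 0] ub unfolding lexup_def by auto
        qed
        then show "v \<in> ?L q" using vn by (simp add: slice_def)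
      qed
      then have "card (B q) \<le> card (?L q)" if "q \<le> d" for q
        using that Llex[OF that] by (intro card_mono) (auto intro: lexup_finite)
      moreover have "card (B 0) < card (?L 0)" using less by simp
      ultimately have "(\<Sum>q | q \<le> d. card (B q)) < (\<Sum>q | q \<le> d. card (?L q))"
        by (intro sum_strict_mono_ex1) auto
      then show False using le by simp
    qed
    then have "card (?L 0) \<le> card (?A 0)" using B(2)[of 0] by simp
    moreover have "lexup n c d (?L 0)" "?A 0 \<subseteq> box n c d" using Llex[of 0] slice_subset_box[OF A, of 0] by auto
    ultimately have "new_count c (?L 0) k \<le> new_count c (?A 0) k"
      using big slice_stable[OF st, of 0] k False unfolding lex_new_count_minimal_def by (metis less_antisym)
    moreover have "{w \<in> X. (\<forall>j>k. w j = 0) \<and> Suc (w k) < c k} = {w \<in> slice n 0 X. (\<forall>j>k. w j = 0) \<and> Suc (w k) < c k}"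
      for X
      using k False by (auto simp: slice_def fun_upd_idem)
    then have "new_count c X k = new_count c (slice n 0 X) k" for X unfolding new_count_def by metis
    ultimately show ?thesis by simp
  next
    case True
    have nc: "new_count c X k = card {w \<in> X. Suc (w n) < c n}" if "X \<subseteq> box (Suc n) c d" for X
      unfolding new_count_def using that True box_zero[of _ "Suc n" c d] by (intro arg_cong[of _ _ card]) auto
    \<comment> \<open>For \<open>k = n\<close> every vector counts except those in the top slice,
      where the last exponent is \<open>c n - 1\<close>.\<close>
    have "(\<Sum>q | q \<le> d \<and> Suc q < c n. card (?L q)) \<le> (\<Sum>q | q \<le> d \<and> Suc q < c n. card (B q))"
    proof (cases "\<exists>y t. t \<le> d \<and> c n = Suc t \<and> y \<in> B t \<and> y \<notin> ?L t")
      case True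
      then obtain y t where t: "t \<le> d" "c n = Suc t" and y: "y \<in> B t" "y \<notin> ?L t" by blast
      have yb: "y \<in> box n c (d - t)" using Bb t y by blast
      have yn: "y n = 0" using box_zero[OF yb] by simp
      have ytb: "y(n := t) \<in> box (Suc n) c d" using box_Suc_upd[of y n t d c] yb yn t by simp
      have ytL: "y(n := t) \<notin> L" using y(2) yn by (simp add: slice_def)
      have "?L q \<subseteq> B q" if q: "q \<le> d" "Suc q < c n" for q
      proof
        fix v assume v: "v \<in> ?L q"
        have vb: "v \<in> box n c (d - q)" using slice_subset_box[OF Lb q(1)] v by blast
        have vL: "v(n := q) \<in> L" using v by (simp add: slice_def)
        have "less_fun (y(n := t)) (v(n := q))"
          using L ytL ytb vL unfolding lexup_def by (metis less_fun_cases)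
        then obtain i where i: "(y(n := t)) i < (v(n := q)) i" "\<And>j. j < i \<Longrightarrow> (y(n := t)) j = (v(n := q)) j"
          unfolding less_fun_def by blast
        have "i < n"
        proof (rule ccontr)
          assume "\<not> i < n"
          then show False using i(1) q(2) t(2) box_zero[OF vb, of i] by (cases "i = n") auto
        qed
        then have i': "y i < v i" "\<And>j. j < i \<Longrightarrow> y j = v j" using i by (auto split: if_splits)
        have dq: "d - t + (t - q) = d - q" using t q by simp
        have vb': "v \<in> box n c (d - t + (t - q))" using vb dq by simp
        obtain x where x: "x \<in> box n c (d - t + (t - q))" "\<And>j. y j \<le> x j" "x = v \<or> less_fun x v"
          using exists_lex_le_multiple[OF yb vb' \<open>i < n\<close> i'] by blast
        have "x \<in> B (t - (t - q))" using chain Bb y t x(1,2) by (intro shadow_chain[where d = d and B = B]) auto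
        then have "x \<in> B q" using t q by simp
        then show "v \<in> B q" using x(3) B(1)[OF q(1)] vb unfolding lexup_def by auto
      qed
      then show ?thesis using B(1) by (intro sum_mono card_mono) (auto intro: lexup_finite)
    next
      case False
      \<comment> \<open>Here the top slice of \<open>B\<close> lies in that of \<open>L\<close>, and
        \<open>B q\<close> is empty from \<open>c n\<close> on. Subtracting these from the two
        totals compares the lower slices.\<close>
      let ?S = "{q. q \<le> d \<and> Suc q < c n}" and ?T = "{q. q \<le> d \<and> \<not> Suc q < c n}"
      have split: "(\<Sum>q | q \<le> d. f q) = sum f ?S + sum f ?T" for f :: "nat \<Rightarrow> nat"
      proof -
        have "{q. q \<le> d} = ?S \<union> ?T" by auto
        moreover have "sum f (?S \<union> ?T) = sum f ?S + sum f ?T" by (rule sum.union_disjoint) auto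
        ultimately show ?thesis by (simp only:)
      qed
      have "card (B q) \<le> card (?L q)" if q: "q \<le> d" "\<not> Suc q < c n" for q
      proof (cases "c n = Suc q")
        case True
        then have "B q \<subseteq> ?L q" using False q by blast
        then show ?thesis using Llex[OF q(1)] by (intro card_mono) (auto intro: lexup_finite)
      next
        case False
        then have "B q = {}" using Bc[OF q(1)] q(2) by auto
        then show ?thesis by simp
      qed
      then have "(\<Sum>q\<in>?T. card (B q)) \<le> (\<Sum>q\<in>?T. card (?L q))" by (intro sum_mono) auto
      then show ?thesis using le unfolding split by linarith
    qed
    then show ?thesis
      unfolding nc[OF A] nc[OF Lb] cardA[of "\<lambda>x. Suc x < c n"] cardL[of "\<lambda>x. Suc x < c n"] .
  qed
qed

text \<open>The two minimality statements alternate: counts in \<open>m\<close> variables give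
  shadows in \<open>m\<close> variables by compression, and both together give counts in
  \<open>Suc m\<close> variables.\<close>

theorem clements_lindstrom:
  assumes c: "\<And>i j. i < j \<Longrightarrow> j < n \<Longrightarrow> c i \<le> c j"
  shows "lex_shadow_minimal n c"
proof -
  have "lex_new_count_minimal m c" if "m \<le> n" for m
    using that
  proof (induction m)
    case 0
    show ?case by (simp add: lex_new_count_minimal_def)
  next
    case (Suc m)
    then have "lex_new_count_minimal m c" by simp
    moreover from this have "lex_shadow_minimal m c" by (rule lex_shadow_minimalI[rotated]) (use c Suc.prems in auto)
    ultimately show ?case by (rule lex_new_count_minimal_Suc[rotated])
  qed
  then show ?thesis using lex_shadow_minimalI c by blast
qed

section \<open>Numerical functions with admissible growth\<close>

text \<open>The complement of \<open>A\<close> plays the role of the standard monomials, so \<open>h\<close> is a Hilbert function of a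
  quotient and \<open>card A = card (box n c e) - h e\<close>.\<close>

definition admissible :: "nat \<Rightarrow> (nat \<Rightarrow> nat) \<Rightarrow> (nat \<Rightarrow> nat) \<Rightarrow> bool" where
  "admissible n c h \<longleftrightarrow> (\<forall>e. h e \<le> card (box n c e)) \<and>
     (\<forall>e A. lexup n c e A \<longrightarrow> card A + h e = card (box n c e) \<longrightarrow>
        card (shadow n c A) + h (Suc e) \<le> card (box n c (Suc e)))"

text \<open>Here the sliced variable is \<open>0\<close>, the lex-largest one, and the other indices
  shift down; \<open>slice\<close> cuts along the last variable.\<close>

definition glue_slices :: "nat \<Rightarrow> nat \<Rightarrow> (nat \<Rightarrow> (nat \<Rightarrow> nat) set) \<Rightarrow> (nat \<Rightarrow> nat) set" where
  "glue_slices m e A = {w. w 0 < m \<and> w 0 \<le> e \<and> (\<lambda>i. w (Suc i)) \<in> A (w 0)}"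

lemma box_Suc_eq_glue_slices: "box (Suc r) c e = glue_slices (c 0) e (\<lambda>k. box r (\<lambda>i. c (Suc i)) (e - k))"
proof (intro set_eqI)
  fix w :: "nat \<Rightarrow> nat"
  have 1: "(\<forall>i<Suc r. w i < c i) \<longleftrightarrow> w 0 < c 0 \<and> (\<forall>i<r. w (Suc i) < c (Suc i))"
    using less_Suc_eq_0_disj by auto
  have 2: "(\<forall>i\<ge>Suc r. w i = 0) \<longleftrightarrow> (\<forall>i\<ge>r. w (Suc i) = 0)"
    by (metis Suc_le_D Suc_le_mono)
  have 3: "(\<Sum>i<Suc r. w i) = e \<longleftrightarrow> w 0 \<le> e \<and> (\<Sum>i<r. w (Suc i)) = e - w 0"
    unfolding sum.lessThan_Suc_shift by auto
  show "w \<in> box (Suc r) c e \<longleftrightarrow> w \<in> glue_slices (c 0) e (\<lambda>k. box r (\<lambda>i. c (Suc i)) (e - k))"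
    unfolding box_def glue_slices_def mem_Collect_eq 1 2 3 by blast
qed

lemma card_glue_slices:
  assumes "\<And>k. k < m \<Longrightarrow> k \<le> e \<Longrightarrow> finite (A k)"
  shows "card (glue_slices m e A) = (\<Sum>k | k < m \<and> k \<le> e. card (A k))"
proof -
  have "card (glue_slices m e A) = card (SIGMA k:{k. k < m \<and> k \<le> e}. A k)"
  proof (rule bij_betw_same_card[OF bij_betw_byWitness[where
        f = "\<lambda>w. (w 0, \<lambda>i. w (Suc i))" and f' = "\<lambda>(k, v). case_nat k v"]])
    show "\<forall>w\<in>glue_slices m e A. (case (w 0, \<lambda>i. w (Suc i)) of (k, v) \<Rightarrow> case_nat k v) = w"
      by (auto simp: fun_eq_iff split: nat.split)
  qed (auto simp: glue_slices_def)
  also have "\<dots> = (\<Sum>k | k < m \<and> k \<le> e. card (A k))"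
    using assms by (intro card_SigmaI) auto
  finally show ?thesis .
qed

text \<open>\<open>X e\<close> stacks lex segments whose complements have sizes
  \<open>H k (e - k)\<close>, so its own complement has size \<open>h e\<close>. The shadow of
  \<open>X d\<close> stays in \<open>X (Suc d)\<close>: by \<open>dec\<close> for multiplication by
  variable \<open>0\<close>, by \<open>adm\<close> for the others. \<open>X d\<close> need not be a
  lex segment; Clements--Lindstroem passes from it to \<open>A\<close>.\<close>

lemma admissible_glue:
  fixes r c
  defines "c' \<equiv> \<lambda>i. c (Suc i)"
  assumes c: "\<And>i j. i < j \<Longrightarrow> j < Suc r \<Longrightarrow> c i \<le> c j"
    and adm: "\<And>k. k < c 0 \<Longrightarrow> admissible r c' (H k)"
    and h: "\<And>e. h e = (\<Sum>k | k < c 0 \<and> k \<le> e. H k (e - k))"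
    and dec: "\<And>k. Suc k < c 0 \<Longrightarrow> k \<le> d \<Longrightarrow> H (Suc k) (d - k) \<le> H k (d - k)"
  shows "h e \<le> card (box (Suc r) c e)"
    and "lexup (Suc r) c d A \<Longrightarrow> card A + h d = card (box (Suc r) c d) \<Longrightarrow>
      card (shadow (Suc r) c A) + h (Suc d) \<le> card (box (Suc r) c (Suc d))"
proof -
  let ?K = "\<lambda>e. {k. k < c 0 \<and> k \<le> e}"
  have N: "card (box (Suc r) c e) = (\<Sum>k\<in>?K e. card (box r c' (e - k)))" for e
    unfolding box_Suc_eq_glue_slices c'_def by (rule card_glue_slices) simp
  have Hle: "H k e \<le> card (box r c' e)" if "k < c 0" for k e
    using adm[OF that] by (simp add: admissible_def)
  show "h e \<le> card (box (Suc r) c e)" unfolding N h using Hle by (intro sum_mono) auto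
  assume A: "lexup (Suc r) c d A" and cardA: "card A + h d = card (box (Suc r) c d)"
  have "\<exists>L. \<forall>e k. k < c 0 \<longrightarrow> lexup r c' e (L e k) \<and> card (L e k) = card (box r c' e) - H k e"
    using lexup_exists[of _ r c'] by (intro choice allI) (metis diff_le_self)
  then obtain L where L: "\<And>e k. k < c 0 \<Longrightarrow> lexup r c' e (L e k)"
      "\<And>e k. k < c 0 \<Longrightarrow> card (L e k) = card (box r c' e) - H k e" by blast
  define X where "X e = glue_slices (c 0) e (\<lambda>k. L (e - k) k)" for e
  have Xsub: "X e \<subseteq> box (Suc r) c e" for e
  proof
    fix w assume "w \<in> X e"
    then show "w \<in> box (Suc r) c e"
      using L(1) unfolding X_def box_Suc_eq_glue_slices glue_slices_def lexup_def c'_def by blast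
  qed
  have Xcard: "card (X e) + h e = card (box (Suc r) c e)" for e
  proof -
    have "card (X e) = (\<Sum>k\<in>?K e. card (L (e - k) k))"
      unfolding X_def using L(1) by (intro card_glue_slices) (auto intro: lexup_finite)
    then have "card (X e) + h e = (\<Sum>k\<in>?K e. card (L (e - k) k) + H k (e - k))"
      unfolding h by (simp add: sum.distrib)
    also have "\<dots> = (\<Sum>k\<in>?K e. card (box r c' (e - k)))"
      using L(2) Hle by (intro sum.cong) auto
    finally show ?thesis using N by simp
  qed
  have up: "L (d - k) k \<subseteq> L (d - k) (Suc k)" if "Suc k < c 0" "k \<le> d" for k
    using lexup_subset_iff[OF L(1) L(1), of k "Suc k" "d - k"] L(2) dec[OF that] that by simp
  have sh: "shadow r c' (L e k) \<subseteq> L (Suc e) k" if "k < c 0" for k e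
  proof -
    have "card (L e k) + H k e = card (box r c' e)" using L(2)[OF that] Hle[OF that, of e] by simp
    then have "card (shadow r c' (L e k)) + H k (Suc e) \<le> card (box r c' (Suc e))"
      using adm[OF that] L(1)[OF that] unfolding admissible_def by blast
    then show ?thesis
      using lexup_subset_iff[OF lexup_shadow[OF L(1)[OF that]] L(1)[OF that]] L(2)[OF that] by simp
  qed
  have "shadow (Suc r) c (X d) \<subseteq> X (Suc d)"
  proof
    fix u assume u: "u \<in> shadow (Suc r) c (X d)"
    then obtain w j where w: "w \<in> X d" "j < Suc r" "Suc (w j) < c j" "u = w(j := Suc (w j))"
      by (auto simp: shadow_def)
    have w': "w 0 < c 0" "w 0 \<le> d" "(\<lambda>i. w (Suc i)) \<in> L (d - w 0) (w 0)"
      using w(1) by (auto simp: X_def glue_slices_def)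
    show "u \<in> X (Suc d)"
    proof (cases j)
      case 0
      \<comment> \<open>The exponent \<open>w 0\<close> and the total degree rise together, so the
        remaining degree is still \<open>d - w 0\<close>.\<close>
      have "(\<lambda>i. w (Suc i)) \<in> L (d - w 0) (Suc (w 0))" using up[of "w 0"] w' w(3) 0 by blast
      then show ?thesis using w 0 w' by (simp add: X_def glue_slices_def)
    next
      case (Suc i)
      have "(\<lambda>l. w (Suc l))(i := Suc (w (Suc i))) \<in> shadow r c' (L (d - w 0) (w 0))"
        using shadowI[OF w'(3), of i r c'] w Suc by (simp add: c'_def)
      then have "(\<lambda>l. w (Suc l))(i := Suc (w (Suc i))) \<in> L (Suc d - w 0) (w 0)"
        using sh[OF w'(1)] w'(2) by (auto simp: Suc_diff_le)
      moreover have "(\<lambda>l. u (Suc l)) = (\<lambda>l. w (Suc l))(i := Suc (w (Suc i)))"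
        using w(4) Suc by (auto simp: fun_eq_iff)
      ultimately show ?thesis using w Suc w' by (simp add: X_def glue_slices_def)
    qed
  qed
  then have "card (shadow (Suc r) c (X d)) \<le> card (X (Suc d))"
    by (rule card_mono[OF finite_subset_box[OF Xsub]])
  moreover have "card (shadow (Suc r) c A) \<le> card (shadow (Suc r) c (X d))"
  proof -
    have "lex_shadow_minimal (Suc r) c" using c by (intro clements_lindstrom) auto
    moreover have "card A \<le> card (X d)" using cardA Xcard[of d] by simp
    ultimately show ?thesis using A Xsub unfolding lex_shadow_minimal_def by blast
  qed
  ultimately show "card (shadow (Suc r) c A) + h (Suc d) \<le> card (box (Suc r) c (Suc d))"
    using Xcard[of "Suc d"] by simp
qed

section \<open>Homogeneous ideals\<close>

lemma mdeg_add: "mdeg (m + m') = mdeg m + mdeg m'"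
  by (simp add: mdeg_def lookup_add sum.distrib)

lemma forms_mult:
  fixes p q :: "('n::finite, 'k::comm_ring_1) mpoly"
  shows "p \<in> forms d \<Longrightarrow> q \<in> forms e \<Longrightarrow> p * q \<in> forms (d + e)"
  using keys_mult[of p q] unfolding forms_def by (auto simp: mdeg_add)

lemma forms_0_1: "1 \<in> forms 0"
  by (simp add: forms_def mdeg_def)

definition hcomp :: "nat \<Rightarrow> ('n::finite, 'k::field) mpoly \<Rightarrow> ('n, 'k) mpoly" where
  "hcomp d p = (\<Sum>m\<in>{m \<in> Poly_Mapping.keys p. mdeg m = d}. Poly_Mapping.single m (Poly_Mapping.lookup p m))"

lemma lookup_hcomp: "Poly_Mapping.lookup (hcomp d p) m = (if mdeg m = d then Poly_Mapping.lookup p m else 0)"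
  by (auto simp: hcomp_def lookup_sum lookup_single when_def in_keys_iff)

lemma hcomp_0 [simp]: "hcomp d 0 = 0"
  by (rule poly_mapping_eqI) (simp add: lookup_hcomp)

lemma hcomp_add: "hcomp d (p + q) = hcomp d p + hcomp d q"
  by (rule poly_mapping_eqI) (simp add: lookup_hcomp lookup_add)

lemma hcomp_sum: "hcomp d (sum g A) = (\<Sum>x\<in>A. hcomp d (g x))"
  by (induction A rule: infinite_finite_induct) (simp_all add: hcomp_add)

lemma keys_hcomp: "Poly_Mapping.keys (hcomp d p) = {m \<in> Poly_Mapping.keys p. mdeg m = d}"
  by (auto simp: in_keys_iff lookup_hcomp split: if_splits)

lemma hcomp_forms: "hcomp d p \<in> forms d"
  by (simp add: forms_def keys_hcomp)

lemma hcomp_of_form: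
  assumes "p \<in> forms d" shows "hcomp e p = (if e = d then p else 0)"
proof (rule poly_mapping_eqI)
  fix m
  have "mdeg m = d" if "Poly_Mapping.lookup p m \<noteq> 0" using assms that by (simp add: forms_def in_keys_iff)
  then show "Poly_Mapping.lookup (hcomp e p) m = Poly_Mapping.lookup (if e = d then p else 0) m"
    by (auto simp: lookup_hcomp)
qed

lemma hcomp_hcomp: "hcomp e (hcomp d p) = (if e = d then hcomp d p else 0)"
  by (rule hcomp_of_form[OF hcomp_forms])

lemma sum_hcomp: "p = (\<Sum>d\<in>mdeg ` Poly_Mapping.keys p. hcomp d p)"
  by (rule poly_mapping_eqI) (auto simp: lookup_sum lookup_hcomp in_keys_iff)

lemma hcomp_eq_0: "d \<notin> mdeg ` Poly_Mapping.keys p \<Longrightarrow> hcomp d p = 0"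
  by (rule poly_mapping_eqI) (auto simp: lookup_hcomp in_keys_iff)

lemma hcomp_mult_form:
  assumes l: "l \<in> forms a"
  shows "hcomp e (l * p) = (if a \<le> e then l * hcomp (e - a) p else 0)"
proof -
  let ?D = "mdeg ` Poly_Mapping.keys p"
  have "hcomp e (l * p) = hcomp e (l * (\<Sum>d\<in>?D. hcomp d p))" using sum_hcomp[of p] by simp
  also have "\<dots> = (\<Sum>d\<in>?D. hcomp e (l * hcomp d p))" by (simp add: hcomp_sum sum_distrib_left)
  also have "\<dots> = (\<Sum>d\<in>?D. if d = e - a \<and> a \<le> e then l * hcomp (e - a) p else 0)"
    by (rule sum.cong) (auto simp: hcomp_of_form[OF forms_mult[OF l hcomp_forms]])
  also have "\<dots> = (if a \<le> e then l * hcomp (e - a) p else 0)"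
    using hcomp_eq_0[of "e - a" p] by (cases "a \<le> e") (auto simp: sum.delta)
  finally show ?thesis .
qed

text \<open>In contrast to \<open>graded_ideal\<close>, the whole ring is allowed: repeated colon
  ideals end there.\<close>

definition hideal :: "('n::finite, 'k::field) mpoly set \<Rightarrow> bool" where
  "hideal I \<longleftrightarrow> ideal.subspace I \<and> (\<forall>p\<in>I. \<forall>d. hcomp d p \<in> I)"

lemma hideal_subspace: "hideal I \<Longrightarrow> ideal.subspace I"
  by (simp add: hideal_def)

lemma hideal_hcomp: "hideal I \<Longrightarrow> p \<in> I \<Longrightarrow> hcomp d p \<in> I"
  by (simp add: hideal_def)

text \<open>Components of degree at most \<open>e\<close> see only generators of degree at most
  \<open>e\<close>, so nothing is asked of the others beyond homogeneity.\<close>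

lemma hcomp_span:
  assumes G: "\<And>g. g \<in> G \<Longrightarrow> \<exists>a. g \<in> forms a \<and> (a \<le> e \<longrightarrow> g \<in> ideal.span L)" and p: "p \<in> ideal.span G"
    and de: "d \<le> e"
  shows "hcomp d p \<in> ideal.span L"
  using p
proof (induction rule: ideal.span_induct_alt)
  case base
  then show ?case by (simp add: ideal.span_zero)
next
  case (step c x y)
  obtain a where a: "x \<in> forms a" "a \<le> e \<longrightarrow> x \<in> ideal.span L" using G step by blast
  have "hcomp d (c * x) = (if a \<le> d then hcomp (d - a) c * x else 0)"
    using hcomp_mult_form[OF a(1), of d c] by (simp add: mult.commute)
  also have "\<dots> \<in> ideal.span L" using a(2) de by (auto intro: ideal.span_scale ideal.span_zero)
  finally show ?case using step by (auto simp: hcomp_add intro: ideal.span_add)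
qed

lemma hideal_span:
  assumes "G \<subseteq> (\<Union>d. forms d)" shows "hideal (ideal.span G)"
  unfolding hideal_def
proof (intro conjI ballI allI)
  fix p d assume "p \<in> ideal.span G"
  then show "hcomp d p \<in> ideal.span G"
    using assms by (intro hcomp_span[of G d G p d]) (auto intro: ideal.span_base)
qed simp

lemma graded_ideal_hideal: "graded_ideal I \<Longrightarrow> hideal I"
  using hideal_span by (auto simp: graded_ideal_def)

section \<open>Colon ideals and sums with a principal ideal\<close>

definition colon :: "'a::comm_ring_1 set \<Rightarrow> 'a \<Rightarrow> 'a set" where
  "colon I f = {g. f * g \<in> I}"

definition adjoin :: "'a::comm_ring_1 set \<Rightarrow> 'a \<Rightarrow> 'a set" where
  "adjoin I f = {x + f * y | x y. x \<in> I}"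

lemma ideal_mult: "ideal.subspace I \<Longrightarrow> x \<in> I \<Longrightarrow> c * x \<in> I"
  by (rule ideal.subspace_scale)

lemma subspace_colon: "ideal.subspace I \<Longrightarrow> ideal.subspace (colon I f)"
  by (rule ideal.subspaceI)
    (auto simp: colon_def distrib_left ideal.subspace_0 mult.left_commute[of f] intro: ideal.subspace_add ideal.subspace_scale)

lemma subspace_adjoin: "ideal.subspace I \<Longrightarrow> ideal.subspace (adjoin I f)"
proof (rule ideal.subspaceI)
  assume I: "ideal.subspace I"
  show "0 \<in> adjoin I f" unfolding adjoin_def using ideal.subspace_0[OF I] by (auto intro!: exI[of _ 0])
  fix x y assume "x \<in> adjoin I f" "y \<in> adjoin I f"
  then obtain x' x'' y' y'' where "x' \<in> I" "x = x' + f * x''" "y' \<in> I" "y = y' + f * y''"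
    unfolding adjoin_def by blast
  then have "x' + y' \<in> I" "x + y = (x' + y') + f * (x'' + y'')"
    using ideal.subspace_add[OF I] by (auto simp: algebra_simps)
  then show "x + y \<in> adjoin I f" unfolding adjoin_def by blast
next
  fix c x assume I: "ideal.subspace I" and "x \<in> adjoin I f"
  then obtain x' x'' where "x' \<in> I" "x = x' + f * x''"
    unfolding adjoin_def by blast
  then have "c * x' \<in> I" "c * x = c * x' + f * (c * x'')"
    using ideal.subspace_scale[OF I, of x' c] by (simp_all add: distrib_left mult.left_commute)
  then show "c * x \<in> adjoin I f" unfolding adjoin_def by blast
qed

lemma hideal_colon: "hideal I \<Longrightarrow> f \<in> forms a \<Longrightarrow> hideal (colon I f)"
  unfolding hideal_def
proof (intro conjI ballI allI)
  assume I: "ideal.subspace I \<and> (\<forall>p\<in>I. \<forall>d. hcomp d p \<in> I)" and f: "f \<in> forms a"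
  show "ideal.subspace (colon I f)" using I by (simp add: subspace_colon)
  fix p d assume "p \<in> colon I f"
  then have "hcomp (a + d) (f * p) \<in> I" using I by (simp add: colon_def)
  then show "hcomp d p \<in> colon I f" by (simp add: colon_def hcomp_mult_form[OF f])
qed

lemma hideal_adjoin: "hideal I \<Longrightarrow> f \<in> forms a \<Longrightarrow> hideal (adjoin I f)"
  unfolding hideal_def
proof (intro conjI ballI allI)
  assume I: "ideal.subspace I \<and> (\<forall>p\<in>I. \<forall>d. hcomp d p \<in> I)" and f: "f \<in> forms a"
  show "ideal.subspace (adjoin I f)" using I by (simp add: subspace_adjoin)
  fix p d assume "p \<in> adjoin I f"
  then obtain x y where xy: "x \<in> I" "p = x + f * y" by (auto simp: adjoin_def)
  have "hcomp d p = hcomp d x + f * (if a \<le> d then hcomp (d - a) y else 0)"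
    using xy by (simp add: hcomp_add hcomp_mult_form[OF f])
  then show "hcomp d p \<in> adjoin I f" using I xy unfolding adjoin_def by blast
qed

lemma subset_colon: "ideal.subspace I \<Longrightarrow> I \<subseteq> colon I f"
  by (auto simp: colon_def intro: ideal_mult)

lemma subset_adjoin: "I \<subseteq> adjoin I f"
proof
  fix x assume "x \<in> I"
  then have "x + f * 0 \<in> adjoin I f" unfolding adjoin_def by blast
  then show "x \<in> adjoin I f" by simp
qed

lemma adjoin_self: "ideal.subspace I \<Longrightarrow> f \<in> adjoin I f"
proof -
  assume "ideal.subspace I"
  then have "0 + f * 1 \<in> adjoin I f" unfolding adjoin_def using ideal.subspace_0 by blast
  then show ?thesis by simp
qed

lemma adjoin_mono: "I \<subseteq> J \<Longrightarrow> adjoin I f \<subseteq> adjoin J f"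
  by (auto simp: adjoin_def)

section \<open>Monotonicity and additivity of Hilbert functions\<close>

lemma mpoly_subspace_ideal:
  fixes I :: "('n, 'k::field) mpoly set"
  shows "ideal.subspace I \<Longrightarrow> mpoly.subspace I"
  by (auto simp: mpoly.subspace_def ideal.subspace_def const_mult_def)

lemma subspace_ideal_forms:
  fixes I :: "('n::finite, 'k::field) mpoly set"
  shows "ideal.subspace I \<Longrightarrow> mpoly.subspace (I \<inter> forms d)"
  by (intro mpoly.subspace_inter mpoly_subspace_ideal subspace_forms)

lemma forms_fin_span:
  obtains A :: "('n::finite, 'k::field) mpoly set" where "finite A" "forms d \<subseteq> mpoly.span A"
  using forms_subset_span[of d] finite_mdeg by blast

lemma hilbert_mono:
  fixes I :: "('n::finite, 'k::field) mpoly set"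
  assumes "ideal.subspace I" "ideal.subspace J" "I \<inter> forms d \<subseteq> J \<inter> forms d"
  shows "hilbert J d \<le> hilbert I d"
proof -
  obtain A :: "('n, 'k) mpoly set" where A: "finite A" "forms d \<subseteq> mpoly.span A" by (rule forms_fin_span)
  have "mpoly.dim (I \<inter> forms d) \<le> mpoly.dim (J \<inter> forms d)"
  proof -
    obtain C where C: "C \<subseteq> I \<inter> forms d" "mpoly.independent C" "card C = mpoly.dim (I \<inter> forms d)"
      using mpoly.basis_exists[of "I \<inter> forms d"] by metis
    obtain D where D: "C \<subseteq> D" "D \<subseteq> J \<inter> forms d" "mpoly.independent D" "J \<inter> forms d \<subseteq> mpoly.span D"
      using mpoly.maximal_independent_subset_extend[of C "J \<inter> forms d"] C assms(3) by blast
    have "finite D" using mpoly.independent_span_bound[OF A(1) D(3)] D(2) A(2) by blast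
    moreover have "card D = mpoly.dim (J \<inter> forms d)" using mpoly.basis_card_eq_dim[OF D(2,4,3)] .
    ultimately show ?thesis using card_mono[OF _ D(1)] C(3) by simp
  qed
  then show ?thesis using hilbert_eq[OF assms(1), of d] hilbert_eq[OF assms(2), of d] by linarith
qed

lemma hilbert_cong:
  fixes I :: "('n::finite, 'k::field) mpoly set"
  shows "I \<inter> forms d = J \<inter> forms d \<Longrightarrow> hilbert I d = hilbert J d"
  by (simp add: hilbert_def)

text \<open>Multiplication by \<open>f\<close> identifies the quotient by \<open>colon I f\<close>,
  shifted by \<open>a\<close>, with \<open>adjoin I f\<close> modulo \<open>I\<close>. Concretely,
  \<open>f\<close> times a basis of the former in degree \<open>e - a\<close> is a basis of the
  latter in degree \<open>e\<close>.\<close>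

lemma hilbert_split:
  fixes I :: "('n::finite, 'k::field) mpoly set"
  assumes I: "hideal I" and f: "f \<in> forms a"
  shows "hilbert I e = hilbert (adjoin I f) e + (if a \<le> e then hilbert (colon I f) (e - a) else 0)"
proof (cases "a \<le> e")
  case False
  have "adjoin I f \<inter> forms e = I \<inter> forms e"
  proof (intro equalityI subsetI)
    fix p assume p: "p \<in> adjoin I f \<inter> forms e"
    then obtain x y where xy: "x \<in> I" "p = x + f * y" by (auto simp: adjoin_def)
    have "p = hcomp e p" using p hcomp_of_form[of p e e] by simp
    also have "\<dots> = hcomp e x" using False xy by (simp add: hcomp_add hcomp_mult_form[OF f])
    finally show "p \<in> I \<inter> forms e" using p xy hideal_hcomp[OF I xy(1), of e] by simp
  qed (use subset_adjoin in auto)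
  then show ?thesis using False by (simp add: hilbert_def)
next
  case True
  let ?C = "colon I f" and ?J = "adjoin I f"
  have sI: "ideal.subspace I" and sC: "ideal.subspace ?C" and sJ: "ideal.subspace ?J"
    by (rule hideal_subspace[OF I], rule subspace_colon[OF hideal_subspace[OF I]],
        rule subspace_adjoin[OF hideal_subspace[OF I]])
  obtain A1 :: "('n, 'k) mpoly set" where A1: "finite A1" "forms (e - a) \<subseteq> mpoly.span A1" by (rule forms_fin_span)
  obtain A2 :: "('n, 'k) mpoly set" where A2: "finite A2" "forms e \<subseteq> mpoly.span A2" by (rule forms_fin_span)
  obtain B where B: "quot_basis const_mult (forms (e - a)) (?C \<inter> forms (e - a)) B"
    using mpoly.quot_basis_exists[OF subspace_forms subspace_ideal_forms[OF sC] _ A1] by blast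
  have cardB: "card B + mpoly.dim (?C \<inter> forms (e - a)) = mpoly.dim (forms (e - a) :: ('n, 'k) mpoly set)"
    using mpoly.quot_basis_card[OF subspace_forms subspace_ideal_forms[OF sC] _ A1 B] by blast
  have finB: "finite B" and BV: "B \<subseteq> forms (e - a)"
    and ind: "\<And>c. (\<Sum>b\<in>B. const_mult (c b) b) \<in> ?C \<inter> forms (e - a) \<Longrightarrow> (\<forall>b\<in>B. c b = 0)"
    and gen: "\<And>v. v \<in> forms (e - a) \<Longrightarrow> \<exists>c. v - (\<Sum>b\<in>B. const_mult (c b) b) \<in> ?C \<inter> forms (e - a)"
    using B by (auto simp: quot_basis_def)
  have sumV: "(\<Sum>b\<in>B. const_mult (c b) b) \<in> forms (e - a)" for c
    using BV by (intro mpoly.subspace_sum[OF subspace_forms] mpoly.subspace_scale[OF subspace_forms]) auto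
  have fsum: "f * (\<Sum>b\<in>B. const_mult (c b) b) = (\<Sum>b\<in>B. const_mult (c b) (f * b))" for c
    by (simp add: sum_distrib_left const_mult_def mult.left_commute)
  have ind': "\<forall>b\<in>B. c b = 0" if "(\<Sum>b\<in>B. const_mult (c b) (f * b)) \<in> I" for c
    using ind[of c] that sumV[of c] unfolding fsum[symmetric] by (simp add: colon_def)
  have inj: "inj_on ((*) f) B"
  proof (rule inj_onI, rule ccontr)
    fix b b' assume b: "b \<in> B" "b' \<in> B" "f * b = f * b'" "b \<noteq> b'"
    define c where "c x = (if x = b then 1 else if x = b' then - 1 else (0::'k))" for x
    have "(\<Sum>x\<in>B. const_mult (c x) (f * x)) = (\<Sum>x\<in>{b, b'}. const_mult (c x) (f * x))"
      using b finB by (intro sum.mono_neutral_right) (auto simp: c_def const_mult_def)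
    also have "\<dots> = const_mult 1 (f * b) + const_mult (- 1) (f * b)" using b(3,4) by (simp add: c_def)
    also have "\<dots> = 0" by (simp flip: mpoly.scale_left_distrib)
    finally have "(\<Sum>x\<in>B. const_mult (c x) (f * x)) \<in> I" using ideal.subspace_0[OF sI] by simp
    from ind'[OF this] b(1) show False by (auto simp: c_def)
  qed
  have Q: "quot_basis const_mult (?J \<inter> forms e) (I \<inter> forms e) ((*) f ` B)"
    unfolding quot_basis_def
  proof (intro conjI allI impI ballI)
    show "finite ((*) f ` B)" using finB by simp
    show "(*) f ` B \<subseteq> ?J \<inter> forms e"
    proof
      fix x assume "x \<in> (*) f ` B"
      then obtain b where b: "b \<in> B" "x = f * b" by blast
      have "0 + f * b \<in> ?J" unfolding adjoin_def using ideal.subspace_0[OF sI] by blast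
      moreover have "f * b \<in> forms (a + (e - a))" using forms_mult[OF f] b BV by blast
      ultimately show "x \<in> ?J \<inter> forms e" using b True by simp
    qed
    fix c x assume c: "(\<Sum>b\<in>(*) f ` B. const_mult (c b) b) \<in> I \<inter> forms e" and x: "x \<in> (*) f ` B"
    have "(\<Sum>b\<in>B. const_mult (c (f * b)) (f * b)) \<in> I"
      using c unfolding sum.reindex[OF inj] by (simp add: o_def)
    from ind'[OF this] x show "c x = 0" by auto
  next
    fix v assume v: "v \<in> ?J \<inter> forms e"
    then obtain x y where xy: "x \<in> I" "v = x + f * y" by (auto simp: adjoin_def)
    have veq: "v = hcomp e x + f * hcomp (e - a) y"
      using v hcomp_of_form[of v e e] xy True by (simp add: hcomp_add hcomp_mult_form[OF f])
    obtain c where c: "hcomp (e - a) y - (\<Sum>b\<in>B. const_mult (c b) b) \<in> ?C \<inter> forms (e - a)"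
      using gen[OF hcomp_forms] by blast
    have "v - f * (\<Sum>b\<in>B. const_mult (c b) b) = hcomp e x + f * (hcomp (e - a) y - (\<Sum>b\<in>B. const_mult (c b) b))"
      unfolding veq by (simp add: algebra_simps)
    also have "\<dots> \<in> I" using c hideal_hcomp[OF I xy(1)] by (intro ideal.subspace_add[OF sI]) (auto simp: colon_def)
    finally have 1: "v - f * (\<Sum>b\<in>B. const_mult (c b) b) \<in> I" .
    have "f * (\<Sum>b\<in>B. const_mult (c b) b) \<in> forms (a + (e - a))" by (intro forms_mult f sumV)
    then have 2: "v - f * (\<Sum>b\<in>B. const_mult (c b) b) \<in> forms e"
      using v True by (intro mpoly.subspace_diff[OF subspace_forms]) auto
    define g where "g = inv_into B ((*) f)"
    have "(\<Sum>x\<in>(*) f ` B. const_mult (c (g x)) x) = (\<Sum>b\<in>B. const_mult (c b) (f * b))"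
      unfolding sum.reindex[OF inj] by (rule sum.cong) (auto simp: g_def inv_into_f_f[OF inj])
    then show "\<exists>c. v - (\<Sum>b\<in>(*) f ` B. const_mult (c b) b) \<in> I \<inter> forms e"
      using 1 2 unfolding fsum by (intro exI[of _ "\<lambda>x. c (g x)"]) simp
  qed
  have "I \<inter> forms e \<subseteq> ?J \<inter> forms e" using subset_adjoin by blast
  then have "card ((*) f ` B) + mpoly.dim (I \<inter> forms e) = mpoly.dim (?J \<inter> forms e)"
    using mpoly.quot_basis_card[OF subspace_ideal_forms[OF sJ] subspace_ideal_forms[OF sI] _ A2(1) _ Q] A2(2) by blast
  then show ?thesis
    using True cardB card_image[OF inj] hilbert_eq[OF sI, of e] hilbert_eq[OF sJ, of e] hilbert_eq[OF sC, of "e - a"]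
    by simp
qed

section \<open>Hilbert functions of ideals containing many products of linear forms\<close>

lemma sum_monomials:
  fixes p :: "'a \<Rightarrow>\<^sub>0 'b::comm_monoid_add"
  shows "p = (\<Sum>m\<in>Poly_Mapping.keys p. Poly_Mapping.single m (Poly_Mapping.lookup p m))"
  by (rule poly_mapping_eqI) (auto simp: lookup_sum lookup_single when_def in_keys_iff)

lemma single_mult_const: "const_mult c (Poly_Mapping.single m 1) = Poly_Mapping.single m c"
  by (simp add: const_mult_def mult_single)

lemma independent_monomials:
  "mpoly.independent ((\<lambda>m. Poly_Mapping.single m 1) ` K :: ('n, 'k::field) mpoly set)"
  unfolding mpoly.independent_explicit_module
proof (intro allI impI)
  fix T and u :: "('n, 'k) mpoly \<Rightarrow> 'k" and v
  let ?s = "\<lambda>m. Poly_Mapping.single m 1 :: ('n, 'k) mpoly"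
  assume T: "finite T" "T \<subseteq> ?s ` K" and 0: "(\<Sum>v\<in>T. const_mult (u v) v) = 0" and v: "v \<in> T"
  have inj: "inj ?s" by (rule injI) (metis lookup_single_eq lookup_single_not_eq zero_neq_one)
  obtain K' where K': "T = ?s ` K'" "finite K'"
    using T by (metis finite_imageD inj inj_on_subset subset_UNIV subset_imageE)
  obtain m where m: "m \<in> K'" "v = ?s m" using v K' by blast
  have "Poly_Mapping.lookup (\<Sum>v\<in>T. const_mult (u v) v) m = (\<Sum>m'\<in>K'. if m' = m then u (?s m) else 0)"
    unfolding K'(1) sum.reindex[OF inj_on_subset[OF inj subset_UNIV]]
    by (auto simp: lookup_sum single_mult_const lookup_single when_def intro!: sum.cong)
  also have "\<dots> = u v" using m K'(2) by simp
  finally show "u v = 0" using 0 by simp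
qed

lemma span_monomials:
  fixes K :: "('n \<Rightarrow>\<^sub>0 nat) set"
  shows "mpoly.span ((\<lambda>m. Poly_Mapping.single m 1) ` K) = {p :: ('n, 'k::field) mpoly. Poly_Mapping.keys p \<subseteq> K}"
proof (intro equalityI subsetI)
  fix p :: "('n, 'k) mpoly" assume "p \<in> mpoly.span ((\<lambda>m. Poly_Mapping.single m 1) ` K)"
  then show "p \<in> {p. Poly_Mapping.keys p \<subseteq> K}"
  proof (induction rule: mpoly.span_induct_alt)
    case (step c x y)
    then obtain m where m: "m \<in> K" "x = Poly_Mapping.single m 1" by blast
    then have "Poly_Mapping.keys (const_mult c x) \<subseteq> K" by (simp add: single_mult_const)
    then show ?case using step Poly_Mapping.keys_add[of "const_mult c x" y] by blast
  qed simp
next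
  fix p :: "('n, 'k) mpoly" assume p: "p \<in> {p. Poly_Mapping.keys p \<subseteq> K}"
  have "p = (\<Sum>m\<in>Poly_Mapping.keys p. Poly_Mapping.single m (Poly_Mapping.lookup p m))"
    by (rule sum_monomials)
  also have "\<dots> = (\<Sum>m\<in>Poly_Mapping.keys p. const_mult (Poly_Mapping.lookup p m) (Poly_Mapping.single m 1))"
    by (simp add: single_mult_const)
  also have "\<dots> \<in> mpoly.span ((\<lambda>m. Poly_Mapping.single m 1) ` K)"
    using p by (intro mpoly.span_sum mpoly.span_scale mpoly.span_base) auto
  finally show "p \<in> mpoly.span ((\<lambda>m. Poly_Mapping.single m 1) ` K)" .
qed

lemma dim_keys_subset:
  "mpoly.dim {p :: ('n, 'k::field) mpoly. Poly_Mapping.keys p \<subseteq> K} = card K"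
proof -
  have inj: "inj_on (\<lambda>m. Poly_Mapping.single m 1 :: ('n, 'k) mpoly) K"
    by (rule inj_onI) (metis lookup_single_eq lookup_single_not_eq zero_neq_one)
  have "mpoly.dim {p :: ('n, 'k) mpoly. Poly_Mapping.keys p \<subseteq> K} =
      card ((\<lambda>m. Poly_Mapping.single m 1 :: ('n, 'k) mpoly) ` K)"
    unfolding span_monomials[symmetric] mpoly.dim_span by (rule mpoly.dim_eq_card_independent[OF independent_monomials])
  then show ?thesis using card_image[OF inj] by simp
qed

lemma dim_forms: "mpoly.dim (forms d :: ('n::finite, 'k::field) mpoly set) = card {m :: 'n \<Rightarrow>\<^sub>0 nat. mdeg m = d}"
proof -
  have "(forms d :: ('n, 'k) mpoly set) = {p. Poly_Mapping.keys p \<subseteq> {m. mdeg m = d}}"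
    by (auto simp: forms_def)
  then show ?thesis by (simp add: dim_keys_subset)
qed

lemma dim_zero: "mpoly.dim {0 :: ('n, 'k::field) mpoly} = 0"
  using mpoly.dim_span[of "{} :: ('n, 'k) mpoly set"]
    mpoly.dim_eq_card_independent[of "{} :: ('n, 'k) mpoly set"] mpoly.independent_empty by simp

lemma finite_basis_in_forms:
  fixes U :: "('n::finite, 'k::field) mpoly set"
  assumes "mpoly.subspace U" "U \<subseteq> forms d"
  obtains C where "finite C" "C \<subseteq> U" "mpoly.independent C" "mpoly.span C = U" "card C = mpoly.dim U"
proof -
  obtain A :: "('n, 'k) mpoly set" where A: "finite A" "forms d \<subseteq> mpoly.span A" by (rule forms_fin_span)
  obtain C where C: "C \<subseteq> U" "mpoly.independent C" "U \<subseteq> mpoly.span C" "card C = mpoly.dim U"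
    using mpoly.basis_exists[of U] by metis
  have "finite C" using mpoly.independent_span_bound[OF A(1) C(2)] C(1) assms(2) A(2) by blast
  moreover have "mpoly.span C = U" using mpoly.span_minimal[OF C(1) assms(1)] C(3) by blast
  ultimately show ?thesis using that C by blast
qed

lemma subspace_eq_of_dim_le:
  fixes U :: "('n::finite, 'k::field) mpoly set"
  assumes "mpoly.subspace U" "mpoly.subspace V" "U \<subseteq> V" "V \<subseteq> forms d" "mpoly.dim V \<le> mpoly.dim U"
  shows "U = V"
proof -
  obtain C where C: "finite C" "C \<subseteq> U" "mpoly.independent C" "mpoly.span C = U" "card C = mpoly.dim U"
    using finite_basis_in_forms[OF assms(1)] assms(3,4) by blast
  obtain D where D: "C \<subseteq> D" "D \<subseteq> V" "mpoly.independent D" "V \<subseteq> mpoly.span D"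
    by (rule mpoly.maximal_independent_subset_extend[OF order_trans[OF C(2) assms(3)] C(3)])
  have cD: "card D = mpoly.dim V" using mpoly.basis_card_eq_dim[OF D(2,4,3)] .
  obtain A :: "('n, 'k) mpoly set" where A: "finite A" "forms d \<subseteq> mpoly.span A" by (rule forms_fin_span)
  have "finite D" using mpoly.independent_span_bound[OF A(1) D(3)] D(2) assms(4) A(2) by blast
  then have "C = D" using D(1) cD C(5) assms(5) by (intro card_seteq) auto
  then have "V \<subseteq> mpoly.span C" using D(4) by simp
  then show ?thesis using C(4) assms(3) by simp
qed

lemma dim_span_insert:
  fixes U :: "('n::finite, 'k::field) mpoly set"
  assumes "mpoly.subspace U" "U \<subseteq> forms d" "l \<notin> U"
  shows "mpoly.dim (mpoly.span (insert l U)) = Suc (mpoly.dim U)"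
proof -
  obtain C where C: "finite C" "C \<subseteq> U" "mpoly.independent C" "mpoly.span C = U" "card C = mpoly.dim U"
    using finite_basis_in_forms[OF assms(1,2)] by blast
  have "mpoly.independent (insert l C)" using C assms(3) by (simp add: mpoly.independent_insert)
  moreover have "mpoly.span (insert l U) = mpoly.span (insert l C)"
    unfolding mpoly.span_insert C(4) mpoly.span_eq_iff[THEN iffD2, OF assms(1)] ..
  ultimately have "mpoly.dim (mpoly.span (insert l U)) = card (insert l C)"
    by (simp add: mpoly.dim_eq_card_independent)
  moreover have "l \<notin> C" using C assms(3) by blast
  ultimately show ?thesis using C by simp
qed

lemma hilbert_UNIV: "hilbert (UNIV :: ('n::finite, 'k::field) mpoly set) d = 0"
  using hilbert_eq[of UNIV d] by simp

lemma forms_subset_ideal: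
  fixes I :: "('n::finite, 'k::field) mpoly set"
  assumes I: "ideal.subspace I" "forms 1 \<subseteq> I" and e: "0 < e"
  shows "forms e \<subseteq> I"
proof
  fix p :: "('n, 'k) mpoly" assume p: "p \<in> forms e"
  have "Poly_Mapping.single m c \<in> I" if m: "mdeg m = e" for m c
  proof -
    have "\<exists>i. 0 < Poly_Mapping.lookup m i" using m e by (metis gr_zeroI mdeg_def sum.neutral)
    then obtain i where i: "0 < Poly_Mapping.lookup m i" by blast
    have "m = Poly_Mapping.single i 1 + (m - Poly_Mapping.single i 1)"
      using i by (intro poly_mapping_eqI) (auto simp: lookup_add lookup_minus lookup_single when_def)
    then have "Poly_Mapping.single m c = Poly_Mapping.single (m - Poly_Mapping.single i 1) c * Poly_Mapping.single (Poly_Mapping.single i 1) 1"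
      by (metis add.commute mult.right_neutral mult_single)
    moreover have "Poly_Mapping.single (Poly_Mapping.single i 1) 1 \<in> (forms 1 :: ('n, 'k) mpoly set)"
      by (simp add: forms_def mdeg_def lookup_single when_def)
    ultimately show ?thesis using I ideal_mult[OF I(1)] by (metis subsetD)
  qed
  then have "(\<Sum>m\<in>Poly_Mapping.keys p. Poly_Mapping.single m (Poly_Mapping.lookup p m)) \<in> I"
    using p by (intro ideal.subspace_sum[OF I(1)]) (auto simp: forms_def)
  moreover have "p = (\<Sum>m\<in>Poly_Mapping.keys p. Poly_Mapping.single m (Poly_Mapping.lookup p m))"
    by (rule sum_monomials)
  ultimately show "p \<in> I" by simp
qed

text \<open>\<open>W k\<close> is \<open>(I : l\<^sub>1 \<dots> l\<^sub>k) + (l\<^sub>k\<^sub>+\<^sub>1)\<close>. The factors are chosen one after the other so that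
  \<open>hilbert (W k) (d - k)\<close> is as large as possible; as \<open>I : l\<^sub>1 \<dots> l\<^sub>k\<close> increases with \<open>k\<close>, this gives the
  monotonicity in the third clause.\<close>

definition layers ::
    "nat \<Rightarrow> ('n::finite, 'k::field) mpoly set \<Rightarrow> ('n, 'k) mpoly set \<Rightarrow> nat \<Rightarrow> (nat \<Rightarrow> ('n, 'k) mpoly set) \<Rightarrow> bool" where
  "layers d I X m W \<longleftrightarrow>
    (\<forall>k<m. \<exists>l\<in>X. \<exists>I'. hideal I' \<and> I \<subseteq> I' \<and> W k = adjoin I' l) \<and>
    (\<forall>e. hilbert I e = (\<Sum>k | k < m \<and> k \<le> e. hilbert (W k) (e - k))) \<and>
    (\<forall>k. Suc k < m \<longrightarrow> k \<le> d \<longrightarrow> hilbert (W (Suc k)) (d - k) \<le> hilbert (W k) (d - k)) \<and>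
    (0 < m \<longrightarrow> (\<exists>l\<in>X. W 0 = adjoin I l))"

lemma exists_layers:
  fixes I :: "('n::finite, 'k::field) mpoly set"
  assumes "hideal I" "set ls \<subseteq> forms 1" "prod_list ls \<in> I"
  shows "\<exists>W. layers d I (set ls) (length ls) W"
  using assms
proof (induction "length ls" arbitrary: ls I d)
  case 0
  \<comment> \<open>The empty product is \<open>1\<close>, so without factors both sides of the
    Hilbert function identity are zero.\<close>
  then have "1 \<in> I" by simp
  then have "I = UNIV" using ideal_mult[OF hideal_subspace[OF 0(2)], of 1] by auto
  then show ?case using 0 by (simp add: hilbert_UNIV layers_def)
next
  case (Suc m)
  have sI: "ideal.subspace I" by (rule hideal_subspace[OF Suc.prems(1)])
  have ne: "set ls \<noteq> {}" using Suc(2) by auto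
  have "\<exists>l. l \<in> set ls \<and> (\<forall>l'. l' \<in> set ls \<longrightarrow> hilbert (adjoin I l') d \<le> hilbert (adjoin I l) d)"
  proof (rule ex_has_greatest_nat)
    show "hd ls \<in> set ls" using ne by (cases ls) auto
    have "hilbert (adjoin I l) d < Suc (mpoly.dim (forms d :: ('n, 'k) mpoly set))" for l
      using hilbert_eq[OF subspace_adjoin[OF sI], of l d] by linarith
    then show "\<forall>l. l \<in> set ls \<longrightarrow> hilbert (adjoin I l) d < Suc (mpoly.dim (forms d :: ('n, 'k) mpoly set))"
      by blast
  qed
  then obtain l where l: "l \<in> set ls" and lmax: "\<And>l'. l' \<in> set ls \<Longrightarrow> hilbert (adjoin I l') d \<le> hilbert (adjoin I l) d"
    by blast
  have lf: "l \<in> forms 1" using l Suc.prems by blast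
  obtain xs ys where ls: "ls = xs @ l # ys" using l by (meson split_list)
  let ?ls = "xs @ ys"
  have "prod_list ls = l * prod_list ?ls" unfolding ls by (simp add: mult.left_commute)
  then have "prod_list ?ls \<in> colon I l" using Suc.prems by (simp add: colon_def)
  moreover have sub: "set ?ls \<subseteq> set ls" and len: "m = length ?ls" using Suc(2) ls by auto
  moreover have "hideal (colon I l)" by (rule hideal_colon[OF Suc.prems(1) lf])
  \<comment> \<open>The remaining factors are ordered for degree \<open>d - 1\<close>: layer
    \<open>k\<close> of the tail becomes layer \<open>Suc k\<close>, and
    \<open>d - 1 - k = d - Suc k\<close>.\<close>
  ultimately obtain W where W: "layers (d - 1) (colon I l) (set ?ls) m W"
    using Suc.hyps(1)[of ?ls "colon I l" "d - 1"] Suc.prems(2) by auto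
  note W1 = W[unfolded layers_def, THEN conjunct1, rule_format]
    and W2 = W[unfolded layers_def, THEN conjunct2, THEN conjunct1, rule_format]
    and W3 = W[unfolded layers_def, THEN conjunct2, THEN conjunct2, THEN conjunct1, rule_format]
    and W4 = W[unfolded layers_def, THEN conjunct2, THEN conjunct2, THEN conjunct2, rule_format]
  define V where "V k = (case k of 0 \<Rightarrow> adjoin I l | Suc k \<Rightarrow> W k)" for k
  have "layers d I (set ls) (Suc m) V"
    unfolding layers_def
  proof (intro conjI allI impI)
    fix k assume "k < Suc m"
    show "\<exists>l\<in>set ls. \<exists>I'. hideal I' \<and> I \<subseteq> I' \<and> V k = adjoin I' l"
    proof (cases k)
      case 0
      then show ?thesis using l Suc.prems(1) by (auto simp: V_def)
    next
      case (Suc k')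
      then obtain l' I' where "l' \<in> set ?ls" "hideal I'" "colon I l \<subseteq> I'" "W k' = adjoin I' l'"
        using W1[of k'] \<open>k < Suc m\<close> by auto
      moreover have "l' \<in> set ls" "I \<subseteq> I'" using calculation sub subset_colon[OF sI, of l] by blast+
      moreover have "V k = W k'" using Suc by (simp add: V_def)
      ultimately show ?thesis by metis
    qed
  next
    fix e
    show "hilbert I e = (\<Sum>k | k < Suc m \<and> k \<le> e. hilbert (V k) (e - k))"
    proof (cases e)
      case 0
      have "{k. k < Suc m \<and> k \<le> 0} = {0}" by auto
      then show ?thesis using 0 hilbert_split[OF Suc.prems(1) lf, of e] by (simp add: V_def)
    next
      case (Suc e')
      have "{k. k < Suc m \<and> k \<le> e} = insert 0 (Suc ` {k. k < m \<and> k \<le> e'})"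
        using Suc by (auto simp: image_iff) (metis Suc_le_mono not0_implies_Suc not_less_eq)
      then have "(\<Sum>k | k < Suc m \<and> k \<le> e. hilbert (V k) (e - k)) =
          hilbert (V 0) e + (\<Sum>k | k < m \<and> k \<le> e'. hilbert (V (Suc k)) (e - Suc k))"
        by (simp add: sum.reindex)
      also have "\<dots> = hilbert (adjoin I l) e + hilbert (colon I l) (e - 1)"
        using W2[of e'] Suc by (simp add: V_def)
      finally show ?thesis using hilbert_split[OF Suc.prems(1) lf, of e] Suc by simp
    qed
  next
    fix k assume k: "Suc k < Suc m" "k \<le> d"
    show "hilbert (V (Suc k)) (d - k) \<le> hilbert (V k) (d - k)"
    proof (cases k)
      case 0
      \<comment> \<open>The factor \<open>l'\<close> was itself a candidate when \<open>l\<close>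
        was chosen, and passing from \<open>I\<close> to \<open>colon I l\<close> can only lower the
        Hilbert function. The last clause of \<open>layers\<close> serves to name this
        \<open>l'\<close>.\<close>
      obtain l' where l': "l' \<in> set ?ls" "W 0 = adjoin (colon I l) l'" using W4 k by auto
      have "hilbert (W 0) d \<le> hilbert (adjoin I l') d"
        unfolding l'(2) using adjoin_mono[OF subset_colon[OF sI, of l], of l']
        by (intro hilbert_mono subspace_adjoin subspace_colon sI) auto
      also have "\<dots> \<le> hilbert (adjoin I l) d" using l' sub by (intro lmax) auto
      finally show ?thesis using 0 by (simp add: V_def)
    next
      case (Suc k')
      then show ?thesis using W3[of k'] k by (simp add: V_def)
    qed
  next
    show "\<exists>l\<in>set ls. V 0 = adjoin I l" using l by (auto simp: V_def)
  qed
  then show ?case using Suc(2) by metis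
qed

text \<open>Induction on the number \<open>r\<close> of dimensions that separate
  \<open>\<Lambda>\<close> from the space of all linear forms. The products in \<open>G\<close> stay
  the same throughout; \<open>\<Lambda>\<close> and \<open>I\<close> grow.\<close>

lemma hilbert_admissible:
  fixes I \<Lambda> :: "('n::finite, 'k::field) mpoly set"
  assumes "mpoly.subspace \<Lambda>" "\<Lambda> \<subseteq> forms 1"
    and "mpoly.dim \<Lambda> + r = mpoly.dim (forms 1 :: ('n, 'k) mpoly set)"
    and "hideal I" "\<Lambda> \<subseteq> I"
    and "\<And>ls. ls \<in> G \<Longrightarrow> set ls \<subseteq> forms 1 \<and> prod_list ls \<in> I"
    and "\<And>i j. i < j \<Longrightarrow> j < r \<Longrightarrow> c i \<le> c j"
    and "\<And>i L. i < r \<Longrightarrow> mpoly.subspace L \<Longrightarrow> \<Lambda> \<subseteq> L \<Longrightarrow> L \<subseteq> forms 1 \<Longrightarrow>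
      (\<forall>ls\<in>G. length ls \<le> c i \<longrightarrow> set ls \<inter> L \<noteq> {}) \<Longrightarrow> mpoly.dim \<Lambda> + Suc i \<le> mpoly.dim L"
  shows "admissible r c (hilbert I)"
  using assms
proof (induction r arbitrary: \<Lambda> I c)
  case 0
  have sI: "ideal.subspace I" by (rule hideal_subspace[OF 0(4)])
  \<comment> \<open>With \<open>r = 0\<close> the ideal contains all forms of positive degree,
    matching the box without variables, which is empty except in degree \<open>0\<close>.\<close>
  have "\<Lambda> = forms 1" using 0 by (intro subspace_eq_of_dim_le[of _ _ 1] subspace_forms) auto
  then have "forms 1 \<subseteq> I" using 0 by simp
  then have fe: "forms e \<subseteq> I" if "0 < e" for e using forms_subset_ideal[OF sI] that by blast
  have h: "hilbert I e = 0" if "0 < e" for e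
    using hilbert_eq[OF sI, of e] fe[OF that] by (simp add: Int_absorb1)
  have b0: "box 0 c 0 = {\<lambda>_. 0}" by (auto simp: box_def)
  have "{m :: 'n \<Rightarrow>\<^sub>0 nat. mdeg m = 0} = {0}"
    by (auto simp: mdeg_def intro!: poly_mapping_eqI)
  then have "mpoly.dim (forms 0 :: ('n, 'k) mpoly set) = 1" by (simp add: dim_forms)
  then have "hilbert I 0 \<le> 1" using hilbert_eq[OF sI, of 0] by linarith
  then have "hilbert I e \<le> card (box 0 c e)" for e using h b0 by (cases e) auto
  then show ?case using h by (auto simp: admissible_def shadow_def)
next
  case (Suc r)
  note S = Suc.prems
  have sI: "ideal.subspace I" by (rule hideal_subspace[OF S(4)])
  \<comment> \<open>Otherwise the codimension condition for \<open>L = \<Lambda>\<close> and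
    \<open>i = 0\<close> would make the dimension of \<open>\<Lambda>\<close> exceed itself.\<close>
  have "\<not> (\<forall>ls\<in>G. length ls \<le> c 0 \<longrightarrow> set ls \<inter> \<Lambda> \<noteq> {})" using S(8)[of 0 \<Lambda>] S(1,2) by auto
  then obtain ls0 where ls0: "ls0 \<in> G" "length ls0 \<le> c 0" "set ls0 \<inter> \<Lambda> = {}" by blast
  have "\<Lambda> \<noteq> forms 1" using S(3) by auto
  then obtain l0 where l0: "l0 \<in> forms 1" "l0 \<notin> \<Lambda>" using S(2) by blast
  \<comment> \<open>Padding to exactly \<open>c 0\<close> factors makes the layers correspond to the
    exponents \<open>0, ..., c 0 - 1\<close> of the variable split off.\<close>
  define ls where "ls = replicate (c 0 - length ls0) l0 @ ls0"
  have len: "length ls = c 0" using ls0 by (simp add: ls_def)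
  have lsf: "set ls \<subseteq> forms 1" and lsL: "set ls \<inter> \<Lambda> = {}"
    using ls0 l0 S(6)[OF ls0(1)] by (auto simp: ls_def)
  have "prod_list ls \<in> I" using S(6)[OF ls0(1)] ideal_mult[OF sI] by (simp add: ls_def)
  from exists_layers[OF S(4) lsf this] have ex: "\<exists>W. layers d I (set ls) (c 0) W" for d
    by (simp add: len)
  have adm: "admissible r (\<lambda>i. c (Suc i)) (hilbert (W k))" if W: "layers d I (set ls) (c 0) W" and k: "k < c 0" for d W k
  proof -
    obtain l I' where l: "l \<in> set ls" and I': "hideal I'" "I \<subseteq> I'" "W k = adjoin I' l"
      using W k unfolding layers_def by blast
    have lf: "l \<in> forms 1" "l \<notin> \<Lambda>" using l lsf lsL by auto
    let ?\<Lambda> = "mpoly.span (insert l \<Lambda>)"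
    have dim: "mpoly.dim ?\<Lambda> = Suc (mpoly.dim \<Lambda>)" using dim_span_insert[OF S(1,2) lf(2)] .
    have IW: "I \<subseteq> W k" using I' subset_adjoin[of I' l] by blast
    have hW: "hideal (W k)" using I' hideal_adjoin[OF I'(1) lf(1)] by simp
    have lW: "l \<in> W k" using adjoin_self[OF hideal_subspace[OF I'(1)], of l] I' by simp
    show ?thesis
    proof (rule Suc.IH)
      show "mpoly.subspace ?\<Lambda>" by simp
      show "?\<Lambda> \<subseteq> forms 1" using lf S(2) by (intro mpoly.span_minimal subspace_forms) auto
      show "mpoly.dim ?\<Lambda> + r = mpoly.dim (forms 1 :: ('n, 'k) mpoly set)" using dim S(3) by simp
      show "hideal (W k)" by (rule hW)
      show "?\<Lambda> \<subseteq> W k"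
        using lW IW S(5) by (intro mpoly.span_minimal mpoly_subspace_ideal hideal_subspace[OF hW]) auto
      show "set ls \<subseteq> forms 1 \<and> prod_list ls \<in> W k" if "ls \<in> G" for ls using S(6)[OF that] IW by blast
      show "c (Suc i) \<le> c (Suc j)" if "i < j" "j < r" for i j using S(7) that by simp
      fix i L assume i: "i < r" and L: "mpoly.subspace L" "?\<Lambda> \<subseteq> L" "L \<subseteq> forms 1"
        "\<forall>ls\<in>G. length ls \<le> c (Suc i) \<longrightarrow> set ls \<inter> L \<noteq> {}"
      have "\<Lambda> \<subseteq> L" using L(2) mpoly.span_superset[of "insert l \<Lambda>"] by blast
      \<comment> \<open>The old condition at \<open>Suc i\<close> gives up one dimension to
        \<open>l\<close> and becomes the new condition at \<open>i\<close>.\<close>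
      then have "mpoly.dim \<Lambda> + Suc (Suc i) \<le> mpoly.dim L" using i L by (intro S(8)) auto
      then show "mpoly.dim ?\<Lambda> + Suc i \<le> mpoly.dim L" using dim by simp
    qed
  qed
  show ?case
    unfolding admissible_def
  proof (intro conjI allI impI)
    fix e
    obtain W where W: "layers 0 I (set ls) (c 0) W" using ex by blast
    show "hilbert I e \<le> card (box (Suc r) c e)"
    proof (rule admissible_glue(1)[of r c "\<lambda>k. hilbert (W k)" "hilbert I" 0])
      show "c i \<le> c j" if "i < j" "j < Suc r" for i j using S(7) that by simp
      show "admissible r (\<lambda>i. c (Suc i)) (hilbert (W k))" if "k < c 0" for k using adm[OF W that] .
      show "hilbert I e = (\<Sum>k | k < c 0 \<and> k \<le> e. hilbert (W k) (e - k))" for e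
        using W unfolding layers_def by blast
      show "hilbert (W (Suc k)) (0 - k) \<le> hilbert (W k) (0 - k)" if "Suc k < c 0" "k \<le> 0" for k
        using W that unfolding layers_def by blast
    qed
  next
    fix e A
    assume A: "lexup (Suc r) c e A" "card A + hilbert I e = card (box (Suc r) c e)"
    \<comment> \<open>The step from \<open>e\<close> to \<open>Suc e\<close> uses the order that is
      greedy for this very \<open>e\<close>.\<close>
    obtain W where W: "layers e I (set ls) (c 0) W" using ex by blast
    show "card (shadow (Suc r) c A) + hilbert I (Suc e) \<le> card (box (Suc r) c (Suc e))"
    proof (rule admissible_glue(2)[of r c "\<lambda>k. hilbert (W k)" "hilbert I" e, OF _ _ _ _ A])
      show "c i \<le> c j" if "i < j" "j < Suc r" for i j using S(7) that by simp
      show "admissible r (\<lambda>i. c (Suc i)) (hilbert (W k))" if "k < c 0" for k using adm[OF W that] .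
      show "hilbert I e = (\<Sum>k | k < c 0 \<and> k \<le> e. hilbert (W k) (e - k))" for e
        using W unfolding layers_def by blast
      show "hilbert (W (Suc k)) (e - k) \<le> hilbert (W k) (e - k)" if "Suc k < c 0" "k \<le> e" for k
        using W that unfolding layers_def by blast
    qed
  qed
qed

section \<open>Regular sequences inside ideals of linear forms\<close>

text \<open>Iterated partial sums take the place of multiplying Hilbert series by powers of \<open>1/(1 - z)\<close>.\<close>

definition csum :: "(nat \<Rightarrow> nat) \<Rightarrow> nat \<Rightarrow> nat" where
  "csum g D = (\<Sum>d\<le>D. g d)"

lemma csum_0 [simp]: "csum g 0 = g 0" and csum_Suc [simp]: "csum g (Suc D) = csum g D + g (Suc D)"
  by (simp_all add: csum_def)

lemma csum_le: "(\<And>d. g d \<le> h d) \<Longrightarrow> csum g D \<le> csum h D"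
  unfolding csum_def by (intro sum_mono) auto

lemma le_csum: "g D \<le> csum g D"
  by (cases D) auto

lemma mono_csum: "D \<le> E \<Longrightarrow> csum g D \<le> csum g E"
  unfolding csum_def by (intro sum_mono2) auto

lemma csum_iter_le: "(\<And>d. g d \<le> h d) \<Longrightarrow> (csum ^^ k) g D \<le> (csum ^^ k) h D"
  by (induction k arbitrary: D) (auto intro: csum_le)

lemma le_csum_iter: "g D \<le> (csum ^^ k) g D"
proof (induction k arbitrary: D)
  case (Suc k)
  then show ?case using le_csum[of "(csum ^^ k) g" D] order_trans by fastforce
qed simp

lemma csum_shift:
  assumes "\<And>D. g D = h D + (if a \<le> D then g' (D - a) else 0)"
  shows "csum g D = csum h D + (if a \<le> D then csum g' (D - a) else 0)"
proof (induction D)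
  case 0
  then show ?case using assms[of 0] by auto
next
  case (Suc D)
  consider "a \<le> D" | "a = Suc D" | "Suc D < a" by linarith
  then show ?case
  proof cases
    case 1
    then show ?thesis using Suc assms[of "Suc D"] by (simp add: Suc_diff_le)
  qed (use Suc assms[of "Suc D"] in auto)
qed

lemma csum_iter_shift:
  assumes "\<And>D. g D = h D + (if a \<le> D then g (D - a) else 0)"
  shows "(csum ^^ k) g D = (csum ^^ k) h D + (if a \<le> D then (csum ^^ k) g (D - a) else 0)"
proof (induction k arbitrary: D)
  case 0
  show ?case using assms by simp
next
  case (Suc k)
  show ?case using csum_shift[OF Suc] by simp
qed

text \<open>Each of the last \<open>a\<close> summands is at most \<open>G D\<close>.\<close>

lemma csum_window:
  assumes "mono G"
  shows "csum G D \<le> a * G D + (if a \<le> D then csum G (D - a) else 0)"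
proof (induction a)
  case 0
  then show ?case by simp
next
  case (Suc a)
  show ?case
  proof (cases "a \<le> D")
    case True
    show ?thesis
    proof (cases "D - a")
      case 0
      have "G 0 \<le> G D" using assms by (simp add: monoD)
      then show ?thesis using Suc 0 True by auto
    next
      case (Suc E)
      have "G (D - a) \<le> G D" using assms by (simp add: monoD)
      moreover have "D - Suc a = E" "Suc a \<le> D" using Suc by auto
      ultimately show ?thesis using Suc.IH True Suc by auto
    qed
  qed (use Suc in auto)
qed

text \<open>\<open>h\<close> is \<open>g\<close> minus its shift by \<open>a\<close>, so a sum of
  \<open>h\<close> is a window of length \<open>a\<close> in a sum of \<open>g\<close>. One
  summation is thereby traded for the factor \<open>a\<close>. The exponent is \<open>Suc k\<close>
  because the window estimate needs a monotone function, and a partial sum is one.\<close>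

lemma csum_regular:
  assumes "\<And>D. g D = h D + (if a \<le> D then g (D - a) else 0)"
  shows "(csum ^^ Suc (Suc k)) h D \<le> a * (csum ^^ Suc k) g D"
proof -
  have "mono ((csum ^^ Suc k) g)" by (auto intro!: monoI mono_csum)
  from csum_window[OF this, of D a] csum_iter_shift[of g h a "Suc (Suc k)" D, OF assms]
  show ?thesis by (cases "a \<le> D") auto
qed

text \<open>As \<open>colon I l\<close> contains \<open>I\<close>, its Hilbert function is at most
  that of \<open>I\<close>; unrolling \<open>hilbert_split\<close> down to degree \<open>0\<close>
  gives the sum.\<close>

lemma hilbert_linear:
  fixes I :: "('n::finite, 'k::field) mpoly set"
  assumes "hideal I" "l \<in> forms 1"
  shows "hilbert I e \<le> csum (hilbert (adjoin I l)) e"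
proof (induction e)
  case 0
  show ?case using hilbert_split[OF assms, of 0] by simp
next
  case (Suc e)
  have sI: "ideal.subspace I" using assms hideal_subspace by blast
  have "hilbert (colon I l) e \<le> hilbert I e"
    using subset_colon[OF sI, of l] by (intro hilbert_mono sI subspace_colon) auto
  then show ?case using Suc hilbert_split[OF assms, of "Suc e"] by simp
qed

lemma span_insert_adjoin: "ideal.span (insert f G) = adjoin (ideal.span G) f"
proof (intro equalityI subsetI)
  fix p assume "p \<in> ideal.span (insert f G)"
  then obtain k where "p - k * f \<in> ideal.span G" unfolding ideal.span_insert by blast
  moreover have "p = (p - k * f) + f * k" by (simp add: mult.commute)
  ultimately show "p \<in> adjoin (ideal.span G) f" unfolding adjoin_def by blast
next
  fix p assume "p \<in> adjoin (ideal.span G) f"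
  then obtain x y where "x \<in> ideal.span G" "p = x + f * y" unfolding adjoin_def by blast
  then have "p - y * f \<in> ideal.span G" by (simp add: mult.commute)
  then show "p \<in> ideal.span (insert f G)" unfolding ideal.span_insert by blast
qed

lemma hilbert_zero: "hilbert {0 :: ('n::finite, 'k::field) mpoly} d = card {m :: 'n \<Rightarrow>\<^sub>0 nat. mdeg m = d}"
proof -
  have "{0 :: ('n, 'k) mpoly} \<inter> forms d = {0}" by (simp add: forms_def)
  then show ?thesis using hilbert_eq[of "{0 :: ('n, 'k) mpoly}" d]
    by (simp add: dim_forms dim_zero ideal.subspace_def)
qed

lemma hilbert_linear_forms:
  fixes C :: "('n::finite, 'k::field) mpoly set"
  assumes "finite C" "C \<subseteq> forms 1"
  shows "hilbert {0 :: ('n, 'k) mpoly} e \<le> (csum ^^ card C) (hilbert (ideal.span C)) e"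
  using assms
proof (induction C arbitrary: e)
  case empty
  show ?case by simp
next
  case (insert l C)
  have "hideal (ideal.span C)" using insert by (intro hideal_span) auto
  have "hilbert {0 :: ('n, 'k) mpoly} e \<le> (csum ^^ card C) (hilbert (ideal.span C)) e"
    using insert by blast
  also have "\<dots> \<le> (csum ^^ card C) (csum (hilbert (ideal.span (insert l C)))) e"
    unfolding span_insert_adjoin
    by (intro csum_iter_le hilbert_linear) (use insert \<open>hideal (ideal.span C)\<close> in auto)
  also have "\<dots> = (csum ^^ card (insert l C)) (hilbert (ideal.span (insert l C))) e"
    unfolding card_insert_disjoint[OF insert(1,2)] by (simp only: funpow_Suc_right o_apply)
  finally show ?case .
qed

text \<open>Every non-zero-divisor trades a summation for its degree, so the constant built up is
  the product of the degrees.\<close>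

lemma hilbert_regular_growth:
  fixes f :: "nat \<Rightarrow> ('n::finite, 'k::field) mpoly"
  assumes reg: "\<And>j g. j \<in> {1..i} \<Longrightarrow> f j * g \<in> ideal.span (f ` {1..<j}) \<Longrightarrow> g \<in> ideal.span (f ` {1..<j})"
    and deg: "\<And>j. j \<in> {1..i} \<Longrightarrow> f j \<in> forms (a j)"
  shows "\<exists>K. \<forall>D. (csum ^^ Suc i) (hilbert (ideal.span (f ` {1..i}))) D \<le> K * csum (hilbert {0 :: ('n, 'k) mpoly}) D"
  using assms
proof (induction i)
  case 0
  show ?case by (auto intro: exI[of _ 1])
next
  case (Suc i)
  then obtain K where K: "\<And>D. (csum ^^ Suc i) (hilbert (ideal.span (f ` {1..i}))) D \<le> K * csum (hilbert {0 :: ('n, 'k) mpoly}) D"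
    by fastforce
  let ?I = "ideal.span (f ` {1..i})"
  have eq: "{1..<Suc i} = {1..i}" "{1..Suc i} = insert (Suc i) {1..i}" by auto
  have hI: "hideal ?I" using Suc.prems(2) by (intro hideal_span) force
  have fd: "f (Suc i) \<in> forms (a (Suc i))" using Suc.prems(2) by simp
  have "colon ?I (f (Suc i)) = ?I"
    using Suc.prems(1)[of "Suc i"] subset_colon[OF hideal_subspace[OF hI], of "f (Suc i)"] eq(1)
    by (auto simp: colon_def)
  then have "hilbert ?I D = hilbert (ideal.span (f ` {1..Suc i})) D + (if a (Suc i) \<le> D then hilbert ?I (D - a (Suc i)) else 0)" for D
    using hilbert_split[OF hI fd, of D] unfolding eq(2) image_insert span_insert_adjoin by simp
  then have "(csum ^^ Suc (Suc i)) (hilbert (ideal.span (f ` {1..Suc i}))) D \<le> a (Suc i) * (csum ^^ Suc i) (hilbert ?I) D" for D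
    by (rule csum_regular)
  also have "\<dots> D \<le> a (Suc i) * K * csum (hilbert {0 :: ('n, 'k) mpoly}) D" for D
    using K[of D] by (metis mult.assoc mult_le_mono2)
  finally show ?case by blast
qed

section \<open>Polynomial against exponential growth\<close>

lemma card_mdeg_le: "card {m :: 'n::finite \<Rightarrow>\<^sub>0 nat. mdeg m = d} \<le> Suc d ^ CARD('n)"
proof -
  have "card {m :: 'n \<Rightarrow>\<^sub>0 nat. mdeg m = d} \<le> card ((UNIV :: 'n set) \<rightarrow>\<^sub>E {..d})"
  proof (rule card_inj_on_le)
    show "inj_on Poly_Mapping.lookup {m :: 'n \<Rightarrow>\<^sub>0 nat. mdeg m = d}" by (rule inj_onI) (simp add: lookup_inject)
    have "Poly_Mapping.lookup m i \<le> mdeg m" for m :: "'n \<Rightarrow>\<^sub>0 nat" and i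
      unfolding mdeg_def by (rule member_le_sum) auto
    then show "Poly_Mapping.lookup ` {m :: 'n \<Rightarrow>\<^sub>0 nat. mdeg m = d} \<subseteq> (UNIV :: 'n set) \<rightarrow>\<^sub>E {..d}" by auto
  qed (auto intro: finite_PiE)
  also have "\<dots> = Suc d ^ CARD('n)" by (simp add: card_PiE)
  finally show ?thesis .
qed

text \<open>By \<open>K\<close> and monotonicity, the \<open>K\<close> terms after \<open>D\<close>
  together are at least \<open>csum A D\<close>. So the partial sum doubles in every
  \<open>K\<close> steps, which a polynomial bound excludes.\<close>

lemma csum_poly_growth_contradiction:
  assumes poly: "\<And>D. A D \<le> Suc D ^ n" and mono: "mono A" and pos: "0 < A 0" and K: "\<And>D. csum A D \<le> K * A D"
  shows False
proof -
  have Kpos: "0 < K" using K[of 0] pos by (cases K) auto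
  have step: "csum A D + j * A D \<le> csum A (D + j)" for D j
  proof (induction j)
    case (Suc j)
    have "A D \<le> A (Suc (D + j))" using mono by (simp add: monoD)
    then show ?case using Suc by simp
  qed simp
  have dbl: "2 * csum A D \<le> csum A (D + K)" for D using step[of D K] K[of D] by linarith
  have "2 ^ T \<le> csum A (K * T)" for T
  proof (induction T)
    case 0
    show ?case using pos by simp
  next
    case (Suc T)
    then show ?case using dbl[of "K * T"] by (simp add: add.commute)
  qed
  then have bound: "2 ^ T \<le> K * Suc (K * T) ^ n" for T
    using K[of "K * T"] poly[of "K * T"] by (meson mult_le_mono2 order_trans)
  \<comment> \<open>Chosen so that \<open>real K * (2 * real K * real T) ^ n\<close> equals
    \<open>C * (real T * ln 2) ^ n\<close>; the factor \<open>2\<close> absorbs the successor in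
    \<open>Suc (K * T)\<close> once \<open>T \<ge> 1\<close>.\<close>
  define C where "C = real K * (2 * real K) ^ n / ln 2 ^ n"
  have "filterlim (\<lambda>T. real T * ln 2) at_top sequentially"
    by (rule filterlim_at_top_mult_tendsto_pos[OF tendsto_const _ filterlim_real_sequentially, of "ln 2", simplified mult.commute]) simp
  from filterlim_compose[OF tendsto_power_div_exp_0[of n] this]
  have "(\<lambda>T. C * ((real T * ln 2) ^ n / exp (real T * ln 2))) \<longlonglongrightarrow> C * 0" by (intro tendsto_mult tendsto_const)
  then have "eventually (\<lambda>T. C * ((real T * ln 2) ^ n / exp (real T * ln 2)) < 1) sequentially"
    by (intro order_tendstoD(2)[of _ "C * 0"]) auto
  then obtain T0 where T0: "\<And>T. T \<ge> T0 \<Longrightarrow> C * ((real T * ln 2) ^ n / exp (real T * ln 2)) < 1"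
    unfolding eventually_sequentially by blast
  define T where "T = max T0 1"
  have "real (2 ^ T) \<le> real K * real (Suc (K * T)) ^ n" using bound[of T] by (metis of_nat_le_iff of_nat_mult of_nat_power)
  also have "\<dots> \<le> real K * (2 * real K * real T) ^ n"
  proof -
    have "1 \<le> K * T" using Kpos by (simp add: T_def)
    then have "Suc (K * T) \<le> 2 * K * T" by simp
    then have "real (Suc (K * T)) \<le> 2 * real K * real T" by (metis of_nat_le_iff of_nat_mult of_nat_numeral)
    then show ?thesis by (intro mult_left_mono power_mono) auto
  qed
  also have "\<dots> = C * (real T * ln 2) ^ n" by (simp add: C_def power_mult_distrib)
  also have "\<dots> < exp (real T * ln 2)" using T0[of T] by (simp add: T_def divide_simps)
  also have "\<dots> = 2 ^ T" by (simp add: exp_of_nat_mult)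
  finally show False by simp
qed

lemma regular_sequence_le_dim:
  fixes f :: "nat \<Rightarrow> ('n::finite, 'k::field) mpoly"
  assumes reg: "\<And>j g. j \<in> {1..i} \<Longrightarrow> f j * g \<in> ideal.span (f ` {1..<j}) \<Longrightarrow> g \<in> ideal.span (f ` {1..<j})"
    and deg: "\<And>j. j \<in> {1..i} \<Longrightarrow> f j \<in> forms (a j)"
    and L: "mpoly.subspace L" "L \<subseteq> forms 1" and fL: "f ` {1..i} \<subseteq> ideal.span L"
  shows "i \<le> mpoly.dim L"
proof (rule ccontr)
  assume "\<not> ?thesis"
  then have less: "mpoly.dim L < i" by simp
  obtain C where C: "finite C" "C \<subseteq> L" "mpoly.independent C" "mpoly.span C = L" "card C = mpoly.dim L"
    using finite_basis_in_forms[OF L] .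
  let ?F = "ideal.span (f ` {1..i})" and ?H = "hilbert {0 :: ('n, 'k) mpoly}"
  have LC: "ideal.span L \<subseteq> ideal.span C"
  proof (rule ideal.span_minimal)
    have "mpoly.span C \<subseteq> ideal.span C"
      by (intro mpoly.span_minimal mpoly_subspace_ideal) (auto intro: ideal.span_base)
    then show "L \<subseteq> ideal.span C" using C by simp
  qed simp
  have FC: "?F \<subseteq> ideal.span C" using fL LC by (intro ideal.span_minimal) auto
  obtain K where K: "\<And>D. (csum ^^ Suc i) (hilbert ?F) D \<le> K * csum ?H D"
    using hilbert_regular_growth[OF reg deg] by blast
  \<comment> \<open>If \<open>dim L < i\<close>, then \<open>Suc i\<close> summations cover the
    \<open>card C\<close> that the linear forms account for and leave at least two. The regular
    sequence bounds the result by a multiple of a single summation.\<close>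
  obtain m where m: "Suc i = card C + Suc (Suc m)" using less C(5) by (metis Suc_diff_Suc add_Suc_right less_imp_Suc_add)
  have "csum (csum ?H) D \<le> K * csum ?H D" for D
  proof -
    have "csum (csum ?H) D \<le> (csum ^^ m) (csum (csum ?H)) D" by (rule le_csum_iter)
    also have "\<dots> \<le> (csum ^^ m) (csum (csum ((csum ^^ card C) (hilbert (ideal.span C))))) D"
      using C L by (intro csum_iter_le csum_le hilbert_linear_forms) auto
    also have "\<dots> = (csum ^^ Suc i) (hilbert (ideal.span C)) D"
      unfolding m add.commute[of "card C"] funpow_add by (simp only: funpow_Suc_right o_apply add_Suc)
    also have "\<dots> \<le> (csum ^^ Suc i) (hilbert ?F) D"
      using FC by (intro csum_iter_le hilbert_mono) auto
    finally show ?thesis using K[of D] by simp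
  qed
  moreover have "csum ?H D \<le> Suc D ^ Suc CARD('n)" for D
  proof -
    have "csum ?H D \<le> (\<Sum>d\<le>D. Suc D ^ CARD('n))"
      unfolding csum_def hilbert_zero
      by (intro sum_mono order_trans[OF card_mdeg_le] power_mono) auto
    then show ?thesis by simp
  qed
  moreover have "0 < csum ?H 0"
  proof -
    have "{m :: 'n \<Rightarrow>\<^sub>0 nat. mdeg m = 0} \<noteq> {}" by (auto intro: exI[of _ 0] simp: mdeg_def)
    then show ?thesis using finite_mdeg[of 0, where 'n = 'n] by (simp add: hilbert_zero card_gt_0_iff)
  qed
  moreover have "mono (csum ?H)" by (auto intro!: monoI mono_csum)
  ultimately show False using csum_poly_growth_contradiction[of "csum ?H" "Suc CARD('n)" K] by blast
qed

section \<open>The monomial ideal\<close>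

lemma prod_list_forms: "set ls \<subseteq> forms 1 \<Longrightarrow> prod_list ls \<in> (forms (length ls) :: ('n::finite, 'k::comm_ring_1) mpoly set)"
proof (induction ls)
  case (Cons l ls)
  then show ?case using forms_mult[of l 1 "prod_list ls" "length ls"] by simp
qed (simp add: forms_0_1)

lemma prod_list_in_span:
  fixes L :: "'a::comm_ring_1 set"
  assumes "l \<in> set ls" "l \<in> L"
  shows "prod_list ls \<in> ideal.span L"
proof -
  obtain xs ys where "ls = xs @ l # ys" using assms(1) by (meson split_list)
  then have "prod_list ls = (prod_list xs * prod_list ys) * l" by (simp add: ac_simps)
  then show ?thesis using assms(2) by (simp add: ideal.span_scale ideal.span_base)
qed

text \<open>In degree at most \<open>e\<close> only generators with at most \<open>e\<close> factors
  contribute, and each of these has a factor in \<open>L\<close>.\<close>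

lemma form_in_span_of_factors:
  fixes M :: "('n::finite, 'k::field) mpoly set"
  assumes M: "M = ideal.span G" "\<And>g. g \<in> G \<Longrightarrow> \<exists>ls. set ls \<subseteq> forms 1 \<and> g = prod_list ls"
    and hit: "\<And>ls. set ls \<subseteq> forms 1 \<Longrightarrow> prod_list ls \<in> M \<Longrightarrow> length ls \<le> e \<Longrightarrow> set ls \<inter> L \<noteq> {}"
    and p: "p \<in> M" "p \<in> forms d" "d \<le> e"
  shows "p \<in> ideal.span L"
proof -
  have "hcomp d p \<in> ideal.span L"
  proof (rule hcomp_span[of G e])
    fix g assume g: "g \<in> G"
    then obtain ls where ls: "set ls \<subseteq> forms 1" "g = prod_list ls" using M by blast
    have "g \<in> ideal.span L" if "length ls \<le> e"
      using hit[OF ls(1) _ that] g ls(2) M(1) prod_list_in_span[of _ ls L] by (auto intro: ideal.span_base)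
    then show "\<exists>a. g \<in> forms a \<and> (a \<le> e \<longrightarrow> g \<in> ideal.span L)" using ls prod_list_forms by blast
  qed (use M p in auto)
  then show ?thesis using hcomp_of_form[OF p(2), of d] by simp
qed

text \<open>All forms of degree above \<open>D\<close> are added to \<open>I\<close>, so that every product of \<open>D + 1\<close> linear forms is available.
  This supplies the missing products for the variables beyond \<open>x\<^sub>t\<close>, which carry no power condition.\<close>

definition upto_degree :: "nat \<Rightarrow> ('n::finite, 'k::field) mpoly set \<Rightarrow> ('n, 'k) mpoly set" where
  "upto_degree D I = {p. \<forall>e\<le>D. hcomp e p \<in> I}"

lemma hideal_upto_degree:
  assumes "hideal I" shows "hideal (upto_degree D I)"
  unfolding hideal_def
proof (intro conjI ballI allI)
  have sI: "ideal.subspace I" by (rule hideal_subspace[OF assms])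
  show "ideal.subspace (upto_degree D I)"
  proof (rule ideal.subspaceI)
    fix c p assume p: "p \<in> upto_degree D I"
    have "hcomp e (c * p) \<in> I" if e: "e \<le> D" for e
    proof -
      have "c * p = (\<Sum>d\<in>mdeg ` Poly_Mapping.keys p. hcomp d p * c)"
        using sum_hcomp[of p] by (metis mult.commute sum_distrib_right)
      then have "hcomp e (c * p) = (\<Sum>d\<in>mdeg ` Poly_Mapping.keys p. if d \<le> e then hcomp d p * hcomp (e - d) c else 0)"
        by (simp add: hcomp_sum hcomp_mult_form[OF hcomp_forms])
      also have "\<dots> = (\<Sum>d\<in>mdeg ` Poly_Mapping.keys p. (if d \<le> e then hcomp (e - d) c else 0) * hcomp d p)"
        by (rule sum.cong) (auto simp: mult.commute)
      also have "\<dots> \<in> I"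
      proof (intro ideal.subspace_sum[OF sI])
        fix d
        show "(if d \<le> e then hcomp (e - d) c else 0) * hcomp d p \<in> I"
          using p e ideal_mult[OF sI, of "hcomp d p"] ideal.subspace_0[OF sI] by (auto simp: upto_degree_def)
      qed
      finally show ?thesis .
    qed
    then show "c * p \<in> upto_degree D I" by (simp add: upto_degree_def)
  qed (auto simp: upto_degree_def hcomp_add ideal.subspace_0[OF sI] intro: ideal.subspace_add[OF sI])
  fix p d assume "p \<in> upto_degree D I"
  then show "hcomp d p \<in> upto_degree D I"
    by (auto simp: upto_degree_def hcomp_hcomp ideal.subspace_0[OF sI])
qed

lemma forms_upto_degree: "ideal.subspace I \<Longrightarrow> D < e \<Longrightarrow> forms e \<subseteq> upto_degree D I"
  by (auto simp: upto_degree_def hcomp_of_form ideal.subspace_0)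

lemma subset_upto_degree: "hideal I \<Longrightarrow> I \<subseteq> upto_degree D I"
  by (auto simp: upto_degree_def hideal_def)

lemma hilbert_upto_degree:
  assumes "hideal I" "e \<le> D" shows "hilbert (upto_degree D I) e = hilbert I e"
proof (rule hilbert_cong, intro equalityI subsetI)
  fix p assume p: "p \<in> upto_degree D I \<inter> forms e"
  then have "hcomp e p \<in> I" using assms(2) by (simp add: upto_degree_def)
  then show "p \<in> I \<inter> forms e" using p hcomp_of_form[of p e e] by simp
qed (use subset_upto_degree[OF assms(1)] in auto)

lemma card_mdeg_1: "card {m :: 'n::finite \<Rightarrow>\<^sub>0 nat. mdeg m = 1} = CARD('n)"
proof (rule bij_betw_same_card[symmetric], rule bij_betw_imageI)
  show "inj_on (\<lambda>i :: 'n. Poly_Mapping.single i (1::nat)) UNIV"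
    by (rule injI) (metis lookup_single_eq lookup_single_not_eq zero_neq_one)
  show "range (\<lambda>i :: 'n. Poly_Mapping.single i (1::nat)) = {m. mdeg m = 1}"
  proof (intro equalityI subsetI)
    fix m :: "'n \<Rightarrow>\<^sub>0 nat" assume "m \<in> {m. mdeg m = 1}"
    then have "(\<Sum>i\<in>UNIV. Poly_Mapping.lookup m i) = Suc 0" by (simp add: mdeg_def)
    then obtain i where i: "Poly_Mapping.lookup m i = Suc 0" "\<And>j. i \<noteq> j \<Longrightarrow> Poly_Mapping.lookup m j = 0"
      by (subst (asm) sum_eq_Suc0_iff) auto
    have "m = Poly_Mapping.single i 1"
      using i by (intro poly_mapping_eqI) (auto simp: lookup_single when_def)
    then show "m \<in> range (\<lambda>i. Poly_Mapping.single i 1)" by blast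
  qed (auto simp: mdeg_def lookup_single when_def)
qed

text \<open>Variables count from \<open>0\<close> here and the degrees \<open>a\<close> from
  \<open>1\<close>. Beyond \<open>t\<close>, \<open>Suc D\<close> is the length of the products
  gained by truncation, and it excludes nothing in degrees up to \<open>D\<close>; the maximum with
  \<open>a t\<close> keeps the bounds increasing.\<close>

definition bounds :: "nat \<Rightarrow> (nat \<Rightarrow> nat) \<Rightarrow> nat \<Rightarrow> nat \<Rightarrow> nat" where
  "bounds t a D i = (if i < t then a (Suc i) else max (a t) (Suc D))"

lemma admissible_of_regular_sequence:
  fixes M I :: "('n::finite, 'k::field) mpoly set"
  assumes a: "mono_on {1..t} a"
    and M: "totally_reducible M"
    and f_reg: "regular_sequence t f"
    and f_deg: "\<And>i. i \<in> {1..t} \<Longrightarrow> f i \<in> forms (a i)"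
    and f_M: "f ` {1..t} \<subseteq> M"
    and I: "hideal I"
    and M_I: "M \<subseteq> I"
  shows "t \<le> CARD('n)" and "admissible CARD('n) (bounds t a D) (hilbert (upto_degree D I))"
proof -
  have dim1: "mpoly.dim (forms 1 :: ('n, 'k) mpoly set) = CARD('n)"
    using dim_forms[where 'n = 'n and 'k = 'k, of 1] card_mdeg_1[where 'n = 'n] by simp
  have "\<exists>G. (\<forall>g\<in>G. \<exists>ls. set ls \<subseteq> forms 1 \<and> g = prod_list ls) \<and> M = ideal.span G"
    using M unfolding totally_reducible_def by (rule conjunct2)
  then obtain G where G': "\<forall>g\<in>G. \<exists>ls. set ls \<subseteq> forms 1 \<and> g = prod_list ls" and GM: "M = ideal.span G"
    by (elim exE conjE) (rule that)
  note G = bspec[OF G'] GM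
  have codim: "i \<le> mpoly.dim L"
    if i: "i \<le> t" "0 < i" and L: "mpoly.subspace L" "L \<subseteq> forms 1"
      and hit: "\<And>ls. set ls \<subseteq> forms 1 \<Longrightarrow> prod_list ls \<in> M \<Longrightarrow> length ls \<le> a i \<Longrightarrow> set ls \<inter> L \<noteq> {}" for i L
  proof (rule regular_sequence_le_dim[of i f a, OF _ _ L])
    show "g \<in> ideal.span (f ` {1..<j})" if "j \<in> {1..i}" "f j * g \<in> ideal.span (f ` {1..<j})" for j g
    proof -
      have "j \<in> {1..t}" using that(1) i by simp
      then show ?thesis using f_reg that(2) unfolding regular_sequence_def by blast
    qed
    show "f j \<in> forms (a j)" if "j \<in> {1..i}" for j using f_deg that i by auto
    show "f ` {1..i} \<subseteq> ideal.span L"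
    proof
      fix p assume "p \<in> f ` {1..i}"
      then obtain j where j: "j \<in> {1..i}" "p = f j" by blast
      have jt: "j \<in> {1..t}" using j i by simp
      have "a j \<le> a i" using mono_onD[OF a jt, of i] j i by simp
      then show "p \<in> ideal.span L"
        unfolding j(2) using f_M f_deg[OF jt] jt
        by (intro form_in_span_of_factors[OF G(2,1) hit, where d = "a j"]) auto
    qed
  qed
  show tn: "t \<le> CARD('n)"
  proof (cases "t = 0")
    case False
    have "M \<noteq> UNIV" using M by (simp add: totally_reducible_def graded_ideal_def)
    \<comment> \<open>The space of all linear forms meets every product in \<open>M\<close>, since
      \<open>M\<close> is proper and so misses the empty product.\<close>
    have "t \<le> mpoly.dim (forms 1 :: ('n, 'k) mpoly set)"
    proof (rule codim)
      fix ls :: "('n, 'k) mpoly list" assume ls: "set ls \<subseteq> forms 1" "prod_list ls \<in> M"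
      have "ls \<noteq> []"
      proof
        assume "ls = []"
        then have "1 \<in> M" using ls by simp
        then have "x * 1 \<in> M" for x unfolding G(2) by (rule ideal.span_scale)
        then show False using \<open>M \<noteq> UNIV\<close> by auto
      qed
      then show "set ls \<inter> forms 1 \<noteq> {}" using ls by (cases ls) auto
    qed (use False subspace_forms in auto)
    then show ?thesis using dim1 by simp
  qed simp
  let ?I = "upto_degree D I" and ?c = "bounds t a D"
  have sI: "ideal.subspace I" by (rule hideal_subspace[OF I])
  show "admissible CARD('n) ?c (hilbert ?I)"
  proof (rule hilbert_admissible[of "{0}" _ _ "{ls. set ls \<subseteq> forms 1 \<and> prod_list ls \<in> ?I}"])
    show "mpoly.subspace {0 :: ('n, 'k) mpoly}" by simp
    show "{0 :: ('n, 'k) mpoly} \<subseteq> forms 1" by (simp add: forms_def)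
    show "mpoly.dim {0 :: ('n, 'k) mpoly} + CARD('n) = mpoly.dim (forms 1 :: ('n, 'k) mpoly set)"
      using dim1 by (simp add: dim_zero)
    show hI: "hideal ?I" by (rule hideal_upto_degree[OF I])
    show "{0} \<subseteq> ?I" using ideal.subspace_0[OF hideal_subspace[OF hI]] by simp
    show "set ls \<subseteq> forms 1 \<and> prod_list ls \<in> ?I" if "ls \<in> {ls. set ls \<subseteq> forms 1 \<and> prod_list ls \<in> ?I}" for ls
      using that by blast
    show "?c i \<le> ?c j" if "i < j" "j < CARD('n)" for i j
    proof -
      have "a x \<le> a y" if "1 \<le> x" "x \<le> y" "y \<le> t" for x y using a that by (auto simp: mono_on_def)
      from this[of "Suc i" "Suc j"] this[of "Suc i" t] show ?thesis using \<open>i < j\<close> by (auto simp: bounds_def)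
    qed
    fix i L assume i: "i < CARD('n)" and L: "mpoly.subspace L" "{0} \<subseteq> L" "L \<subseteq> forms 1"
      and hit: "\<forall>ls\<in>{ls. set ls \<subseteq> forms 1 \<and> prod_list ls \<in> ?I}. length ls \<le> ?c i \<longrightarrow> set ls \<inter> L \<noteq> {}"
    have "Suc i \<le> mpoly.dim L"
    proof (cases "i < t")
      case True
      show ?thesis
      proof (rule codim[OF _ _ L(1,3)])
        fix ls assume "set ls \<subseteq> forms 1" "prod_list ls \<in> M" "length ls \<le> a (Suc i)"
        then show "set ls \<inter> L \<noteq> {}"
          using hit True M_I subset_upto_degree[OF I, of D] by (auto simp: bounds_def)
      qed (use True in auto)
    next
      case False
      \<comment> \<open>A linear form outside \<open>L\<close> would have its power of exponent
        \<open>Suc D\<close> in the truncated ideal for degree reasons, a product without factor in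
        \<open>L\<close>.\<close>
      have "L = forms 1"
      proof (rule ccontr)
        assume "L \<noteq> forms 1"
        then obtain l where l: "l \<in> forms 1" "l \<notin> L" using L by blast
        define ls where "ls = replicate (Suc D) l"
        have ls: "set ls = {l}" "length ls = Suc D"
          unfolding ls_def by (rule set_replicate) simp_all
        then have "prod_list ls \<in> forms (Suc D)" using prod_list_forms[of ls] l by simp
        then have "prod_list ls \<in> ?I" using forms_upto_degree[OF sI, of D "Suc D"] by blast
        moreover have "length ls \<le> ?c i" using False ls by (simp add: bounds_def)
        moreover have "set ls \<subseteq> forms 1" using l ls by simp
        ultimately have "set ls \<inter> L \<noteq> {}" using hit by blast
        then show False using l ls by simp
      qed
      then show ?thesis using dim1 i by simp
    qed
    then show "mpoly.dim {0 :: ('n, 'k) mpoly} + Suc i \<le> mpoly.dim L" by (simp add: dim_zero)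
  qed
qed

text \<open>The bounds vary with the degree. Those for parameter \<open>Suc d\<close> restrict the
  later variables neither in degree \<open>d\<close> nor in degree \<open>Suc d\<close>, so segments
  chosen separately in each degree can be compared with the shadows from the degree below.\<close>

lemma exists_lex_segments:
  fixes I :: "('n::finite, 'k::field) mpoly set"
  assumes I: "hideal I"
    and adm: "\<And>D. admissible n (bounds t a D) (hilbert (upto_degree D I))"
  defines "b \<equiv> \<lambda>d. box n (bounds t a (Suc d)) d"
  obtains A where "\<And>d. A d \<subseteq> b d" "\<And>d. card (A d) + hilbert I d = card (b d)"
    "\<And>d. shadow n (bounds t a (Suc d)) (A d) \<subseteq> A (Suc d)"
proof -
  have box_eq: "box n (bounds t a (Suc d)) (Suc d) = b (Suc d)" for d
  proof -
    have "w i \<le> Suc d" if "(\<Sum>i<n. w i) = Suc d" "i < n" for w :: "nat \<Rightarrow> nat" and i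
      using member_le_sum[of i "{..<n}" w] that by simp
    then have "w i < bounds t a (Suc d) i \<longleftrightarrow> w i < bounds t a (Suc (Suc d)) i"
      if "(\<Sum>i<n. w i) = Suc d" "i < n" for w :: "nat \<Rightarrow> nat" and i
      using that by (fastforce simp: bounds_def less_Suc_eq_le max_def)
    then show ?thesis unfolding b_def box_def by blast
  qed
  have le: "hilbert I d \<le> card (b d)" for d
    using adm[of "Suc d"] hilbert_upto_degree[OF I, of d "Suc d"] unfolding admissible_def b_def by (metis le_SucI le_refl)
  have "\<exists>A. \<forall>d. lexup n (bounds t a (Suc d)) d (A d) \<and> card (A d) = card (b d) - hilbert I d"
    unfolding b_def by (intro choice allI lexup_exists) simp
  then obtain A where A: "\<And>d. lexup n (bounds t a (Suc d)) d (A d)" "\<And>d. card (A d) = card (b d) - hilbert I d"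
    by blast
  have card: "card (A d) + hilbert I d = card (b d)" for d using A(2) le by simp
  have "shadow n (bounds t a (Suc d)) (A d) \<subseteq> A (Suc d)" for d
  proof -
    let ?c = "bounds t a (Suc d)"
    have "lexup n ?c (Suc d) (A (Suc d))"
      using A(1)[of "Suc d"] box_eq[of d] unfolding lexup_def b_def by simp
    moreover have "lexup n ?c (Suc d) (shadow n ?c (A d))" by (rule lexup_shadow[OF A(1)])
    moreover have "card (shadow n ?c (A d)) \<le> card (A (Suc d))"
    proof -
      have "card (A d) + hilbert (upto_degree (Suc d) I) d = card (box n ?c d)"
        using card[of d] hilbert_upto_degree[OF I, of d "Suc d"] by (simp add: b_def)
      then have "card (shadow n ?c (A d)) + hilbert (upto_degree (Suc d) I) (Suc d) \<le> card (box n ?c (Suc d))"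
        using adm[of "Suc d"] A(1)[of d] unfolding admissible_def by blast
      then show ?thesis using card[of "Suc d"] hilbert_upto_degree[OF I, of "Suc d" "Suc d"] box_eq[of d] by simp
    qed
    ultimately show ?thesis using lexup_subset_iff by blast
  qed
  then show ?thesis using that[of A] A(1) card unfolding lexup_def b_def by blast
qed

section \<open>From sets of exponent vectors to monomial ideals\<close>

lemma Var_power: "Var i ^ k = Poly_Mapping.single (Poly_Mapping.single i k) 1"
  by (induction k) (simp_all add: Var_def mult_single flip: single_add)

lemma monomial_ideal:
  fixes E :: "('n::finite \<Rightarrow>\<^sub>0 nat) set"
  assumes E: "\<And>m i. m \<in> E \<Longrightarrow> m + Poly_Mapping.single i 1 \<in> E"
  defines "J \<equiv> {p :: ('n, 'k::field) mpoly. Poly_Mapping.keys p \<subseteq> E}"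
  shows "J = ideal.span ((\<lambda>m. Poly_Mapping.single m 1) ` E)"
    and "hilbert J d = card {m. mdeg m = d \<and> m \<notin> E}"
proof -
  have up: "m + x \<in> E" if "m \<in> E" "mdeg x = k" for m x k
    using that
  proof (induction k arbitrary: m x)
    case 0
    then have "x = 0" by (intro poly_mapping_eqI) (simp add: mdeg_def)
    then show ?case using 0 by simp
  next
    case (Suc k)
    then have "\<exists>i. 0 < Poly_Mapping.lookup x i" by (metis gr_zeroI mdeg_def nat.distinct(1) sum.neutral)
    then obtain i where i: "0 < Poly_Mapping.lookup x i" by blast
    let ?y = "x - Poly_Mapping.single i 1"
    have x: "x = Poly_Mapping.single i 1 + ?y"
      using i by (intro poly_mapping_eqI) (auto simp: lookup_add lookup_minus lookup_single when_def)
    have "mdeg (Poly_Mapping.single i 1 :: 'n \<Rightarrow>\<^sub>0 nat) = 1" by (simp add: mdeg_def lookup_single when_def)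
    then have "mdeg ?y = k" using Suc.prems(2) mdeg_add[of "Poly_Mapping.single i 1" ?y] x by simp
    then have "(m + Poly_Mapping.single i 1) + ?y \<in> E" by (intro Suc.IH E Suc.prems)
    then show ?case using x by (metis add.assoc)
  qed
  have sJ: "ideal.subspace J"
  proof (rule ideal.subspaceI)
    show "0 \<in> J" by (simp add: J_def)
    show "p + q \<in> J" if "p \<in> J" "q \<in> J" for p q
      using that Poly_Mapping.keys_add[of p q] by (auto simp: J_def)
    show "c * p \<in> J" if "p \<in> J" for c p
      using that keys_mult[of p c] up by (fastforce simp: J_def mult.commute[of c])
  qed
  let ?G = "(\<lambda>m. Poly_Mapping.single m 1) ` E :: ('n, 'k) mpoly set"
  show "J = ideal.span ?G"
  proof (intro equalityI ideal.span_minimal sJ)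
    have "mpoly.span ?G \<subseteq> ideal.span ?G"
      by (intro mpoly.span_minimal mpoly_subspace_ideal) (auto intro: ideal.span_base)
    then show "J \<subseteq> ideal.span ?G" by (simp add: J_def span_monomials)
  qed (auto simp: J_def)
  have "J \<inter> forms d = {p. Poly_Mapping.keys p \<subseteq> E \<inter> {m. mdeg m = d}}" by (auto simp: J_def forms_def)
  then have "hilbert J d + card (E \<inter> {m. mdeg m = d}) = card {m :: 'n \<Rightarrow>\<^sub>0 nat. mdeg m = d}"
    using hilbert_eq[OF sJ, of d] by (simp only: dim_keys_subset dim_forms)
  moreover have "card {m :: 'n \<Rightarrow>\<^sub>0 nat. mdeg m = d} =
      card {m. mdeg m = d \<and> m \<notin> E} + card (E \<inter> {m. mdeg m = d})"
  proof -
    have "{m :: 'n \<Rightarrow>\<^sub>0 nat. mdeg m = d} = {m. mdeg m = d \<and> m \<notin> E} \<union> (E \<inter> {m. mdeg m = d})" by blast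
    moreover have "card ({m. mdeg m = d \<and> m \<notin> E} \<union> (E \<inter> {m. mdeg m = d})) =
        card {m. mdeg m = d \<and> m \<notin> E} + card (E \<inter> {m. mdeg m = d})"
      using finite_mdeg[of d, where 'n = 'n] by (intro card_Un_disjoint) auto
    ultimately show ?thesis by metis
  qed
  ultimately show "hilbert J d = card {m. mdeg m = d \<and> m \<notin> E}" by simp
qed

text \<open>Renumbers from \<open>0\<close>, as \<open>box\<close> does, whereas
  \<open>\<iota>\<close> names the variables from \<open>1\<close>.\<close>

definition exponents :: "(nat \<Rightarrow> 'n) \<Rightarrow> ('n::finite \<Rightarrow>\<^sub>0 nat) \<Rightarrow> nat \<Rightarrow> nat" where
  "exponents \<iota> m i = (if i < CARD('n) then Poly_Mapping.lookup m (\<iota> (Suc i)) else 0)"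

lemma exponents_facts:
  fixes \<iota> :: "nat \<Rightarrow> 'n::finite"
  assumes \<iota>: "bij_betw \<iota> {1..CARD('n)} UNIV"
  shows "(\<Sum>i<CARD('n). exponents \<iota> m i) = mdeg m"
    and "bij_betw (exponents \<iota>) UNIV {w. \<forall>i\<ge>CARD('n). w i = 0}"
    and "j < CARD('n) \<Longrightarrow> exponents \<iota> (m + Poly_Mapping.single (\<iota> (Suc j)) 1) =
      (exponents \<iota> m)(j := Suc (exponents \<iota> m j))"
proof -
  let ?n = "CARD('n)"
  have "bij_betw Suc {..<?n} {1..?n}" by (rule bij_betw_byWitness[where f' = "\<lambda>i. i - 1"]) auto
  from bij_betw_trans[OF this \<iota>] have b: "bij_betw (\<lambda>i. \<iota> (Suc i)) {..<?n} UNIV" by (simp add: o_def)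
  have "(\<Sum>i<?n. exponents \<iota> m i) = (\<Sum>i<?n. Poly_Mapping.lookup m (\<iota> (Suc i)))"
    by (rule sum.cong) (auto simp: exponents_def)
  also have "\<dots> = mdeg m" unfolding mdeg_def by (rule sum.reindex_bij_betw[OF b])
  finally show "(\<Sum>i<?n. exponents \<iota> m i) = mdeg m" .
  have inv: "\<exists>i<?n. x = \<iota> (Suc i)" for x using b unfolding bij_betw_def by blast
  show "bij_betw (exponents \<iota>) UNIV {w. \<forall>i\<ge>?n. w i = 0}"
  proof (rule bij_betw_imageI)
    show "inj (exponents \<iota>)"
    proof (rule injI, rule poly_mapping_eqI)
      fix m m' x assume eq: "exponents \<iota> m = exponents \<iota> m'"
      obtain i where "i < ?n" "x = \<iota> (Suc i)" using inv by blast
      then show "Poly_Mapping.lookup m x = Poly_Mapping.lookup m' x"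
        using fun_cong[OF eq, of i] by (simp add: exponents_def)
    qed
    show "range (exponents \<iota>) = {w. \<forall>i\<ge>?n. w i = 0}"
    proof (intro equalityI subsetI)
      fix w :: "nat \<Rightarrow> nat" assume w: "w \<in> {w. \<forall>i\<ge>?n. w i = 0}"
      define g where "g = inv_into {..<?n} (\<lambda>i. \<iota> (Suc i))"
      have g: "g (\<iota> (Suc i)) = i" if "i < ?n" for i
        using inv_into_f_f[of "\<lambda>i. \<iota> (Suc i)" "{..<?n}" i] b that by (simp add: g_def bij_betw_def)
      have "exponents \<iota> (Abs_poly_mapping (\<lambda>x. w (g x))) i = w i" for i
        using w g[of i] by (auto simp: exponents_def lookup_Abs_poly_mapping)
      then have "exponents \<iota> (Abs_poly_mapping (\<lambda>x. w (g x))) = w" by (rule ext)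
      then show "w \<in> range (exponents \<iota>)" by (metis rangeI)
    qed (auto simp: exponents_def)
  qed
  assume j: "j < ?n"
  have "\<iota> (Suc j) = \<iota> (Suc i) \<longleftrightarrow> i = j" if "i < ?n" for i
    using b j that unfolding bij_betw_def inj_on_def by auto
  then show "exponents \<iota> (m + Poly_Mapping.single (\<iota> (Suc j)) 1) = (exponents \<iota> m)(j := Suc (exponents \<iota> m j))"
    using j by (auto simp: exponents_def fun_eq_iff lookup_add lookup_single when_def)
qed

theorem theorem3p4:
  fixes \<iota> :: "nat \<Rightarrow> 'n::finite"
    and t :: nat
    and a :: "nat \<Rightarrow> nat"
    and f :: "nat \<Rightarrow> ('n, 'k::field) mpoly"
    and M I :: "('n, 'k) mpoly set"
  assumes vars: "bij_betw \<iota> {1..CARD('n)} UNIV"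
    and t: "t \<ge> 1"
    and a: "mono_on {1..t} a"
    and M: "totally_reducible M"
    and f_reg: "regular_sequence t f"
    and f_deg: "\<And>i. i \<in> {1..t} \<Longrightarrow> f i \<in> forms (a i)"
    and f_M: "f ` {1..t} \<subseteq> M"
    and I: "graded_ideal I"
    and M_I: "M \<subseteq> I"
  shows "\<exists>J :: ('n, 'k) mpoly set. graded_ideal J \<and> (\<forall>i\<in>{1..t}. Var (\<iota> i) ^ a i \<in> J) \<and>
           (\<forall>d. hilbert I d = hilbert J d)"
proof -
  let ?n = "CARD('n)"
  have hI: "hideal I" by (rule graded_ideal_hideal[OF I])
  note reg = admissible_of_regular_sequence[OF a M f_reg f_deg f_M hI M_I]
  have tn: "t \<le> ?n" using reg(1) by blast
  obtain A where A: "\<And>d. A d \<subseteq> box ?n (bounds t a (Suc d)) d"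
      "\<And>d. card (A d) + hilbert I d = card (box ?n (bounds t a (Suc d)) d)"
      "\<And>d. shadow ?n (bounds t a (Suc d)) (A d) \<subseteq> A (Suc d)"
    using exists_lex_segments[OF hI, of ?n t a] reg(2) by blast
  note \<phi> = exponents_facts[OF vars]
  have exp_le: "exponents \<iota> m i \<le> mdeg m" for m i
    using member_le_sum[of i "{..<?n}" "exponents \<iota> m"] \<phi>(1)[of m] by (cases "i < ?n") (auto simp: exponents_def)
  \<comment> \<open>Beyond \<open>t\<close> the bound is at least \<open>mdeg m + 2\<close>, so only
    the prescribed powers of the first \<open>t\<close> variables can push \<open>m\<close> out of
    the box.\<close>
  have in_box: "exponents \<iota> m \<in> box ?n (bounds t a (Suc (mdeg m))) (mdeg m) \<longleftrightarrow> \<not> (\<exists>i<t. a (Suc i) \<le> exponents \<iota> m i)" for m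
  proof -
    have "exponents \<iota> m i < bounds t a (Suc (mdeg m)) i \<longleftrightarrow> (i < t \<longrightarrow> exponents \<iota> m i < a (Suc i))" for i
      using exp_le[of m i] by (auto simp: bounds_def)
    moreover have "\<forall>i\<ge>?n. exponents \<iota> m i = 0" by (simp add: exponents_def)
    ultimately show ?thesis using \<phi>(1)[of m] tn unfolding box_def mem_Collect_eq by (meson less_le_trans not_le)
  qed
  \<comment> \<open>The first condition collects the monomials outside the box, which forces the
    prescribed powers into \<open>J\<close>. The standard monomials of degree \<open>d\<close> then
    correspond to the box minus \<open>A d\<close>.\<close>
  define E where "E = {m. (\<exists>i<t. a (Suc i) \<le> exponents \<iota> m i) \<or> exponents \<iota> m \<in> A (mdeg m)}"
  have E: "m + Poly_Mapping.single x 1 \<in> E" if m: "m \<in> E" for m x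
  proof -
    obtain j where "j \<in> {1..?n}" "x = \<iota> j" using vars unfolding bij_betw_def by blast
    then have "j - 1 < ?n \<and> x = \<iota> (Suc (j - 1))" by auto
    then obtain i where i: "i < ?n" "x = \<iota> (Suc i)" by blast
    let ?m = "m + Poly_Mapping.single x 1"
    have e: "exponents \<iota> ?m = (exponents \<iota> m)(i := Suc (exponents \<iota> m i))" using \<phi>(3)[OF i(1)] i(2) by simp
    have d: "mdeg ?m = Suc (mdeg m)" by (simp add: mdeg_add) (simp add: mdeg_def lookup_single when_def)
    show ?thesis
    proof (cases "\<exists>i<t. a (Suc i) \<le> exponents \<iota> ?m i")
      case True
      then show ?thesis by (simp add: E_def)
    next
      case False
      have "\<not> (\<exists>i<t. a (Suc i) \<le> exponents \<iota> m i)"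
      proof
        assume "\<exists>i<t. a (Suc i) \<le> exponents \<iota> m i"
        then obtain l where "l < t" "a (Suc l) \<le> exponents \<iota> m l" by blast
        then show False using False unfolding e by (metis fun_upd_apply le_Suc_eq)
      qed
      then have "exponents \<iota> m \<in> A (mdeg m)" using m unfolding E_def by blast
      moreover have "Suc (exponents \<iota> m i) < bounds t a (Suc (mdeg m)) i"
      proof (cases "i < t")
        case True
        then have "\<not> a (Suc i) \<le> exponents \<iota> ?m i" using False by blast
        then show ?thesis using True unfolding e by (simp add: bounds_def)
      qed (use exp_le[of m i] in \<open>auto simp: bounds_def\<close>)
      ultimately have "exponents \<iota> ?m \<in> shadow ?n (bounds t a (Suc (mdeg m))) (A (mdeg m))"
        unfolding e using i(1) by (intro shadowI)
      then show ?thesis using A(3) d by (auto simp: E_def)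
    qed
  qed
  define J where "J = {p :: ('n, 'k) mpoly. Poly_Mapping.keys p \<subseteq> E}"
  have J_span: "J = ideal.span ((\<lambda>m. Poly_Mapping.single m 1) ` E)" unfolding J_def by (rule monomial_ideal(1)[OF E])
  have H: "hilbert I d = hilbert J d" for d
  proof -
    let ?b = "box ?n (bounds t a (Suc d)) d"
    have "bij_betw (exponents \<iota>) {m. mdeg m = d \<and> m \<notin> E} (?b - A d)"
    proof (rule bij_betw_imageI)
      show "inj_on (exponents \<iota>) {m. mdeg m = d \<and> m \<notin> E}"
        using \<phi>(2) unfolding bij_betw_def by (auto intro: inj_on_subset)
      show "exponents \<iota> ` {m. mdeg m = d \<and> m \<notin> E} = ?b - A d"
      proof (intro equalityI subsetI)
        fix w assume w: "w \<in> ?b - A d"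
        then have "w \<in> {w. \<forall>i\<ge>?n. w i = 0}" by (simp add: box_def)
        then obtain m where m: "w = exponents \<iota> m" using \<phi>(2) unfolding bij_betw_def by blast
        have "mdeg m = d" using w \<phi>(1)[of m] unfolding m by (simp add: box_def)
        then show "w \<in> exponents \<iota> ` {m. mdeg m = d \<and> m \<notin> E}"
          using w in_box[of m] unfolding m by (auto simp: E_def)
      next
        fix w assume "w \<in> exponents \<iota> ` {m. mdeg m = d \<and> m \<notin> E}"
        then show "w \<in> ?b - A d" using in_box by (auto simp: E_def)
      qed
    qed
    then have "card {m. mdeg m = d \<and> m \<notin> E} = card (?b - A d)" by (rule bij_betw_same_card)
    also have "\<dots> = card ?b - card (A d)" using A(1) by (intro card_Diff_subset finite_subset_box[OF A(1)])
    finally show ?thesis using A(2)[of d] monomial_ideal(2)[OF E, of d, where 'k = 'k] unfolding J_def by simp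
  qed
  \<comment> \<open>Properness is visible in degree \<open>0\<close>: the value zero there would put
    \<open>1\<close> into \<open>I\<close>.\<close>
  have "J \<noteq> UNIV"
  proof
    assume "J = UNIV"
    then have "hilbert I 0 = 0" using H[of 0] by (simp add: hilbert_UNIV)
    then have "mpoly.dim (forms 0 :: ('n, 'k) mpoly set) \<le> mpoly.dim (I \<inter> forms 0)"
      using hilbert_eq[OF hideal_subspace[OF hI], of 0] by simp
    then have "I \<inter> forms 0 = forms 0"
      by (intro subspace_eq_of_dim_le[of _ _ 0] subspace_ideal_forms hideal_subspace[OF hI] subspace_forms) auto
    then have "1 \<in> I" using forms_0_1 by blast
    then have "x * 1 \<in> I" for x by (rule ideal_mult[OF hideal_subspace[OF hI]])
    then show False using I by (auto simp: graded_ideal_def)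
  qed
  moreover have "(\<lambda>m. Poly_Mapping.single m 1) ` E \<subseteq> (\<Union>d. forms d :: ('n, 'k) mpoly set)"
    by (auto simp: forms_def)
  ultimately have "graded_ideal J" using J_span unfolding graded_ideal_def by blast
  moreover have "Var (\<iota> i) ^ a i \<in> J" if i: "i \<in> {1..t}" for i
  proof -
    have "exponents \<iota> (Poly_Mapping.single (\<iota> i) (a i)) (i - 1) = a i"
      using i tn by (auto simp: exponents_def)
    then have "Poly_Mapping.single (\<iota> i) (a i) \<in> E"
      using i unfolding E_def by (auto intro!: exI[of _ "i - 1"])
    then show ?thesis by (simp add: Var_power J_def)
  qed
  ultimately show ?thesis using H by blast
qed

end
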